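(* Let $H$ be a countable group, let $\alpha$ be an automorphism of $H$, and let $H\rtimes\mathbb{Z}$ be the corresponding semidirect product. Let $H\rtimes\mathbb{Z}\curvearrowright X$ be a free continuous action on a compact metric space. Suppose that the restricted action $H\curvearrowright X$ is almost finite. Then the action $H\rtimes\mathbb{Z}\curvearrowright X$ is almost finite.
   Context: In $H\rtimes\mathbb{Z}$ the factor $\mathbb{Z}$ is viewed multiplicatively as the group $\langle g\rangle$ with generator $g$ satisfying $g^m t g^{-m}=\alpha^m(t)$ for all $m\in\mathbb{Z}$ and $t\in H$. For finite subsets $K,F$ of a group $G$ put $\partial_K F=\{t\in G: Kt\cap F\neq\emptyset \text{ and } Kt\cap (G\setminus F)\neq\emptyset\}$. For $\delta>0$, $F$ is $(K,\delta)$-invariant if $|\partial_K F|\le\delta|F|$. Let $G\curvearrowright X$ be a free continuous action of a countable group on a compact metric space. A tower is a pair $(S,V)$ where $S\subseteq G$ is finite (the shape) and $V\subseteq X$ (the base) are such that the sets $sV$ for $s\in S$ (the levels) are pairwise disjoint; it is open if $V$ is open. A castle is a finite collection $\{(S_i,V_i)\}_{i\in I}$ of towers such that the sets $S_iV_i$, $i\in I$, are pairwise disjoint; it is open if each of its towers is open. For $A,B\subseteq X$ write $A\prec B$ (with respect to the $G$-action) if for every closed set $C\subseteq A$ there are finitely many open sets $U_1,\dots,U_n$ which cover $C$ and elements $s_1,\dots,s_n\in G$ such that the sets $s_iU_i$, $i=1,\dots,n$, are pairwise disjoint and contained in $B$. The action $G\curvearrowright X$ is almost finite if for every $n\in\mathbb{N}$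 ($n\geq 1$), finite set $K\subseteq G$, and $\delta>0$ there exist (i) an open castle $\{(S_i,V_i)\}_{i\in I}$ each of whose shapes is $(K,\delta)$-invariant and each of whose levels has diameter less than $\delta$, and (ii) sets $S_i'\subseteq S_i$ such that $|S_i'|\le|S_i|/n$ for every $i\in I$ and $X\setminus\bigsqcup_{i\in I}S_iV_i\prec\bigsqcup_{i\in I}S_i'V_i$. For the restricted action, all of these notions are taken with $H$ as the acting group. *)

theory Defs
  imports "HOL-Analysis.Analysis" "HOL-Algebra.Group_Action" "HOL-Algebra.Elementary_Groups"
begin

section \<open>Semidirect products\<close>

definition semidirect_product ::
  "('h, 'a) monoid_scheme \<Rightarrow> ('k, 'b) monoid_scheme \<Rightarrow> ('k \<Rightarrow> 'h \<Rightarrow> 'h) \<Rightarrow> ('h \<times> 'k) monoid"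
  where "semidirect_product H K \<theta> =
    \<lparr>carrier = carrier H \<times> carrier K,
     monoid.mult = (\<lambda>(s, k) (t, l). (s \<otimes>\<^bsub>H\<^esub> \<theta> k t, k \<otimes>\<^bsub>K\<^esub> l)),
     one = (\<one>\<^bsub>H\<^esub>, \<one>\<^bsub>K\<^esub>)\<rparr>"

text \<open>The pair \<open>(t, m)\<close> stands for \<open>t g\<^sup>m\<close>, where \<open>g = (1, 1)\<close> generates the copy of the
  integers; the subgroup \<open>H\<close> consists of the pairs \<open>(t, 0)\<close>.\<close>

definition semidirect_int ::
  "('h, 'a) monoid_scheme \<Rightarrow> ('h \<Rightarrow> 'h) \<Rightarrow> ('h \<times> int) monoid"
  where "semidirect_int H \<alpha> =
    semidirect_product H integer_group (\<lambda>m. \<alpha> [^]\<^bsub>AutoGroup H\<^esub> m)"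

lemma group_semidirect_product:
  assumes H: "group H" and K: "group K" and \<theta>: "\<theta> \<in> hom K (AutoGroup H)"
  shows "group (semidirect_product H K \<theta>)"
proof -
  interpret H: group H by fact
  interpret K: group K by fact
  interpret \<theta>: group_hom K "AutoGroup H" \<theta>
    using \<theta> H.AutoGroup K by (simp add: group_hom_def group_hom_axioms_def)
  have au: "\<theta> k \<in> auto H" if "k \<in> carrier K" for k
    using \<theta>.hom_closed[OF that] by (simp add: AutoGroup_def)
  have cl: "\<theta> k t \<in> carrier H" if "k \<in> carrier K" "t \<in> carrier H" for k t
    using au[OF that(1)] that(2) by (auto simp: auto_def hom_def)
  have hm: "\<theta> k (s \<otimes>\<^bsub>H\<^esub> t) = \<theta> k s \<otimes>\<^bsub>H\<^esub> \<theta> k t"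
    if "k \<in> carrier K" "s \<in> carrier H" "t \<in> carrier H" for k s t
    using au[OF that(1)] that(2,3) by (auto simp: auto_def hom_def)
  have mu: "\<theta> (k \<otimes>\<^bsub>K\<^esub> l) t = \<theta> k (\<theta> l t)"
    if "k \<in> carrier K" "l \<in> carrier K" "t \<in> carrier H" for k l t
    using \<theta>.hom_mult[OF that(1,2)] au[OF that(1)] au[OF that(2)] that(3)
    by (simp add: AutoGroup_def BijGroup_def auto_def compose_def)
  have on: "\<theta> \<one>\<^bsub>K\<^esub> t = t" if "t \<in> carrier H" for t
    using \<theta>.hom_one that by (simp add: AutoGroup_def BijGroup_def)
  show ?thesis
  proof (rule groupI, goal_cases)
    case (3 x y z)
    then show ?case
      by (auto simp: semidirect_product_def cl hm mu H.m_assoc K.m_assoc simp del: \<theta>.hom_mult)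
  next
    case (5 x)
    then obtain t k where x: "x = (t, k)" "t \<in> carrier H" "k \<in> carrier K"
      by (auto simp: semidirect_product_def)
    let ?y = "(\<theta> (inv\<^bsub>K\<^esub> k) (inv\<^bsub>H\<^esub> t), inv\<^bsub>K\<^esub> k)"
    have 1: "\<theta> (inv\<^bsub>K\<^esub> k) (inv\<^bsub>H\<^esub> t) \<otimes>\<^bsub>H\<^esub> \<theta> (inv\<^bsub>K\<^esub> k) t = \<theta> (inv\<^bsub>K\<^esub> k) \<one>\<^bsub>H\<^esub>"
      using x by (simp add: hm[symmetric] del: \<theta>.hom_inv)
    have 2: "\<theta> (inv\<^bsub>K\<^esub> k) \<one>\<^bsub>H\<^esub> = \<one>\<^bsub>H\<^esub>"
      using hm[of "inv\<^bsub>K\<^esub> k" "\<one>\<^bsub>H\<^esub>" "\<one>\<^bsub>H\<^esub>"] cl[of "inv\<^bsub>K\<^esub> k" "\<one>\<^bsub>H\<^esub>"] x by (simp del: \<theta>.hom_inv)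
    show ?case
      by (rule bexI[of _ ?y]) (use x in \<open>auto simp: semidirect_product_def cl 1 2 simp del: \<theta>.hom_inv\<close>)
  qed (auto simp: semidirect_product_def cl on simp del: \<theta>.hom_one)
qed

lemma group_semidirect_int:
  assumes H: "group H" and \<alpha>: "\<alpha> \<in> auto H"
  shows "group (semidirect_int H \<alpha>)"
proof -
  interpret A: group "AutoGroup H" using group.AutoGroup[OF H] .
  have "\<alpha> \<in> carrier (AutoGroup H)" using \<alpha> by (simp add: AutoGroup_def)
  then have "(\<lambda>m::int. \<alpha> [^]\<^bsub>AutoGroup H\<^esub> m) \<in> hom integer_group (AutoGroup H)"
    by (auto simp: hom_def A.int_pow_mult)
  then show ?thesis
    unfolding semidirect_int_def by (intro group_semidirect_product H group_integer_group)
qed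

lemma semidirect_int_conjugation:
  assumes H: "group H" and \<alpha>: "\<alpha> \<in> auto H" and t: "t \<in> carrier H"
  defines "G \<equiv> semidirect_int H \<alpha>"
  defines "g \<equiv> (\<one>\<^bsub>H\<^esub>, 1)"
  shows "g [^]\<^bsub>G\<^esub> (m::int) \<otimes>\<^bsub>G\<^esub> (t, 0) \<otimes>\<^bsub>G\<^esub> g [^]\<^bsub>G\<^esub> (- m)
    = ((\<alpha> [^]\<^bsub>AutoGroup H\<^esub> m) t, 0)"
proof -
  interpret H: group H by fact
  interpret G: group G unfolding G_def by (rule group_semidirect_int[OF H \<alpha>])
  interpret A: group "AutoGroup H" using group.AutoGroup[OF H] .
  have au: "\<alpha> [^]\<^bsub>AutoGroup H\<^esub> m \<in> auto H" for m :: int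
    using A.int_pow_closed[of \<alpha> m] \<alpha> by (simp add: AutoGroup_def)
  have cl: "(\<alpha> [^]\<^bsub>AutoGroup H\<^esub> m) t \<in> carrier H" if "t \<in> carrier H" for m :: int and t
    using au that by (auto simp: auto_def hom_def)
  have one: "(\<alpha> [^]\<^bsub>AutoGroup H\<^esub> m) \<one>\<^bsub>H\<^esub> = \<one>\<^bsub>H\<^esub>" for m :: int
    using au[of m] H by (auto simp: auto_def intro: hom_one)
  have g: "g \<in> carrier G" by (simp add: g_def G_def semidirect_int_def semidirect_product_def)
  have "(\<lambda>m. (\<one>\<^bsub>H\<^esub>, m)) \<in> hom integer_group G"
    by (auto simp: hom_def G_def semidirect_int_def semidirect_product_def one)
  then interpret h: group_hom integer_group G "\<lambda>m. (\<one>\<^bsub>H\<^esub>, m)"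
    by (simp add: group_hom_def group_hom_axioms_def G.is_group)
  have pow: "g [^]\<^bsub>G\<^esub> m = (\<one>\<^bsub>H\<^esub>, m)" for m :: int
    using h.hom_int_pow[of 1 m] by (simp add: g_def)
  show ?thesis
    using t by (simp add: pow) (simp add: G_def semidirect_int_def semidirect_product_def one cl)
qed


section \<open>Free continuous actions\<close>

locale free_continuous_action = group_action G X \<phi>
  for G (structure) and X :: "'x::metric_space set" and \<phi> +
  assumes compact_space: "compact X"
    and continuous: "g \<in> carrier G \<Longrightarrow> continuous_on X (\<phi> g)"
    and free: "x \<in> X \<Longrightarrow> stabilizer G \<phi> x = {\<one>}"


section \<open>Almost finiteness\<close>

definition Folner_boundary :: "('g, 'a) monoid_scheme \<Rightarrow> 'g set \<Rightarrow> 'g set \<Rightarrow> 'g set"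
  where "Folner_boundary G K F =
    {t \<in> carrier G. (K #>\<^bsub>G\<^esub> t) \<inter> F \<noteq> {} \<and> (K #>\<^bsub>G\<^esub> t) \<inter> (carrier G - F) \<noteq> {}}"

text \<open>For finite \<open>K\<close> and \<open>F\<close> the boundary is finite, so \<^const>\<open>card\<close> is its true cardinality.\<close>

definition Folner_invariant :: "('g, 'a) monoid_scheme \<Rightarrow> 'g set \<Rightarrow> real \<Rightarrow> 'g set \<Rightarrow> bool"
  where "Folner_invariant G K \<delta> F \<longleftrightarrow> real (card (Folner_boundary G K F)) \<le> \<delta> * real (card F)"

lemma finite_Folner_boundary:
  assumes G: "group G" and K: "finite K" "K \<subseteq> carrier G" and F: "finite F" "F \<subseteq> carrier G"
  shows "finite (Folner_boundary G K F)"
proof (rule finite_subset)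
  interpret group G by fact
  show "Folner_boundary G K F \<subseteq> (\<lambda>(k, f). inv\<^bsub>G\<^esub> k \<otimes>\<^bsub>G\<^esub> f) ` (K \<times> F)"
  proof
    fix t assume "t \<in> Folner_boundary G K F"
    then obtain k where k: "t \<in> carrier G" "k \<in> K" "k \<otimes>\<^bsub>G\<^esub> t \<in> F"
      by (auto simp: Folner_boundary_def r_coset_def)
    then have "t = inv\<^bsub>G\<^esub> k \<otimes>\<^bsub>G\<^esub> (k \<otimes>\<^bsub>G\<^esub> t)"
      using K by (auto simp: m_assoc[symmetric])
    then show "t \<in> (\<lambda>(k, f). inv\<^bsub>G\<^esub> k \<otimes>\<^bsub>G\<^esub> f) ` (K \<times> F)"
      using k by (force simp: image_iff)
  qed
qed (use K F in auto)

definition translates :: "('g \<Rightarrow> 'x \<Rightarrow> 'x) \<Rightarrow> 'g set \<Rightarrow> 'x set \<Rightarrow> 'x set"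
  where "translates \<phi> S V = (\<Union>s\<in>S. \<phi> s ` V)"

definition tower ::
  "('g, 'a) monoid_scheme \<Rightarrow> 'x set \<Rightarrow> ('g \<Rightarrow> 'x \<Rightarrow> 'x) \<Rightarrow> 'g set \<Rightarrow> 'x set \<Rightarrow> bool"
  where "tower G X \<phi> S V \<longleftrightarrow>
    finite S \<and> S \<subseteq> carrier G \<and> V \<subseteq> X \<and> disjoint_family_on (\<lambda>s. \<phi> s ` V) S"

definition castle ::
  "('g, 'a) monoid_scheme \<Rightarrow> 'x set \<Rightarrow> ('g \<Rightarrow> 'x \<Rightarrow> 'x) \<Rightarrow>
    'i set \<Rightarrow> ('i \<Rightarrow> 'g set) \<Rightarrow> ('i \<Rightarrow> 'x set) \<Rightarrow> bool"
  where "castle G X \<phi> I S V \<longleftrightarrow>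
    finite I \<and> (\<forall>i\<in>I. tower G X \<phi> (S i) (V i)) \<and>
    disjoint_family_on (\<lambda>i. translates \<phi> (S i) (V i)) I"

text \<open>Open and closed sets are those of the subspace topology of \<open>X\<close>.\<close>

definition open_castle ::
  "('g, 'a) monoid_scheme \<Rightarrow> 'x::metric_space set \<Rightarrow> ('g \<Rightarrow> 'x \<Rightarrow> 'x) \<Rightarrow>
    'i set \<Rightarrow> ('i \<Rightarrow> 'g set) \<Rightarrow> ('i \<Rightarrow> 'x set) \<Rightarrow> bool"
  where "open_castle G X \<phi> I S V \<longleftrightarrow>
    castle G X \<phi> I S V \<and> (\<forall>i\<in>I. openin (top_of_set X) (V i))"

definition subequivalent ::
  "('g, 'a) monoid_scheme \<Rightarrow> 'x::metric_space set \<Rightarrow> ('g \<Rightarrow> 'x \<Rightarrow> 'x) \<Rightarrow>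
    'x set \<Rightarrow> 'x set \<Rightarrow> bool"
  where "subequivalent G X \<phi> A B \<longleftrightarrow>
    (\<forall>C. closedin (top_of_set X) C \<and> C \<subseteq> A \<longrightarrow>
      (\<exists>(n::nat) U s.
        (\<forall>i<n. openin (top_of_set X) (U i) \<and> s i \<in> carrier G \<and> \<phi> (s i) ` U i \<subseteq> B) \<and>
        C \<subseteq> (\<Union>i<n. U i) \<and>
        disjoint_family_on (\<lambda>i. \<phi> (s i) ` U i) {..<n}))"

definition almost_finite ::
  "('g, 'a) monoid_scheme \<Rightarrow> 'x::metric_space set \<Rightarrow> ('g \<Rightarrow> 'x \<Rightarrow> 'x) \<Rightarrow> bool"
  where "almost_finite G X \<phi> \<longleftrightarrow>
    (\<forall>(n::nat) K (\<delta>::real). n \<ge> 1 \<and> finite K \<and> K \<subseteq> carrier G \<and> \<delta> > 0 \<longrightarrow>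
      (\<exists>(I::nat set) S V S'.
        open_castle G X \<phi> I S V \<and>
        (\<forall>i\<in>I. Folner_invariant G K \<delta> (S i)) \<and>
        (\<forall>i\<in>I. \<forall>s\<in>S i. diameter (\<phi> s ` V i) < \<delta>) \<and>
        (\<forall>i\<in>I. S' i \<subseteq> S i \<and> real (card (S' i)) \<le> real (card (S i)) / real n) \<and>
        subequivalent G X \<phi>
          (X - (\<Union>i\<in>I. translates \<phi> (S i) (V i)))
          (\<Union>i\<in>I. translates \<phi> (S' i) (V i))))"

end

theory Submission
  imports Defs
begin

text \<open>Write \<open>N\<close> for the copy of \<open>H\<close> in \<open>G = H \<rtimes> \<int>\<close> and measure subsets of \<open>X\<close> by their
  densities along Folner subsets of \<open>N\<close>; the relation \<open>f \<lesssim>\<^sub>N h\<close> means \<open>f \<le> h + \<epsilon>\<close> for all sufficiently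
  invariant sets. Almost finiteness of \<open>N\<close> yields (a) arbitrarily many sets whose boundary
  has density zero, and (b) comparison: a uniform density gap between a closed and an open set implies
  subequivalence already under \<open>N\<close>.

  The action of \<open>\<int>\<close> on the space of \<open>N\<close>-orbits is then treated like a zero-dimensional system. The
  tiles of a very invariant \<open>N\<close>-castle are coloured greedily with boundedly many colours (the number
  does not depend on the tiles) so that a tile and its translates by \<open>\<gamma> k\<close>, \<open>0 < \<bar>k\<bar> \<le> h\<close>, rarely
  have the same colour. Processing the colours one after another gives a marker set \<open>W\<close> that is
  disjoint from its translates by \<open>\<gamma> k\<close>, whose translates cover \<open>X\<close> up to small density, and which
  is nearly \<open>N\<close>-invariant. The columns over \<open>W\<close>, grouped along a still more invariant \<open>N\<close>-castle,
  form a castle for \<open>G\<close>. Its remainder has small density along every \<open>N\<close>-orbit, so comparison for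
  \<open>N\<close> places it into a fixed small proportion of the levels. If \<open>N\<close> is finite, small density
  forces the remainder to be empty.\<close>

text \<open>Densities along \<open>N\<close> are not preserved by \<open>\<gamma> k\<close>, since
  conjugation changes the Folner set and the base point; only bounds uniform over all Folner sets
  and points can be moved. Hence all error sets are bounded by constants, and the absorbing levels
  are chosen separately at each height of a column, as different heights may carry different
  densities. The second obstacle is the order of choices. The marker set must be nearly invariant
  under a finite set conjugated by every \<open>\<gamma> k\<close> in the window of the marker rule,
  and this window grows with the number of colours. So that number is fixed before the castle.
  Translates of one tile may meet many others, so avoiding every conflict gives no such bound;
  tolerating conflicts of small density lets a pigeonhole count suffice. Third, \<open>X\<close>
  need not be zero-dimensional: cuts have boundaries, whose density zero replaces emptiness, and
  what they lose joins the remainder. Taking an \<open>n\<close>-th part of each height loses fewer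
  than \<open>n\<close> elements, which is negligible only for large tiles; this is why finite
  \<open>N\<close> is treated apart.\<close>

lemma subequivalent_empty: "subequivalent K X \<phi> {} B"
  unfolding subequivalent_def
  by (intro allI impI exI[of _ "0::nat"] exI[of _ "\<lambda>_. {}"] exI[of _ undefined])
    (auto simp: disjoint_family_on_def)

text \<open>The semidirect product in internal form: one group contains \<open>N\<close> and all
  \<open>\<gamma> k\<close>, so the conjugations that twist densities are products in
  \<open>G\<close>. The assumption \<open>nonempty\<close> lets \<open>ev_exists\<close> extract
  invariant sets from a castle.\<close>

locale cyclic_extension = group G for G (structure) +
  fixes N :: "'g set" and \<gamma> :: "int \<Rightarrow> 'g" and X :: "'x::metric_space set"
    and \<phi> :: "'g \<Rightarrow> 'x \<Rightarrow> 'x"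
  assumes normal: "N \<lhd> G"
    and gam_closed [simp, intro]: "\<gamma> k \<in> carrier G"
    and gam_add: "\<gamma> (k + l) = \<gamma> k \<otimes> \<gamma> l"
    and gam_N: "\<gamma> k \<in> N \<Longrightarrow> k = 0"
    and decomp: "a \<in> carrier G \<Longrightarrow> \<exists>t\<in>N. \<exists>k. a = t \<otimes> \<gamma> k"
    and compact: "compact X" and nonempty: "X \<noteq> {}"
    and act_closed [simp, intro]: "a \<in> carrier G \<Longrightarrow> x \<in> X \<Longrightarrow> \<phi> a x \<in> X"
    and act_mult: "a \<in> carrier G \<Longrightarrow> b \<in> carrier G \<Longrightarrow> x \<in> X \<Longrightarrow> \<phi> (a \<otimes> b) x = \<phi> a (\<phi> b x)"
    and act_one [simp]: "x \<in> X \<Longrightarrow> \<phi> \<one> x = x"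
    and act_free: "a \<in> carrier G \<Longrightarrow> x \<in> X \<Longrightarrow> \<phi> a x = x \<Longrightarrow> a = \<one>"
    and act_cont: "a \<in> carrier G \<Longrightarrow> continuous_on X (\<phi> a)"
    and almost_finite_N: "almost_finite (G\<lparr>carrier := N\<rparr>) X \<phi>"
begin

lemma N_subgroup: "subgroup N G"
  using normal by (rule normal_imp_subgroup)

lemma N_sub: "N \<subseteq> carrier G"
  by (rule subgroup.subset[OF N_subgroup])

lemma N_carrier [simp, intro]: "t \<in> N \<Longrightarrow> t \<in> carrier G"
  using N_sub by blast

lemma N_one [simp, intro]: "\<one> \<in> N"
  by (rule subgroup.one_closed[OF N_subgroup])

lemma N_mult [simp, intro]: "s \<in> N \<Longrightarrow> t \<in> N \<Longrightarrow> s \<otimes> t \<in> N"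
  by (rule subgroup.m_closed[OF N_subgroup])

lemma N_inv [simp, intro]: "s \<in> N \<Longrightarrow> inv s \<in> N"
  by (rule subgroup.m_inv_closed[OF N_subgroup])

lemma N_conj: "a \<in> carrier G \<Longrightarrow> t \<in> N \<Longrightarrow> a \<otimes> t \<otimes> inv a \<in> N"
  by (rule normal.inv_op_closed2[OF normal])

lemma N_conj': "a \<in> carrier G \<Longrightarrow> t \<in> N \<Longrightarrow> inv a \<otimes> t \<otimes> a \<in> N"
  by (rule normal.inv_op_closed1[OF normal])

lemma gam_0 [simp]: "\<gamma> 0 = \<one>"
  using gam_add[of 0 0] by (metis add_0 gam_closed r_cancel_one')

lemma gam_minus: "\<gamma> (- k) = inv (\<gamma> k)"
  using gam_add[of "- k" k] by (simp add: inv_equality)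

lemma act_gam: "x \<in> X \<Longrightarrow> \<phi> (\<gamma> k) (\<phi> (\<gamma> l) x) = \<phi> (\<gamma> (k + l)) x"
  by (simp add: gam_add act_mult)

lemma act_inv [simp]: "a \<in> carrier G \<Longrightarrow> x \<in> X \<Longrightarrow> \<phi> (inv a) (\<phi> a x) = x"
  by (simp flip: act_mult)

lemma act_inv' [simp]: "a \<in> carrier G \<Longrightarrow> x \<in> X \<Longrightarrow> \<phi> a (\<phi> (inv a) x) = x"
  by (simp flip: act_mult)

lemma act_inj: "a \<in> carrier G \<Longrightarrow> x \<in> X \<Longrightarrow> y \<in> X \<Longrightarrow> \<phi> a x = \<phi> a y \<Longrightarrow> x = y"
  by (metis act_inv)

text \<open>The translate of \<open>A\<close> by \<open>a\<close>, written as a preimage: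
  topological properties then follow from continuity, and \<open>A\<close> may stick out of
  \<open>X\<close>. For \<open>A \<subseteq> X\<close> it is the image, by
  \<open>tr_image\<close>.\<close>

definition tr :: "'g \<Rightarrow> 'x set \<Rightarrow> 'x set"
  where "tr a A = {x \<in> X. \<phi> (inv a) x \<in> A}"

lemma mem_tr_inv: "a \<in> carrier G \<Longrightarrow> x \<in> tr (inv a) A \<longleftrightarrow> x \<in> X \<and> \<phi> a x \<in> A"
  by (auto simp: tr_def)

lemma tr_image: "a \<in> carrier G \<Longrightarrow> A \<subseteq> X \<Longrightarrow> tr a A = \<phi> a ` A"
  by (auto simp: tr_def image_iff subset_iff) (metis act_inv')

lemma mem_tr_act: "a \<in> carrier G \<Longrightarrow> x \<in> X \<Longrightarrow> \<phi> a x \<in> tr a A \<longleftrightarrow> x \<in> A"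
  by (auto simp: tr_def)

lemma openin_tr:
  assumes "a \<in> carrier G" "openin (top_of_set X) U" shows "openin (top_of_set X) (tr a U)"
proof -
  have "tr a U = X \<inter> \<phi> (inv a) -` U" by (auto simp: tr_def)
  then show ?thesis
    using assms continuous_openin_preimage[OF act_cont, of "inv a" X U] by auto
qed

lemma closedin_tr:
  assumes "a \<in> carrier G" "closedin (top_of_set X) U" shows "closedin (top_of_set X) (tr a U)"
proof -
  have "tr a U = X \<inter> \<phi> (inv a) -` U" by (auto simp: tr_def)
  then show ?thesis
    using assms continuous_closedin_preimage_gen[OF act_cont, of "inv a" X U] by auto
qed


section \<open>Densities along the normal subgroup\<close>

text \<open>Counted inside \<open>F\<close> and for left multiplication, the form in which
  translated and conjugated densities are estimated.
  \<open>inner_boundary_sub_Folner_boundary\<close> and \<open>card_Folner_boundary_le\<close> link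
  it with the boundary in the definition of almost finiteness.\<close>

definition inner_boundary :: "'g set \<Rightarrow> 'g set \<Rightarrow> 'g set"
  where "inner_boundary K F = {f \<in> F. \<exists>k\<in>K. k \<otimes> f \<notin> F}"

definition Folner :: "'g set \<Rightarrow> real \<Rightarrow> 'g set \<Rightarrow> bool"
  where "Folner K \<delta> F \<longleftrightarrow> finite F \<and> F \<noteq> {} \<and> F \<subseteq> N \<and>
    real (card (inner_boundary K F)) \<le> \<delta> * real (card F)"

lemma inner_boundary_mono: "K \<subseteq> K' \<Longrightarrow> inner_boundary K F \<subseteq> inner_boundary K' F"
  by (auto simp: inner_boundary_def)

lemma Folner_mono:
  assumes "Folner K' \<delta>' F" "K \<subseteq> K'" "\<delta>' \<le> \<delta>" shows "Folner K \<delta> F"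
proof -
  have "card (inner_boundary K F) \<le> card (inner_boundary K' F)"
    using assms by (intro card_mono inner_boundary_mono) (auto simp: Folner_def inner_boundary_def)
  moreover have "\<delta>' * real (card F) \<le> \<delta> * real (card F)"
    using assms by (simp add: mult_right_mono)
  ultimately show ?thesis using assms unfolding Folner_def by linarith
qed

text \<open>Eventual truth along the Folner sets of \<open>N\<close>. Uniformity in the base point
  plays the part that quantification over all \<open>N\<close>-invariant probability measures would
  play.\<close>

definition ev :: "('g set \<Rightarrow> 'x \<Rightarrow> bool) \<Rightarrow> bool"
  where "ev P \<longleftrightarrow> (\<exists>K \<delta>. finite K \<and> K \<subseteq> N \<and> \<delta> > 0 \<and> (\<forall>F x. Folner K \<delta> F \<longrightarrow> x \<in> X \<longrightarrow> P F x))"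

lemma evI:
  assumes "finite K" "K \<subseteq> N" "\<delta> > 0" "\<And>F x. Folner K \<delta> F \<Longrightarrow> x \<in> X \<Longrightarrow> P F x"
  shows "ev P"
  using assms unfolding ev_def by blast

lemma ev_all:
  assumes "\<And>F x. finite F \<Longrightarrow> F \<noteq> {} \<Longrightarrow> F \<subseteq> N \<Longrightarrow> x \<in> X \<Longrightarrow> P F x" shows "ev P"
  by (rule evI[of "{}" 1]) (auto simp: Folner_def intro: assms)

lemma ev_mono:
  assumes "ev P" "\<And>F x. finite F \<Longrightarrow> F \<noteq> {} \<Longrightarrow> F \<subseteq> N \<Longrightarrow> x \<in> X \<Longrightarrow> P F x \<Longrightarrow> Q F x" shows "ev Q"
  using assms unfolding ev_def Folner_def by meson

lemma ev_conj:
  assumes "ev P" "ev Q" shows "ev (\<lambda>F x. P F x \<and> Q F x)"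
proof -
  obtain K d where 1: "finite K" "K \<subseteq> N" "d > 0" "\<And>F x. Folner K d F \<Longrightarrow> x \<in> X \<Longrightarrow> P F x"
    using assms(1) unfolding ev_def by blast
  obtain K' d' where 2: "finite K'" "K' \<subseteq> N" "d' > 0" "\<And>F x. Folner K' d' F \<Longrightarrow> x \<in> X \<Longrightarrow> Q F x"
    using assms(2) unfolding ev_def by blast
  show ?thesis
  proof (rule evI[of "K \<union> K'" "min d d'"])
    fix F x assume F: "Folner (K \<union> K') (min d d') F" and x: "x \<in> X"
    have "Folner K d F" "Folner K' d' F" using F by (auto elim: Folner_mono)
    then show "P F x \<and> Q F x" using 1 2 x by blast
  qed (use 1 2 in auto)
qed

definition dens :: "'x set \<Rightarrow> 'g set \<Rightarrow> 'x \<Rightarrow> real"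
  where "dens A F x = real (card {t \<in> F. \<phi> t x \<in> A}) / real (card F)"

definition lesim :: "('g set \<Rightarrow> 'x \<Rightarrow> real) \<Rightarrow> ('g set \<Rightarrow> 'x \<Rightarrow> real) \<Rightarrow> bool" (infix "\<lesssim>\<^sub>N" 50)
  where "f \<lesssim>\<^sub>N h \<longleftrightarrow> (\<forall>\<epsilon>>0. ev (\<lambda>F x. f F x \<le> h F x + \<epsilon>))"

lemma lesim_all:
  assumes "\<And>F x. finite F \<Longrightarrow> F \<noteq> {} \<Longrightarrow> F \<subseteq> N \<Longrightarrow> x \<in> X \<Longrightarrow> f F x \<le> h F x" shows "f \<lesssim>\<^sub>N h"
  unfolding lesim_def by (intro allI impI ev_all) (use assms in \<open>fastforce intro: order_trans\<close>)

lemma lesim_refl: "f \<lesssim>\<^sub>N f" by (rule lesim_all) simp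

lemma lesim_trans [trans]:
  assumes "f \<lesssim>\<^sub>N h" "h \<lesssim>\<^sub>N k" shows "f \<lesssim>\<^sub>N k"
  unfolding lesim_def
proof (intro allI impI)
  fix e :: real assume "e > 0"
  then have "ev (\<lambda>F x. f F x \<le> h F x + e/2 \<and> h F x \<le> k F x + e/2)"
    using assms unfolding lesim_def by (intro ev_conj) auto
  then show "ev (\<lambda>F x. f F x \<le> k F x + e)" by (rule ev_mono) simp
qed

lemma lesim_le [trans]:
  assumes "f \<lesssim>\<^sub>N h" "\<And>F x. finite F \<Longrightarrow> F \<noteq> {} \<Longrightarrow> F \<subseteq> N \<Longrightarrow> x \<in> X \<Longrightarrow> h F x \<le> k F x" shows "f \<lesssim>\<^sub>N k"
  by (rule lesim_trans[OF assms(1) lesim_all[OF assms(2)]])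

lemma le_lesim:
  assumes "\<And>F x. finite F \<Longrightarrow> F \<noteq> {} \<Longrightarrow> F \<subseteq> N \<Longrightarrow> x \<in> X \<Longrightarrow> f F x \<le> h F x" "h \<lesssim>\<^sub>N k" shows "f \<lesssim>\<^sub>N k"
  by (rule lesim_trans[OF lesim_all[OF assms(1)] assms(2)])

lemma lesim_add:
  assumes "f \<lesssim>\<^sub>N h" "f' \<lesssim>\<^sub>N h'" shows "(\<lambda>F x. f F x + f' F x) \<lesssim>\<^sub>N (\<lambda>F x. h F x + h' F x)"
  unfolding lesim_def
proof (intro allI impI)
  fix e :: real assume "e > 0"
  then have "ev (\<lambda>F x. f F x \<le> h F x + e/2 \<and> f' F x \<le> h' F x + e/2)"
    using assms unfolding lesim_def by (intro ev_conj) auto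
  then show "ev (\<lambda>F x. f F x + f' F x \<le> h F x + h' F x + e)" by (rule ev_mono) simp
qed

lemma lesim_cmult:
  assumes "f \<lesssim>\<^sub>N h" "c \<ge> 0" shows "(\<lambda>F x. c * f F x) \<lesssim>\<^sub>N (\<lambda>F x. c * h F x)"
proof (cases "c = 0")
  case False
  then have c: "c > 0" using assms by simp
  show ?thesis unfolding lesim_def
  proof (intro allI impI)
    fix e :: real assume "e > 0"
    then have "ev (\<lambda>F x. f F x \<le> h F x + e/c)" using assms c unfolding lesim_def by simp
    then show "ev (\<lambda>F x. c * f F x \<le> c * h F x + e)"
      by (rule ev_mono) (use c in \<open>simp add: field_simps\<close>)
  qed
qed (simp add: lesim_refl)

lemma lesim_sum:
  assumes "finite I" "\<And>i. i \<in> I \<Longrightarrow> f i \<lesssim>\<^sub>N h i"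
  shows "(\<lambda>F x. \<Sum>i\<in>I. f i F x) \<lesssim>\<^sub>N (\<lambda>F x. \<Sum>i\<in>I. h i F x)"
  using assms
proof (induction I rule: finite_induct)
  case (insert i I)
  then show ?case using lesim_add[of "f i" "h i"] by simp
qed (simp add: lesim_refl)

lemma dens_nonneg: "dens A F x \<ge> 0" by (simp add: dens_def)

lemma dens_le1: "finite F \<Longrightarrow> dens A F x \<le> 1"
  by (auto simp: dens_def divide_le_eq intro!: card_mono)

lemma dens_X: "finite F \<Longrightarrow> F \<noteq> {} \<Longrightarrow> F \<subseteq> N \<Longrightarrow> x \<in> X \<Longrightarrow> dens X F x = 1"
proof -
  assume a: "finite F" "F \<noteq> {}" "F \<subseteq> N" "x \<in> X"
  then have "{t \<in> F. \<phi> t x \<in> X} = F" by auto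
  then show ?thesis using a by (simp add: dens_def)
qed

lemma dens_empty: "dens {} F x = 0" by (simp add: dens_def)

lemma dens_mono:
  assumes "finite F" "F \<subseteq> N" "x \<in> X" "A \<inter> X \<subseteq> B" shows "dens A F x \<le> dens B F x"
  unfolding dens_def using assms by (intro divide_right_mono) (auto intro!: card_mono)

lemma dens_Un: "finite F \<Longrightarrow> dens (A \<union> B) F x \<le> dens A F x + dens B F x"
proof -
  assume F: "finite F"
  have "{t \<in> F. \<phi> t x \<in> A \<union> B} = {t \<in> F. \<phi> t x \<in> A} \<union> {t \<in> F. \<phi> t x \<in> B}" by auto
  then have "card {t \<in> F. \<phi> t x \<in> A \<union> B} \<le> card {t \<in> F. \<phi> t x \<in> A} + card {t \<in> F. \<phi> t x \<in> B}"
    by (simp add: card_Un_le)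
  then show ?thesis
    unfolding dens_def add_divide_distrib[symmetric] by (intro divide_right_mono) linarith+
qed

lemma dens_UN:
  assumes "finite I" "finite F" shows "dens (\<Union>i\<in>I. A i) F x \<le> (\<Sum>i\<in>I. dens (A i) F x)"
  using assms
proof (induction I rule: finite_induct)
  case (insert i I)
  then show ?case using dens_Un[of F "A i" "\<Union>i\<in>I. A i" x] by simp
qed (simp add: dens_empty)

lemma dens_UN_disjoint:
  assumes "finite I" "finite F" "F \<subseteq> N" "x \<in> X"
    "\<And>i j y. i \<in> I \<Longrightarrow> j \<in> I \<Longrightarrow> y \<in> X \<Longrightarrow> y \<in> A i \<Longrightarrow> y \<in> A j \<Longrightarrow> i = j"
  shows "dens (\<Union>i\<in>I. A i) F x = (\<Sum>i\<in>I. dens (A i) F x)"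
proof -
  have "{t \<in> F. \<phi> t x \<in> (\<Union>i\<in>I. A i)} = (\<Union>i\<in>I. {t \<in> F. \<phi> t x \<in> A i})" by auto
  moreover have "card \<dots> = (\<Sum>i\<in>I. card {t \<in> F. \<phi> t x \<in> A i})"
  proof (rule card_UN_disjoint)
    show "\<forall>i\<in>I. \<forall>j\<in>I. i \<noteq> j \<longrightarrow> {t \<in> F. \<phi> t x \<in> A i} \<inter> {t \<in> F. \<phi> t x \<in> A j} = {}"
      using assms(3-5) by blast
  qed (use assms in auto)
  ultimately show ?thesis by (simp add: dens_def sum_divide_distrib)
qed

lemma card_sum_swap:
  assumes "finite S" "finite T"
  shows "(\<Sum>s\<in>S. card {t\<in>T. P s t}) = (\<Sum>t\<in>T. card {s\<in>S. P s t})"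
proof -
  have "(\<Sum>s\<in>S. card {t\<in>T. P s t}) = (\<Sum>s\<in>S. \<Sum>t\<in>T. if P s t then 1 else 0)"
    using assms by (intro sum.cong refl) (simp add: sum.If_cases Int_def)
  also have "\<dots> = (\<Sum>t\<in>T. \<Sum>s\<in>S. if P s t then 1 else 0)" by (rule sum.swap)
  also have "\<dots> = (\<Sum>t\<in>T. card {s\<in>S. P s t})"
    using assms by (intro sum.cong refl) (simp add: sum.If_cases Int_def)
  finally show ?thesis .
qed

text \<open>Left multiplication by \<open>inv s\<close> turns visits to \<open>tr s A\<close>
  injectively into visits to \<open>A\<close>, and it leaves \<open>F\<close> only at inner boundary
  points.\<close>

lemma dens_translate:
  assumes s: "s \<in> N" shows "dens (tr s A) \<lesssim>\<^sub>N dens A"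
  unfolding lesim_def
proof (intro allI impI)
  fix e :: real assume e: "e > 0"
  show "ev (\<lambda>F x. dens (tr s A) F x \<le> dens A F x + e)"
  proof (rule evI[of "{inv s}" e])
    fix F x assume F: "Folner {inv s} e F" and x: "x \<in> X"
    have fin: "finite F" "F \<noteq> {}" "F \<subseteq> N"
      and b: "card (inner_boundary {inv s} F) \<le> e * card F" using F by (auto simp: Folner_def)
    have Fc: "f \<in> carrier G" if "f \<in> F" for f using that fin by auto
    let ?A = "{t \<in> F. \<phi> t x \<in> tr s A}" and ?B = "{t \<in> F. \<phi> t x \<in> A}"
    have "(\<otimes>) (inv s) ` (?A - inner_boundary {inv s} F) \<subseteq> ?B"
      using s x Fc by (auto simp: inner_boundary_def tr_def act_mult)
    moreover have "inj_on ((\<otimes>) (inv s)) (?A - inner_boundary {inv s} F)"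
      using s Fc by (auto intro!: inj_onI)
    ultimately have "card (?A - inner_boundary {inv s} F) \<le> card ?B"
      using fin card_inj_on_le[of "(\<otimes>) (inv s)"] by simp
    moreover have "card ?A \<le> card (?A - inner_boundary {inv s} F) + card (inner_boundary {inv s} F)"
      using fin by (metis (no_types, lifting) add.commute diff_card_le_card_Diff finite_subset
          inner_boundary_def le_diff_conv mem_Collect_eq subsetI)
    ultimately have "real (card ?A) \<le> card ?B + e * card F" using b by linarith
    moreover have "real (card F) > 0" using fin by (simp add: card_gt_0_iff)
    ultimately show "dens (tr s A) F x \<le> dens A F x + e"
      unfolding dens_def by (simp add: field_simps)
  qed (use s e in auto)
qed

lemma tr_tr: "a \<in> carrier G \<Longrightarrow> b \<in> carrier G \<Longrightarrow> tr a (tr b A) = tr (a \<otimes> b) A"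
  by (auto simp: tr_def inv_mult_group act_mult)

lemma dens_cong: "F \<subseteq> N \<Longrightarrow> x \<in> X \<Longrightarrow> A \<inter> X = B \<inter> X \<Longrightarrow> dens A F x = dens B F x"
proof -
  assume a: "F \<subseteq> N" "x \<in> X" "A \<inter> X = B \<inter> X"
  then have "{t \<in> F. \<phi> t x \<in> A} = {t \<in> F. \<phi> t x \<in> B}" by blast
  then show ?thesis by (simp add: dens_def)
qed

lemma dens_translate':
  assumes s: "s \<in> N" shows "dens A \<lesssim>\<^sub>N dens (tr s A)"
proof (rule le_lesim[OF _ dens_translate[of "inv s" "tr s A"]])
  fix F x assume "F \<subseteq> N" "x \<in> X"
  then show "dens A F x \<le> dens (tr (inv s) (tr s A)) F x"
    using s by (intro dens_cong[THEN eq_refl]) (auto simp: tr_tr tr_def)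
qed (use s in auto)

text \<open>Conjugation by an element of \<open>G\<close> permutes the Folner sets of \<open>N\<close>, so uniform bounds on
  densities survive arbitrary translations, although densities themselves do not.\<close>

lemma ev_conjugate:
  assumes a: "a \<in> carrier G" and P: "ev P"
  shows "ev (\<lambda>F x. P ((\<lambda>t. inv a \<otimes> t \<otimes> a) ` F) (\<phi> (inv a) x))"
proof -
  let ?c = "\<lambda>t. inv a \<otimes> t \<otimes> a" and ?d = "\<lambda>t. a \<otimes> t \<otimes> inv a"
  obtain K d where K: "finite K" "K \<subseteq> N" "d > 0" "\<And>F x. Folner K d F \<Longrightarrow> x \<in> X \<Longrightarrow> P F x"
    using P unfolding ev_def by blast
  have cd: "?c (?d t) = t" if "t \<in> carrier G" for t
    using a that by (simp add: m_assoc) (simp flip: m_assoc)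
  have cm: "?c (s \<otimes> t) = ?c s \<otimes> ?c t" if "s \<in> carrier G" "t \<in> carrier G" for s t
    using a that by (simp add: m_assoc) (simp flip: m_assoc)
  have inj: "inj_on ?c N"
    using a by (auto intro!: inj_onI simp: m_assoc)
  show ?thesis
  proof (rule evI[of "?d ` K" d])
    fix F x assume F: "Folner (?d ` K) d F" and x: "x \<in> X"
    have fin: "finite F" "F \<noteq> {}" "F \<subseteq> N"
      and b: "card (inner_boundary (?d ` K) F) \<le> d * card F" using F by (auto simp: Folner_def)
    have sub: "inner_boundary K (?c ` F) \<subseteq> ?c ` inner_boundary (?d ` K) F"
    proof
      fix y assume "y \<in> inner_boundary K (?c ` F)"
      then obtain f k where f: "f \<in> F" "y = ?c f" "k \<in> K" "k \<otimes> ?c f \<notin> ?c ` F"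
        by (auto simp: inner_boundary_def)
      have "?c (?d k \<otimes> f) = k \<otimes> ?c f"
        using cm[of "?d k" f] cd[of k] f(1,3) fin K(2) a by (simp add: subset_iff)
      then have "?d k \<otimes> f \<notin> F" using f(4) by (metis imageI)
      then show "y \<in> ?c ` inner_boundary (?d ` K) F" using f by (auto simp: inner_boundary_def)
    qed
    have "card (inner_boundary K (?c ` F)) \<le> card (?c ` inner_boundary (?d ` K) F)"
      using fin by (intro card_mono sub) (auto simp: inner_boundary_def)
    also have "\<dots> \<le> card (inner_boundary (?d ` K) F)"
      using fin by (intro card_image_le) (auto simp: inner_boundary_def)
    finally have "card (inner_boundary K (?c ` F)) \<le> d * card F" using b by linarith
    moreover have "card (?c ` F) = card F"
      using inj fin by (meson card_image inj_on_subset)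
    ultimately have "Folner K d (?c ` F)"
      using fin a by (auto simp: Folner_def intro: N_conj')
    then show "P (?c ` F) (\<phi> (inv a) x)" using K(4) x a by simp
  qed (use K a in \<open>auto intro: N_conj\<close>)
qed

lemma dens_conjugate:
  assumes a: "a \<in> carrier G" and F: "F \<subseteq> N" and x: "x \<in> X"
  shows "dens (tr a A) F x = dens A ((\<lambda>t. inv a \<otimes> t \<otimes> a) ` F) (\<phi> (inv a) x)"
proof -
  let ?c = "\<lambda>t. inv a \<otimes> t \<otimes> a"
  have inj: "inj_on ?c F"
    using a F by (auto intro!: inj_onI simp: m_assoc subset_iff)
  have eq: "\<phi> (?c t) (\<phi> (inv a) x) = \<phi> (inv a) (\<phi> t x)" if "t \<in> F" for t
    using that F a x by (simp add: act_mult subset_iff)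
  have "{s \<in> ?c ` F. \<phi> s (\<phi> (inv a) x) \<in> A} = ?c ` {t \<in> F. \<phi> t x \<in> tr a A}"
    using eq F x by (force simp: tr_def)
  then show ?thesis
    using inj by (simp add: dens_def card_image inj_on_subset[OF inj])
qed

lemma dens_tr_le_const:
  assumes "a \<in> carrier G" "dens A \<lesssim>\<^sub>N (\<lambda>_ _. c)" shows "dens (tr a A) \<lesssim>\<^sub>N (\<lambda>_ _. c)"
  unfolding lesim_def
proof (intro allI impI)
  fix e :: real assume "e > 0"
  then have "ev (\<lambda>F x. dens A F x \<le> c + e)" using assms(2) by (simp add: lesim_def)
  from ev_conjugate[OF assms(1) this] show "ev (\<lambda>F x. dens (tr a A) F x \<le> c + e)"
    by (rule ev_mono) (simp add: dens_conjugate[OF assms(1)])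
qed

text \<open>Double counting over \<open>F\<close> and \<open>E\<close>: summing over
  \<open>t \<in> F\<close> the densities along \<open>E\<close> of the translates by
  \<open>inv t\<close> is the same as summing over \<open>s \<in> E\<close> the densities along
  \<open>F\<close> at \<open>\<phi> s x\<close>. The former are all nearly the density of the set
  itself. So a gap seen at every point by one finite set is seen by all sufficiently invariant
  sets.\<close>

lemma dens_average:
  assumes F: "finite F" "F \<noteq> {}" "F \<subseteq> N" and le: "\<And>x. x \<in> X \<Longrightarrow> dens A F x + c \<le> dens B F x"
  shows "(\<lambda>E x. dens A E x + c) \<lesssim>\<^sub>N dens B"
proof -
  let ?n = "real (card F)"
  have n: "?n > 0" using F by (simp add: card_gt_0_iff)
  have sumeq: "(\<Sum>t\<in>F. dens (tr (inv t) A) E x) = ?n * (\<Sum>s\<in>E. dens A F (\<phi> s x)) / card E"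
    if E: "finite E" "E \<subseteq> N" "x \<in> X" for A E x
  proof -
    have "(\<Sum>t\<in>F. card {s\<in>E. \<phi> s x \<in> tr (inv t) A}) = (\<Sum>t\<in>F. card {s\<in>E. \<phi> t (\<phi> s x) \<in> A})"
      using F E by (intro sum.cong refl arg_cong[where f = card] Collect_cong)
        (auto simp: mem_tr_inv subset_iff)
    also have "\<dots> = (\<Sum>s\<in>E. card {t\<in>F. \<phi> t (\<phi> s x) \<in> A})"
      using F E by (intro card_sum_swap)
    finally have "real (\<Sum>t\<in>F. card {s\<in>E. \<phi> s x \<in> tr (inv t) A}) = ?n * (\<Sum>s\<in>E. dens A F (\<phi> s x))"
      using n by (simp add: dens_def sum_distrib_left)
    then show ?thesis by (simp add: dens_def sum_divide_distrib[symmetric])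
  qed
  have "(\<lambda>E x. ?n * dens A E x) \<lesssim>\<^sub>N (\<lambda>E x. \<Sum>t\<in>F. dens (tr (inv t) A) E x)"
    using lesim_sum[OF F(1), of "\<lambda>_. dens A" "\<lambda>t. dens (tr (inv t) A)"] F(3)
    by (simp add: dens_translate' subset_iff)
  from lesim_add[OF this lesim_refl[of "\<lambda>_ _. ?n * c"]]
  have "(\<lambda>E x. ?n * dens A E x + ?n * c) \<lesssim>\<^sub>N (\<lambda>E x. (\<Sum>t\<in>F. dens (tr (inv t) A) E x) + ?n * c)" .
  also have "\<dots> \<lesssim>\<^sub>N (\<lambda>E x. \<Sum>t\<in>F. dens (tr (inv t) B) E x)"
  proof (rule lesim_all)
    fix E x assume E: "finite E" "E \<noteq> {}" "E \<subseteq> N" "x \<in> X"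
    have "(\<Sum>s\<in>E. dens A F (\<phi> s x)) + card E * c = (\<Sum>s\<in>E. dens A F (\<phi> s x) + c)"
      by (simp add: sum.distrib)
    also have "\<dots> \<le> (\<Sum>s\<in>E. dens B F (\<phi> s x))"
      using E by (intro sum_mono le) (auto simp: subset_iff)
    finally have "?n * ((\<Sum>s\<in>E. dens A F (\<phi> s x)) + card E * c) / card E \<le> ?n * (\<Sum>s\<in>E. dens B F (\<phi> s x)) / card E"
      by (intro divide_right_mono mult_left_mono) auto
    then show "(\<Sum>t\<in>F. dens (tr (inv t) A) E x) + ?n * c \<le> (\<Sum>t\<in>F. dens (tr (inv t) B) E x)"
      unfolding sumeq[OF E(1,3,4)] using E by (simp add: field_simps card_gt_0_iff)
  qed
  also have "\<dots> \<lesssim>\<^sub>N (\<lambda>E x. ?n * dens B E x)"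
    using lesim_sum[OF F(1), of "\<lambda>t. dens (tr (inv t) B)" "\<lambda>_. dens B"] F(3)
    by (simp add: dens_translate subset_iff)
  finally have "(\<lambda>E x. (1/?n) * (?n * dens A E x + ?n * c)) \<lesssim>\<^sub>N (\<lambda>E x. (1/?n) * (?n * dens B E x))"
    using n by (intro lesim_cmult) auto
  moreover have "(\<lambda>E x. (1/?n) * (?n * dens A E x + ?n * c)) = (\<lambda>E x. dens A E x + c)"
    "(\<lambda>E x. (1/?n) * (?n * dens B E x)) = dens B"
    using n by (auto simp: fun_eq_iff field_simps)
  ultimately show ?thesis by (simp only:)
qed


section \<open>Castles\<close>

definition tiles :: "'i set \<Rightarrow> ('i \<Rightarrow> 'g set) \<Rightarrow> ('i \<Rightarrow> 'x set) \<Rightarrow> 'x set"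
  where "tiles I T V = (\<Union>i\<in>I. translates \<phi> (T i) (V i))"

lemma mem_tiles: "x \<in> tiles I T V \<longleftrightarrow> (\<exists>i\<in>I. \<exists>t\<in>T i. \<exists>v\<in>V i. x = \<phi> t v)"
  by (auto simp: tiles_def translates_def)

lemma castle_fin:
  assumes "castle G X \<phi> I T V"
  shows "finite I" "\<And>i. i \<in> I \<Longrightarrow> finite (T i)" "\<And>i. i \<in> I \<Longrightarrow> T i \<subseteq> carrier G"
    "\<And>i. i \<in> I \<Longrightarrow> V i \<subseteq> X"
  using assms by (auto simp: castle_def tower_def)

lemma castle_unique:
  assumes c: "castle G X \<phi> I T V" and "i \<in> I" "j \<in> I" "s \<in> T i" "t \<in> T j" "v \<in> V i" "w \<in> V j"
    "\<phi> s v = \<phi> t w"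
  shows "i = j \<and> s = t \<and> v = w"
proof -
  have "\<phi> s v \<in> translates \<phi> (T i) (V i)" "\<phi> t w \<in> translates \<phi> (T j) (V j)"
    using assms(4-7) by (auto simp: translates_def)
  then have "\<phi> s v \<in> translates \<phi> (T i) (V i) \<inter> translates \<phi> (T j) (V j)"
    using assms(8) by simp
  then have ij: "i = j"
    using c assms(2,3) unfolding castle_def disjoint_family_on_def by blast
  have "\<phi> s v \<in> \<phi> s ` V i" "\<phi> t w \<in> \<phi> t ` V i" using assms(6,7) ij by auto
  then have "\<phi> s v \<in> \<phi> s ` V i \<inter> \<phi> t ` V i" using assms(8) by simp
  then have st: "s = t"
    using c assms(2,4,5) ij unfolding castle_def tower_def disjoint_family_on_def by blast
  have "v \<in> X" "w \<in> X" "s \<in> carrier G" using castle_fin(3,4)[OF c] assms(2-7) by blast+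
  then have "v = w" using assms(8) st act_inj by blast
  with ij st show ?thesis by simp
qed

lemma castleI:
  assumes "finite I" "\<And>i. i \<in> I \<Longrightarrow> finite (T i)" "\<And>i. i \<in> I \<Longrightarrow> T i \<subseteq> carrier G"
    "\<And>i. i \<in> I \<Longrightarrow> V i \<subseteq> X"
    and u: "\<And>i j s t v w. i \<in> I \<Longrightarrow> j \<in> I \<Longrightarrow> s \<in> T i \<Longrightarrow> t \<in> T j \<Longrightarrow> v \<in> V i \<Longrightarrow> w \<in> V j \<Longrightarrow>
      \<phi> s v = \<phi> t w \<Longrightarrow> i = j \<and> s = t"
  shows "castle G X \<phi> I T V"
proof -
  have "disjoint_family_on (\<lambda>s. \<phi> s ` V i) (T i)" if "i \<in> I" for i
    unfolding disjoint_family_on_def using u[OF that that] by fastforce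
  moreover have "disjoint_family_on (\<lambda>i. translates \<phi> (T i) (V i)) I"
    unfolding disjoint_family_on_def translates_def using u by fastforce
  ultimately show ?thesis using assms by (simp add: castle_def tower_def)
qed

lemma castle_sub:
  assumes c: "castle G X \<phi> I T V" and "J \<subseteq> I" "\<And>i. i \<in> J \<Longrightarrow> T' i \<subseteq> T i" "\<And>i. i \<in> J \<Longrightarrow> V' i \<subseteq> V i"
  shows "castle G X \<phi> J T' V'"
proof (rule castleI, goal_cases)
  case (5 i j s t v w)
  then show ?case using castle_unique[OF c, of i j s t v w] assms by blast
next
  case (2 i)
  then show ?case using castle_fin(2)[OF c, of i] assms(2,3) finite_subset by blast
next
  case (3 i)
  then show ?case using castle_fin(3)[OF c, of i] assms(2,3) by blast
next
  case (4 i)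
  then show ?case using castle_fin(4)[OF c, of i] assms(2,4) by blast
next
  case 1
  then show ?case using castle_fin(1)[OF c] assms(2) finite_subset by blast
qed

lemma openin_tiles:
  assumes c: "castle G X \<phi> I T V" and "\<And>i. i \<in> I \<Longrightarrow> openin (top_of_set X) (V i)"
  shows "openin (top_of_set X) (tiles I T V)"
proof -
  have "tiles I T V = (\<Union>i\<in>I. \<Union>t\<in>T i. tr t (V i))"
    using castle_fin[OF c] by (force simp: tiles_def translates_def tr_image subset_iff)
  moreover have "openin (top_of_set X) (tr t (V i))" if "i \<in> I" "t \<in> T i" for i t
    using that assms castle_fin(3)[OF c] by (intro openin_tr) auto
  ultimately show ?thesis by (auto intro!: openin_Union)
qed

lemma dens_castle:
  assumes c: "castle G X \<phi> I T V" and F: "finite F" "F \<subseteq> N" "x \<in> X"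
  shows "dens (Y \<inter> tiles I T V) F x =
    (\<Sum>(i, t)\<in>Sigma I T. dens (tr t {v \<in> V i. \<phi> t v \<in> Y}) F x)"
proof -
  have fin: "finite (Sigma I T)" using castle_fin[OF c] by auto
  let ?A = "\<lambda>(i, t). tr t {v \<in> V i. \<phi> t v \<in> Y}"
  have im: "?A (i, t) = \<phi> t ` {v \<in> V i. \<phi> t v \<in> Y}" if "i \<in> I" "t \<in> T i" for i t
    using castle_fin(3,4)[OF c that(1)] that by (simp, intro tr_image) auto
  have "Y \<inter> tiles I T V = (\<Union>p\<in>Sigma I T. ?A p)"
  proof (intro equalityI subsetI)
    fix y assume "y \<in> Y \<inter> tiles I T V"
    then obtain i t v where "i \<in> I" "t \<in> T i" "v \<in> V i" "y = \<phi> t v" "y \<in> Y" by (auto simp: mem_tiles)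
    then have "y \<in> ?A (i, t)" "(i, t) \<in> Sigma I T" using im by auto
    then show "y \<in> (\<Union>p\<in>Sigma I T. ?A p)" by blast
  next
    fix y assume "y \<in> (\<Union>p\<in>Sigma I T. ?A p)"
    then obtain i t where it: "i \<in> I" "t \<in> T i" "y \<in> ?A (i, t)" by blast
    then show "y \<in> Y \<inter> tiles I T V" using im[OF it(1,2)] by (auto simp: mem_tiles)
  qed
  also have "dens \<dots> F x = (\<Sum>p\<in>Sigma I T. dens (?A p) F x)"
  proof (rule dens_UN_disjoint[OF fin F])
    fix p q y assume pq: "p \<in> Sigma I T" "q \<in> Sigma I T" and y: "y \<in> ?A p" "y \<in> ?A q"
    obtain i t j s where [simp]: "p = (i, t)" "q = (j, s)" by fastforce
    have it: "i \<in> I" "t \<in> T i" "j \<in> I" "s \<in> T j" using pq by auto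
    obtain v w where "v \<in> V i" "y = \<phi> t v" "w \<in> V j" "y = \<phi> s w"
      using y im[OF it(1,2)] im[OF it(3,4)] by auto
    then show "p = q" using castle_unique[OF c it(1,3,2,4)] by simp
  qed
  finally show ?thesis by (simp add: case_prod_beta')
qed

text \<open>The levels are disjoint, and as the shapes lie in \<open>N\<close>, each part of a level
  may be moved down to the base without changing its asymptotic density.\<close>

lemma dens_castle_lesim:
  assumes c: "castle G X \<phi> I T V" and N: "\<And>i. i \<in> I \<Longrightarrow> T i \<subseteq> N"
  shows "dens (Y \<inter> tiles I T V) \<lesssim>\<^sub>N (\<lambda>F x. \<Sum>(i, t)\<in>Sigma I T. dens {v \<in> V i. \<phi> t v \<in> Y} F x)"
    (is "_ \<lesssim>\<^sub>N ?S")
    and "(\<lambda>F x. \<Sum>(i, t)\<in>Sigma I T. dens {v \<in> V i. \<phi> t v \<in> Y} F x) \<lesssim>\<^sub>N dens (Y \<inter> tiles I T V)"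
proof -
  have fin: "finite (Sigma I T)" using castle_fin[OF c] by auto
  let ?R = "\<lambda>F x. \<Sum>p\<in>Sigma I T. (case p of (i, t) \<Rightarrow> dens (tr t {v \<in> V i. \<phi> t v \<in> Y})) F x"
  let ?S' = "\<lambda>F x. \<Sum>p\<in>Sigma I T. (case p of (i, t) \<Rightarrow> dens {v \<in> V i. \<phi> t v \<in> Y}) F x"
  have S: "?S = ?S'" by (simp add: case_prod_beta')
  have R: "dens (Y \<inter> tiles I T V) F x = ?R F x" if "finite F" "F \<subseteq> N" "x \<in> X" for F x
    using dens_castle[OF c that] by (simp add: case_prod_beta')
  have "?R \<lesssim>\<^sub>N ?S'"
    by (rule lesim_sum[OF fin]) (use N in \<open>auto intro: dens_translate\<close>)
  then show "dens (Y \<inter> tiles I T V) \<lesssim>\<^sub>N ?S"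
    unfolding S by (rule le_lesim[rotated]) (simp only: R)
  have "?S' \<lesssim>\<^sub>N ?R"
    by (rule lesim_sum[OF fin]) (use N in \<open>auto intro: dens_translate'\<close>)
  then show "?S \<lesssim>\<^sub>N dens (Y \<inter> tiles I T V)"
    unfolding S by (rule lesim_le) (simp only: R)
qed

text \<open>Each visit to a base \<open>V i\<close> stands for a whole tile, so an inequality
  between the counts in every single tile sums up to one between densities. Only \<open>Y\<close>
  has to lie in the tiles: points of \<open>Z\<close> outside merely enlarge the right-hand
  side.\<close>

lemma castle_average:
  fixes b :: real
  assumes c: "castle G X \<phi> I T V" and N: "\<And>i. i \<in> I \<Longrightarrow> T i \<subseteq> N" and b: "b \<ge> 0"
    and Y: "Y \<subseteq> tiles I T V"
    and le: "\<And>i v. i \<in> I \<Longrightarrow> v \<in> V i \<Longrightarrow> card {t \<in> T i. \<phi> t v \<in> Y} \<le> b * card {t \<in> T i. \<phi> t v \<in> Z}"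
  shows "dens Y \<lesssim>\<^sub>N (\<lambda>F x. b * dens Z F x)"
proof -
  note fin = castle_fin[OF c]
  have swap: "(\<Sum>(i, t)\<in>Sigma I T. dens {v \<in> V i. \<phi> t v \<in> Y} F x) =
      (\<Sum>i\<in>I. \<Sum>s\<in>{s \<in> F. \<phi> s x \<in> V i}. real (card {t \<in> T i. \<phi> t (\<phi> s x) \<in> Y})) / card F"
    if "finite F" for F x Y
  proof -
    have "(\<Sum>t\<in>T i. dens {v \<in> V i. \<phi> t v \<in> Y} F x) =
      (\<Sum>s\<in>{s \<in> F. \<phi> s x \<in> V i}. real (card {t \<in> T i. \<phi> t (\<phi> s x) \<in> Y})) / card F" if "i \<in> I" for i
    proof -
      have "(\<Sum>t\<in>T i. card {s \<in> F. \<phi> s x \<in> {v \<in> V i. \<phi> t v \<in> Y}}) =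
        (\<Sum>t\<in>T i. card {s \<in> {s \<in> F. \<phi> s x \<in> V i}. \<phi> t (\<phi> s x) \<in> Y})"
        by (intro sum.cong refl arg_cong[where f = card]) auto
      also have "\<dots> = (\<Sum>s\<in>{s \<in> F. \<phi> s x \<in> V i}. card {t \<in> T i. \<phi> t (\<phi> s x) \<in> Y})"
        using fin that \<open>finite F\<close> by (intro card_sum_swap) auto
      finally show ?thesis unfolding dens_def sum_divide_distrib[symmetric] of_nat_sum[symmetric] by simp
    qed
    then show ?thesis using fin by (simp add: sum.Sigma[symmetric] sum_divide_distrib)
  qed
  have "dens Y \<lesssim>\<^sub>N (\<lambda>F x. \<Sum>(i, t)\<in>Sigma I T. dens {v \<in> V i. \<phi> t v \<in> Y} F x)"
    using dens_castle_lesim(1)[OF c N, of Y] Y by (simp add: Int_absorb2)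
  also have "\<dots> \<lesssim>\<^sub>N (\<lambda>F x. b * (\<Sum>(i, t)\<in>Sigma I T. dens {v \<in> V i. \<phi> t v \<in> Z} F x))"
  proof (rule lesim_all)
    fix F x assume F: "finite F" "F \<noteq> {}" "F \<subseteq> N" "x \<in> X"
    have "(\<Sum>i\<in>I. \<Sum>s\<in>{s \<in> F. \<phi> s x \<in> V i}. real (card {t \<in> T i. \<phi> t (\<phi> s x) \<in> Y}))
      \<le> (\<Sum>i\<in>I. \<Sum>s\<in>{s \<in> F. \<phi> s x \<in> V i}. b * card {t \<in> T i. \<phi> t (\<phi> s x) \<in> Z})"
      by (intro sum_mono le) auto
    then show "(\<Sum>(i, t)\<in>Sigma I T. dens {v \<in> V i. \<phi> t v \<in> Y} F x) \<le> b * (\<Sum>(i, t)\<in>Sigma I T. dens {v \<in> V i. \<phi> t v \<in> Z} F x)"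
      unfolding swap[OF F(1)] by (simp add: sum_distrib_left divide_right_mono)
  qed
  also have "\<dots> \<lesssim>\<^sub>N (\<lambda>F x. b * dens (Z \<inter> tiles I T V) F x)"
    by (rule lesim_cmult[OF dens_castle_lesim(2)[OF c N] b])
  also have "\<dots> \<lesssim>\<^sub>N (\<lambda>F x. b * dens Z F x)"
    by (intro lesim_all mult_left_mono dens_mono b) auto
  finally show ?thesis .
qed

lemma castle_average_const:
  fixes b :: real
  assumes c: "castle G X \<phi> I T V" and N: "\<And>i. i \<in> I \<Longrightarrow> T i \<subseteq> N" and b: "b \<ge> 0"
    and Y: "Y \<subseteq> tiles I T V"
    and le: "\<And>i v. i \<in> I \<Longrightarrow> v \<in> V i \<Longrightarrow> card {t \<in> T i. \<phi> t v \<in> Y} \<le> b * card (T i)"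
  shows "dens Y \<lesssim>\<^sub>N (\<lambda>_ _. b)"
proof (rule lesim_le[OF castle_average[OF c N b Y, of X]])
  fix i v assume iv: "i \<in> I" "v \<in> V i"
  then have "{t \<in> T i. \<phi> t v \<in> X} = T i" using castle_fin[OF c] by blast
  then show "card {t \<in> T i. \<phi> t v \<in> Y} \<le> b * card {t \<in> T i. \<phi> t v \<in> X}" using le[OF iv] by simp
qed (simp_all add: dens_X)

lemma dens_subcastle:
  assumes c: "castle G X \<phi> I T V" and N: "\<And>i. i \<in> I \<Longrightarrow> T i \<subseteq> N" and m: "m \<ge> 1"
    and T': "\<And>i. i \<in> I \<Longrightarrow> T' i \<subseteq> T i" "\<And>i. i \<in> I \<Longrightarrow> real (card (T' i)) \<le> card (T i) / real m"
  shows "dens (tiles I T' V) \<lesssim>\<^sub>N (\<lambda>_ _. 1 / real m)"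
proof (rule castle_average_const[OF c N, where b = "1 / real m"])
  show "tiles I T' V \<subseteq> tiles I T V" using T' by (fastforce simp: mem_tiles)
  fix i v assume iv: "i \<in> I" "v \<in> V i"
  have "{t \<in> T i. \<phi> t v \<in> tiles I T' V} \<subseteq> T' i"
  proof
    fix t assume "t \<in> {t \<in> T i. \<phi> t v \<in> tiles I T' V}"
    then obtain j s w where "t \<in> T i" "j \<in> I" "s \<in> T' j" "w \<in> V j" "\<phi> t v = \<phi> s w"
      by (auto simp: mem_tiles)
    then show "t \<in> T' i" using castle_unique[OF c iv(1), of j t s v w] iv T' by blast
  qed
  then have "card {t \<in> T i. \<phi> t v \<in> tiles I T' V} \<le> card (T' i)"
    using T'(1)[OF iv(1)] castle_fin(2)[OF c iv(1)] by (meson card_mono finite_subset)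
  then show "card {t \<in> T i. \<phi> t v \<in> tiles I T' V} \<le> (1 / real m) * card (T i)"
    using T'(2)[OF iv(1)] by (simp add: field_simps)
qed auto

text \<open>Since \<open>A\<close> is closed it can itself be taken as the set to be covered. The
  pieces are moved by elements of \<open>N\<close>, which keep densities, to disjoint subsets of
  \<open>B\<close>.\<close>

lemma subequivalent_dens:
  assumes A: "closedin (top_of_set X) A" and sub: "subequivalent (G\<lparr>carrier := N\<rparr>) X \<phi> A B"
  shows "dens A \<lesssim>\<^sub>N dens B"
proof -
  obtain n :: nat and U s where
    U': "\<forall>i<n. openin (top_of_set X) (U i) \<and> s i \<in> carrier (G\<lparr>carrier := N\<rparr>) \<and> \<phi> (s i) ` U i \<subseteq> B"
    and cov: "A \<subseteq> (\<Union>i<n. U i)" and dis: "disjoint_family_on (\<lambda>i. \<phi> (s i) ` U i) {..<n}"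
    using sub[unfolded subequivalent_def, rule_format, of A] A by blast
  have U: "openin (top_of_set X) (U i) \<and> s i \<in> N \<and> \<phi> (s i) ` U i \<subseteq> B" if "i < n" for i
    using U' that by simp
  have UX: "U i \<subseteq> X" if "i < n" for i using U[OF that] openin_imp_subset by blast
  have im: "tr (s i) (U i) = \<phi> (s i) ` U i" if "i < n" for i
    using U[OF that] UX[OF that] by (simp add: tr_image)
  have "dens A \<lesssim>\<^sub>N (\<lambda>F x. \<Sum>i<n. dens (U i) F x)"
  proof (rule lesim_all)
    fix F x assume F: "finite F" "F \<noteq> {}" "F \<subseteq> N" "x \<in> X"
    have "dens A F x \<le> dens (\<Union>i<n. U i) F x" using F cov by (intro dens_mono) auto
    also have "\<dots> \<le> (\<Sum>i<n. dens (U i) F x)" using F by (intro dens_UN) auto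
    finally show "dens A F x \<le> (\<Sum>i<n. dens (U i) F x)" .
  qed
  also have "\<dots> \<lesssim>\<^sub>N (\<lambda>F x. \<Sum>i<n. dens (tr (s i) (U i)) F x)"
    using U by (intro lesim_sum dens_translate') auto
  also have "\<dots> \<lesssim>\<^sub>N dens B"
  proof (rule lesim_all)
    fix F x assume F: "finite F" "F \<noteq> {}" "F \<subseteq> N" "x \<in> X"
    have "(\<Sum>i<n. dens (tr (s i) (U i)) F x) = dens (\<Union>i<n. tr (s i) (U i)) F x"
    proof (rule dens_UN_disjoint[symmetric])
      fix i j y assume "i \<in> {..<n}" "j \<in> {..<n}" "y \<in> tr (s i) (U i)" "y \<in> tr (s j) (U j)"
      then have "y \<in> \<phi> (s i) ` U i \<inter> \<phi> (s j) ` U j" using im by simp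
      then show "i = j" using dis \<open>i \<in> {..<n}\<close> \<open>j \<in> {..<n}\<close> unfolding disjoint_family_on_def by blast
    qed (use F in auto)
    also have "\<dots> \<le> dens B F x"
      using F U im by (intro dens_mono) auto
    finally show "(\<Sum>i<n. dens (tr (s i) (U i)) F x) \<le> dens B F x" .
  qed
  finally show ?thesis .
qed

text \<open>A point of the Folner boundary needs one translate inside \<open>F\<close> and one
  outside; with the unit among the translations, \<open>f\<close> itself is the inside one.\<close>

lemma inner_boundary_sub_Folner_boundary:
  assumes "K \<subseteq> N" "F \<subseteq> N"
  shows "inner_boundary K F \<subseteq> Folner_boundary (G\<lparr>carrier := N\<rparr>) (insert \<one> K) F"
proof
  fix f assume "f \<in> inner_boundary K F"
  then obtain k where f: "f \<in> F" "k \<in> K" "k \<otimes> f \<notin> F" by (auto simp: inner_boundary_def)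
  have "f \<in> N" "k \<otimes> f \<in> N" "\<one> \<otimes> f = f" using f assms by auto
  then show "f \<in> Folner_boundary (G\<lparr>carrier := N\<rparr>) (insert \<one> K) F"
    using f by (auto simp: Folner_boundary_def r_coset_def)
qed

lemma open_castle_exists:
  assumes m: "m \<ge> 1" and K: "finite K" "K \<subseteq> N" and d: "\<delta> > 0"
  obtains I :: "nat set" and T V T' where
    "castle G X \<phi> I T V" "\<And>i. i \<in> I \<Longrightarrow> Folner K \<delta> (T i)" "\<And>i. i \<in> I \<Longrightarrow> V i \<noteq> {}"
    "\<And>i. i \<in> I \<Longrightarrow> openin (top_of_set X) (V i)"
    "\<And>i t v w. i \<in> I \<Longrightarrow> t \<in> T i \<Longrightarrow> v \<in> V i \<Longrightarrow> w \<in> V i \<Longrightarrow> dist (\<phi> t v) (\<phi> t w) < \<delta>"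
    "\<And>i. i \<in> I \<Longrightarrow> T' i \<subseteq> T i" "\<And>i. i \<in> I \<Longrightarrow> real (card (T' i)) \<le> real (card (T i)) / real m"
    "subequivalent (G\<lparr>carrier := N\<rparr>) X \<phi> (X - tiles I T V) (tiles I T' V)"
proof -
  have "finite (insert \<one> K)" "insert \<one> K \<subseteq> carrier (G\<lparr>carrier := N\<rparr>)" using K by auto
  then obtain I :: "nat set" and T V T' where
    *: "open_castle (G\<lparr>carrier := N\<rparr>) X \<phi> I T V \<and>
        (\<forall>i\<in>I. Folner_invariant (G\<lparr>carrier := N\<rparr>) (insert \<one> K) \<delta> (T i)) \<and>
        (\<forall>i\<in>I. \<forall>s\<in>T i. diameter (\<phi> s ` V i) < \<delta>) \<and>
        (\<forall>i\<in>I. T' i \<subseteq> T i \<and> real (card (T' i)) \<le> real (card (T i)) / real m) \<and>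
        subequivalent (G\<lparr>carrier := N\<rparr>) X \<phi> (X - tiles I T V) (tiles I T' V)"
    using almost_finite_N[unfolded almost_finite_def, rule_format, of m "insert \<one> K" \<delta>] m d
    unfolding tiles_def by blast
  note oc = *[THEN conjunct1] and fol = *[THEN conjunct2, THEN conjunct1]
    and dia = *[THEN conjunct2, THEN conjunct2, THEN conjunct1]
    and T' = *[THEN conjunct2, THEN conjunct2, THEN conjunct2, THEN conjunct1]
    and sub = *[THEN conjunct2, THEN conjunct2, THEN conjunct2, THEN conjunct2]
  have cN: "castle (G\<lparr>carrier := N\<rparr>) X \<phi> I T V" using oc by (simp add: open_castle_def)
  have TN: "finite (T i)" "T i \<subseteq> N" if "i \<in> I" for i
    using cN that by (auto simp: castle_def tower_def)
  have c: "castle G X \<phi> I T V" using cN by (auto simp: castle_def tower_def)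
  \<comment> \<open>Towers with empty shape or empty base are dropped: \<open>Folner\<close> demands
    nonempty shapes, and \<open>comparison\<close> picks a point in each base. Neither the tiles nor
    the absorbing levels change.\<close>
  let ?J = "{i \<in> I. T i \<noteq> {} \<and> V i \<noteq> {}}"
  have tJ: "tiles ?J S V = tiles I S V" if "\<And>i. i \<in> I \<Longrightarrow> S i \<subseteq> T i" for S
    using that by (fastforce simp: mem_tiles)
  show thesis
  proof (rule that[of ?J T V T'])
    show "castle G X \<phi> ?J T V" using c by (rule castle_sub) auto
    show "Folner K \<delta> (T i)" if "i \<in> ?J" for i
    proof -
      have i: "i \<in> I" "T i \<noteq> {}" using that by auto
      have "card (inner_boundary K (T i)) \<le> card (Folner_boundary (G\<lparr>carrier := N\<rparr>) (insert \<one> K) (T i))"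
        using inner_boundary_sub_Folner_boundary[OF K(2) TN(2)[OF i(1)]] TN[OF i(1)] K
        by (intro card_mono finite_Folner_boundary subgroup.subgroup_is_group[OF N_subgroup] is_group) auto
      then show ?thesis
        using fol i TN[OF i(1)] unfolding Folner_def Folner_invariant_def by fastforce
    qed
    show "openin (top_of_set X) (V i)" if "i \<in> ?J" for i using oc that by (simp add: open_castle_def)
    show "dist (\<phi> t v) (\<phi> t w) < \<delta>" if "i \<in> ?J" "t \<in> T i" "v \<in> V i" "w \<in> V i" for i t v w
    proof -
      have "\<phi> t ` V i \<subseteq> X" using that castle_fin[OF c] by blast
      then have "bounded (\<phi> t ` V i)" using compact compact_imp_bounded bounded_subset by blast
      then have "dist (\<phi> t v) (\<phi> t w) \<le> diameter (\<phi> t ` V i)"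
        using that by (intro diameter_bounded_bound) auto
      then show ?thesis using dia that by fastforce
    qed
    show "subequivalent (G\<lparr>carrier := N\<rparr>) X \<phi> (X - tiles ?J T V) (tiles ?J T' V)"
      using sub T' by (simp add: tJ)
  qed (use T' in auto)
qed

text \<open>The remainder is closed and subequivalent to a subcastle using at most an
  \<open>m\<close>-th of each shape, so its density is at most that of the subcastle.\<close>

lemma open_castle_small_remainder:
  assumes m: "m \<ge> 1" and K: "finite K" "K \<subseteq> N" and d: "\<delta> > 0"
  obtains I :: "nat set" and T V where
    "castle G X \<phi> I T V" "\<And>i. i \<in> I \<Longrightarrow> Folner K \<delta> (T i)"
    "\<And>i. i \<in> I \<Longrightarrow> openin (top_of_set X) (V i)"
    "\<And>i t v w. i \<in> I \<Longrightarrow> t \<in> T i \<Longrightarrow> v \<in> V i \<Longrightarrow> w \<in> V i \<Longrightarrow> dist (\<phi> t v) (\<phi> t w) < \<delta>"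
    "dens (X - tiles I T V) \<lesssim>\<^sub>N (\<lambda>_ _. 1 / real m)"
proof (rule open_castle_exists[OF assms], goal_cases)
  case (1 I T V T')
  note c = 1(2) and fol = 1(3) and op = 1(5) and dia = 1(6) and T' = 1(7,8) and sub = 1(9)
  have "closedin (top_of_set X) (X - tiles I T V)"
    using openin_tiles[OF c op] by (metis closedin_def double_diff openin_imp_subset order_refl
        topspace_euclidean_subtopology Diff_subset)
  then have "dens (X - tiles I T V) \<lesssim>\<^sub>N dens (tiles I T' V)" using sub by (rule subequivalent_dens)
  also have "\<dots> \<lesssim>\<^sub>N (\<lambda>_ _. 1 / real m)"
    using c fol m T' by (intro dens_subcastle[of I T V]) (auto simp: Folner_def)
  finally have r: "dens (X - tiles I T V) \<lesssim>\<^sub>N (\<lambda>_ _. 1 / real m)" .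
  show ?case by (rule that[OF c fol op dia r])
qed

text \<open>Sufficiently invariant sets do exist: the castle given by almost finiteness has a tower,
  for otherwise all of \<open>X\<close> would be subequivalent to the empty set. Any of its shapes
  serves.\<close>

lemma ev_exists:
  assumes "ev P" obtains F where "finite F" "F \<noteq> {}" "F \<subseteq> N" "\<And>x. x \<in> X \<Longrightarrow> P F x"
proof -
  obtain K d where K: "finite K" "K \<subseteq> N" "d > 0" "\<And>F x. Folner K d F \<Longrightarrow> x \<in> X \<Longrightarrow> P F x"
    using assms unfolding ev_def by blast
  show thesis
  proof (rule open_castle_exists[OF order_refl K(1-3)], goal_cases)
    case (1 I T V T')
    note fol = 1(2) and sub = 1(8)
    have "I \<noteq> {}"
    proof
      assume "I = {}"
      then have "subequivalent (G\<lparr>carrier := N\<rparr>) X \<phi> X {}" using sub by (simp add: tiles_def)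
      from this[unfolded subequivalent_def, THEN spec, THEN mp, of X]
      have "\<exists>(n::nat) U s. (\<forall>i<n. openin (top_of_set X) (U i) \<and> s i \<in> carrier (G\<lparr>carrier := N\<rparr>) \<and>
          \<phi> (s i) ` U i \<subseteq> {}) \<and> X \<subseteq> (\<Union>i<n. U i) \<and> disjoint_family_on (\<lambda>i. \<phi> (s i) ` U i) {..<n}"
        by simp
      then obtain n :: nat and U s where U: "\<forall>i<n. openin (top_of_set X) (U i) \<and> s i \<in> carrier (G\<lparr>carrier := N\<rparr>) \<and>
          \<phi> (s i) ` U i \<subseteq> {}" "X \<subseteq> (\<Union>i<n. U i)" by (elim exE conjE) (rule that)
      obtain x where "x \<in> X" using nonempty by blast
      then obtain i where "i < n" "x \<in> U i" using U by blast
      then show False using U by blast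
    qed
    then obtain i where "i \<in> I" by blast
    then show thesis using that[of "T i"] fol K(4) by (auto simp: Folner_def)
  qed
qed


section \<open>Sets with negligible boundary\<close>

definition nbhd :: "'x set \<Rightarrow> real \<Rightarrow> 'x set"
  where "nbhd A r = {x \<in> X. \<exists>y\<in>A. dist x y < r}"

lemma nbhd_mono: "r \<le> r' \<Longrightarrow> nbhd A r \<subseteq> nbhd A r'"
  by (force simp: nbhd_def)

lemma nbhd_nbhd: "nbhd (nbhd A r) s \<subseteq> nbhd A (r + s)"
proof
  fix x assume "x \<in> nbhd (nbhd A r) s"
  then obtain y z where "x \<in> X" "dist x y < s" "z \<in> A" "dist y z < r" by (auto simp: nbhd_def)
  moreover have "dist x z \<le> dist x y + dist y z" by (rule dist_triangle)
  ultimately show "x \<in> nbhd A (r + s)" unfolding nbhd_def by (auto intro!: bexI[of _ z])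
qed

text \<open>If \<open>\<phi> t l\<close> lies off the closed set, so does a ball around it, and for
  large \<open>n\<close> both \<open>\<phi> t (x n)\<close> and the radius \<open>r n\<close> stay
  within half of that ball.\<close>

lemma near_closed_limit:
  assumes F: "finite F" "F \<subseteq> carrier G" and A: "closedin (top_of_set X) A"
    and x: "\<And>n::nat. x n \<in> X" "l \<in> X" "x \<longlonglongrightarrow> l" and r: "r \<longlonglongrightarrow> 0"
  shows "\<forall>\<^sub>F n in sequentially. \<forall>t\<in>F. \<phi> t (x n) \<in> nbhd A (r n) \<longrightarrow> \<phi> t l \<in> A"
proof (rule eventually_ball_finite[OF F(1)], rule ballI)
  fix t assume t: "t \<in> F"
  show "\<forall>\<^sub>F n in sequentially. \<phi> t (x n) \<in> nbhd A (r n) \<longrightarrow> \<phi> t l \<in> A"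
  proof (cases "\<phi> t l \<in> A")
    case False
    have "closed A" using A compact compact_imp_closed closedin_closed_trans by blast
    then obtain e where e: "e > 0" "\<And>y. dist y (\<phi> t l) < e \<Longrightarrow> y \<notin> A"
      using False open_Compl[of A] unfolding open_dist by (metis ComplD ComplI)
    have "continuous_on X (\<phi> t)" using act_cont t F by blast
    then have "(\<lambda>n. \<phi> t (x n)) \<longlonglongrightarrow> \<phi> t l"
      using continuous_on_tendsto_compose[of X "\<phi> t" x l sequentially] x by simp
    then have "\<forall>\<^sub>F n in sequentially. dist (\<phi> t (x n)) (\<phi> t l) < e/2"
      using tendstoD[of _ _ _ "e/2"] e(1) by simp
    moreover have "\<forall>\<^sub>F n in sequentially. r n < e/2"
      using r e(1) by (intro order_tendstoD(2)) auto
    ultimately show ?thesis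
    proof eventually_elim
      case (elim n)
      have "y \<notin> A" if "dist (\<phi> t (x n)) y < r n" for y
      proof -
        have "dist y (\<phi> t l) \<le> dist (\<phi> t (x n)) y + dist (\<phi> t (x n)) (\<phi> t l)"
          by (metis dist_commute dist_triangle)
        then show ?thesis using that elim by (intro e(2)) linarith
      qed
      then show ?case by (auto simp: nbhd_def)
    qed
  qed auto
qed

text \<open>Compactness: otherwise counterexamples for radii tending to 0 accumulate at some
  \<open>l\<close>, and \<open>l\<close> itself would serve as \<open>x'\<close>. Both sets share
  the same \<open>x'\<close>, because \<open>comparison\<close> has to compare two densities at one
  point.\<close>

lemma nbhd_counting:
  assumes F: "finite F" "F \<subseteq> carrier G"
    and A: "closedin (top_of_set X) A" and B: "closedin (top_of_set X) B"
  obtains r where "r > 0" "\<And>x. x \<in> X \<Longrightarrow> \<exists>x'\<in>X. \<forall>t\<in>F.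
    (\<phi> t x \<in> nbhd A r \<longrightarrow> \<phi> t x' \<in> A) \<and> (\<phi> t x \<in> nbhd B r \<longrightarrow> \<phi> t x' \<in> B)"
proof (rule ccontr)
  assume neg: "\<not> thesis"
  let ?P = "\<lambda>x x' r. \<forall>t\<in>F. (\<phi> t x \<in> nbhd A r \<longrightarrow> \<phi> t x' \<in> A) \<and> (\<phi> t x \<in> nbhd B r \<longrightarrow> \<phi> t x' \<in> B)"
  have "\<exists>x\<in>X. \<forall>x'\<in>X. \<not> ?P x x' (inverse (Suc n))" for n :: nat
    using neg that[of "inverse (Suc n)"] by (metis inverse_positive_iff_positive of_nat_0_less_iff zero_less_Suc)
  then obtain x where x: "\<And>n::nat. x n \<in> X" "\<And>n x'. x' \<in> X \<Longrightarrow> \<not> ?P (x n) x' (inverse (Suc n))"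
    by metis
  obtain l s where l: "l \<in> X" "strict_mono (s :: nat \<Rightarrow> nat)" "(x \<circ> s) \<longlonglongrightarrow> l"
    using compact x(1) unfolding compact_def by blast
  have r: "(\<lambda>n. inverse (real (Suc (s n)))) \<longlonglongrightarrow> 0"
    using LIMSEQ_subseq_LIMSEQ[OF LIMSEQ_inverse_real_of_nat l(2)] by (simp add: o_def)
  have "\<forall>\<^sub>F n in sequentially. ?P ((x \<circ> s) n) l (inverse (real (Suc (s n))))"
    using near_closed_limit[OF F A _ l(1,3) r] near_closed_limit[OF F B _ l(1,3) r] x(1)
    by (auto elim: eventually_elim2)
  then obtain n where "?P ((x \<circ> s) n) l (inverse (real (Suc (s n))))"
    by (auto simp: eventually_sequentially)
  then show False using x(2)[OF l(1), of "s n"] by simp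
qed

text \<open>This is \<open>dens_average\<close> with the gap \<open>- c\<close> against the empty
  set.\<close>

lemma dens_le_constI:
  assumes F: "finite F" "F \<noteq> {}" "F \<subseteq> N" and le: "\<And>x. x \<in> X \<Longrightarrow> dens A F x \<le> c"
  shows "dens A \<lesssim>\<^sub>N (\<lambda>_ _. c)"
proof -
  have "(\<lambda>E x. dens A E x + - c) \<lesssim>\<^sub>N dens {}"
    using dens_average[OF F, of A "- c" "{}"] le by (simp add: dens_empty)
  from lesim_add[OF this lesim_refl[of "\<lambda>_ _. c"]] show ?thesis by (simp add: dens_empty)
qed

text \<open>One finite set \<open>F\<close> already witnesses the bound at all points, and along a
  finite set the visits to a small neighbourhood of \<open>A\<close> are dominated by the visits of
  another point to \<open>A\<close>. This is upper semicontinuity of density on closed sets.\<close>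

lemma dens_nbhd:
  assumes A: "closedin (top_of_set X) A" "dens A \<lesssim>\<^sub>N (\<lambda>_ _. c)" and c: "c < c'"
  obtains r where "r > 0" "dens (nbhd A r) \<lesssim>\<^sub>N (\<lambda>_ _. c')"
proof -
  have "c' - c > 0" using c by simp
  then have "ev (\<lambda>F x. dens A F x \<le> c + (c' - c))" using A(2) unfolding lesim_def by blast
  then have "ev (\<lambda>F x. dens A F x \<le> c')" by simp
  then obtain F where F: "finite F" "F \<noteq> {}" "F \<subseteq> N" "\<And>x. x \<in> X \<Longrightarrow> dens A F x \<le> c'"
    by (rule ev_exists) blast
  have Fc: "F \<subseteq> carrier G" using F(3) by auto
  obtain r where r: "r > 0" "\<And>x. x \<in> X \<Longrightarrow> \<exists>x'\<in>X. \<forall>t\<in>F.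
    (\<phi> t x \<in> nbhd A r \<longrightarrow> \<phi> t x' \<in> A) \<and> (\<phi> t x \<in> nbhd A r \<longrightarrow> \<phi> t x' \<in> A)"
    by (rule nbhd_counting[OF F(1) Fc A(1) A(1)]) (rule that)
  have "dens (nbhd A r) F x \<le> c'" if x: "x \<in> X" for x
  proof -
    obtain x' where x': "x' \<in> X" "\<forall>t\<in>F. \<phi> t x \<in> nbhd A r \<longrightarrow> \<phi> t x' \<in> A" using r(2)[OF x] by blast
    have "dens (nbhd A r) F x \<le> dens A F x'"
      unfolding dens_def using x' F(1) by (intro divide_right_mono) (auto intro!: card_mono)
    then show ?thesis using F(4)[OF x'(1)] by simp
  qed
  then show thesis using that r(1) dens_le_constI[OF F(1-3)] by blast
qed

lemma dens_le_mono:
  assumes "dens B \<lesssim>\<^sub>N (\<lambda>_ _. c)" "A \<inter> X \<subseteq> B" "c \<le> c'" shows "dens A \<lesssim>\<^sub>N (\<lambda>_ _. c')"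
proof (rule le_lesim[OF _ lesim_le[OF assms(1)]])
  show "dens A F x \<le> dens B F x" if "finite F" "F \<subseteq> N" "x \<in> X" for F x
    using that assms(2) by (intro dens_mono)
qed (use assms in auto)

lemma dens_UN_const:
  assumes I: "finite I" and A: "\<And>i. i \<in> I \<Longrightarrow> dens (A i) \<lesssim>\<^sub>N (\<lambda>_ _. c i)"
  shows "dens (\<Union>i\<in>I. A i) \<lesssim>\<^sub>N (\<lambda>_ _. \<Sum>i\<in>I. c i)"
  by (rule le_lesim[OF _ lesim_sum[OF I A]]) (auto intro: dens_UN[OF I])

lemma dens_Un_const:
  assumes "dens A \<lesssim>\<^sub>N (\<lambda>_ _. c)" "dens B \<lesssim>\<^sub>N (\<lambda>_ _. d)"
  shows "dens (A \<union> B) \<lesssim>\<^sub>N (\<lambda>_ _. c + d)"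
  by (rule le_lesim[OF _ lesim_add[OF assms]]) (auto intro: dens_Un)

lemma dens_le_const_limit:
  assumes "\<And>c'. c' > c \<Longrightarrow> dens A \<lesssim>\<^sub>N (\<lambda>_ _. c')" shows "dens A \<lesssim>\<^sub>N (\<lambda>_ _. c)"
  unfolding lesim_def
proof (intro allI impI)
  fix e :: real assume "e > 0"
  then have "dens A \<lesssim>\<^sub>N (\<lambda>_ _. c + e/2)" by (intro assms) simp
  then have "ev (\<lambda>F x. dens A F x \<le> c + e/2 + e/2)" using \<open>e > 0\<close> unfolding lesim_def by (metis half_gt_zero)
  then show "ev (\<lambda>F x. dens A F x \<le> c + e)" by (simp add: add.assoc)
qed

text \<open>The topological boundary relative to \<open>X\<close>, phrased as failure of membership
  to be locally constant. It depends only on the part of \<open>A\<close> inside \<open>X\<close>,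
  and the phrasing suits sets determined by finitely many memberships.\<close>

definition fr :: "'x set \<Rightarrow> 'x set"
  where "fr A = {x \<in> X. \<not> (\<exists>e>0. \<forall>y\<in>X. dist x y < e \<longrightarrow> (y \<in> A \<longleftrightarrow> x \<in> A))}"

text \<open>The analogue of a set whose boundary is null for every invariant measure.\<close>

definition reg :: "'x set \<Rightarrow> bool"
  where "reg A \<longleftrightarrow> dens (fr A) \<lesssim>\<^sub>N (\<lambda>_ _. 0)"

lemma fr_sub: "fr A \<subseteq> X" by (auto simp: fr_def)

lemma notin_frI:
  assumes "e > 0" "\<And>y. y \<in> X \<Longrightarrow> dist x y < e \<Longrightarrow> y \<in> A \<longleftrightarrow> x \<in> A" shows "x \<notin> fr A"
  using assms unfolding fr_def by blast

lemma notin_frE: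
  assumes "x \<in> X" "x \<notin> fr A"
  obtains e where "e > 0" "\<And>y. y \<in> X \<Longrightarrow> dist x y < e \<Longrightarrow> y \<in> A \<longleftrightarrow> x \<in> A"
  using assms unfolding fr_def by blast

lemma notin_fr_iff:
  assumes "x \<in> X" shows "x \<notin> fr A \<longleftrightarrow> (\<forall>\<^sub>F y in at x within X. y \<in> A \<longleftrightarrow> x \<in> A)"
  using assms unfolding fr_def eventually_at by (auto simp: dist_commute)

lemma openin_minus_fr: "openin (top_of_set X) (A \<inter> X - fr A)"
  unfolding openin_euclidean_subtopology_iff
proof (intro conjI ballI)
  fix x assume x: "x \<in> A \<inter> X - fr A"
  then obtain e where e: "e > 0" "\<And>y. y \<in> X \<Longrightarrow> dist x y < e \<Longrightarrow> y \<in> A \<longleftrightarrow> x \<in> A"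
    by (auto elim: notin_frE)
  have "y \<in> A \<inter> X - fr A" if y: "y \<in> X" "dist y x < e" for y
  proof -
    have yA: "y \<in> A" using e(2) y x by (simp add: dist_commute)
    have "y \<notin> fr A"
    proof (rule notin_frI[of "e - dist y x"])
      fix z assume z: "z \<in> X" "dist y z < e - dist y x"
      have "dist x z \<le> dist y x + dist y z" by (rule dist_triangle3)
      then have "z \<in> A" using e(2) z x by simp
      then show "z \<in> A \<longleftrightarrow> y \<in> A" using yA by simp
    qed (use y in simp)
    then show ?thesis using yA y by simp
  qed
  then show "\<exists>e>0. \<forall>x'\<in>X. dist x' x < e \<longrightarrow> x' \<in> A \<inter> X - fr A" using e(1) by blast
qed auto

lemma fr_Compl: "fr (X - A) = fr A"
  by (simp add: fr_def cong: ball_cong conj_cong)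

lemma closedin_fr: "closedin (top_of_set X) (fr A)"
proof -
  have "X - fr A = (A \<inter> X - fr A) \<union> ((X - A) \<inter> X - fr (X - A))" by (auto simp: fr_Compl)
  then have "openin (top_of_set X) (X - fr A)"
    using openin_minus_fr[of A] openin_minus_fr[of "X - A"] by (metis openin_Un)
  then show ?thesis using fr_sub by (simp add: closedin_def)
qed

text \<open>Where the finitely many memberships deciding \<open>B\<close> are all locally constant,
  so is membership in \<open>B\<close>; hence the boundary of \<open>B\<close> is covered by
  translates of theirs. Translation by any element of \<open>G\<close> is harmless here because the
  density bound is the constant 0.\<close>

lemma reg_determined:
  assumes fin: "finite \<G>" and G: "\<And>a A. (a, A) \<in> \<G> \<Longrightarrow> a \<in> carrier G \<and> reg A"
    and det: "\<And>x y. x \<in> X \<Longrightarrow> y \<in> X \<Longrightarrow> (\<And>a A. (a, A) \<in> \<G> \<Longrightarrow> \<phi> a x \<in> A \<longleftrightarrow> \<phi> a y \<in> A) \<Longrightarrow>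
      x \<in> B \<longleftrightarrow> y \<in> B"
  shows "reg B"
proof -
  have "fr B \<subseteq> (\<Union>p\<in>\<G>. tr (inv (fst p)) (fr (snd p)))"
  proof
    fix x assume x: "x \<in> fr B"
    show "x \<in> (\<Union>p\<in>\<G>. tr (inv (fst p)) (fr (snd p)))"
    proof (rule ccontr)
      assume neg: "x \<notin> (\<Union>p\<in>\<G>. tr (inv (fst p)) (fr (snd p)))"
      have xX: "x \<in> X" using x fr_sub by blast
      have "\<forall>\<^sub>F y in at x within X. \<phi> (fst p) y \<in> snd p \<longleftrightarrow> \<phi> (fst p) x \<in> snd p" if p: "p \<in> \<G>" for p
      proof -
        obtain a A where [simp]: "p = (a, A)" by fastforce
        have a: "a \<in> carrier G" using G p by auto
        have "\<phi> a x \<notin> fr A" using neg p a xX by (force simp: mem_tr_inv)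
        then obtain e where e: "e > 0" "\<And>y. y \<in> X \<Longrightarrow> dist (\<phi> a x) y < e \<Longrightarrow> y \<in> A \<longleftrightarrow> \<phi> a x \<in> A"
          using notin_frE[of "\<phi> a x" A] a xX by blast
        have "(\<phi> a \<longlongrightarrow> \<phi> a x) (at x within X)"
          using act_cont[OF a] xX by (simp add: continuous_on_def)
        then have "\<forall>\<^sub>F y in at x within X. dist (\<phi> a y) (\<phi> a x) < e"
          using e(1) by (simp add: tendsto_iff)
        moreover have "\<forall>\<^sub>F y in at x within X. y \<in> X" by (simp add: eventually_at_filter)
        ultimately show ?thesis
        proof eventually_elim
          case (elim y)
          then show ?case using e(2)[of "\<phi> a y"] a by (simp add: dist_commute)
        qed
      qed
      then have "\<forall>\<^sub>F y in at x within X. \<forall>p\<in>\<G>. \<phi> (fst p) y \<in> snd p \<longleftrightarrow> \<phi> (fst p) x \<in> snd p"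
        by (intro eventually_ball_finite[OF fin]) blast
      moreover have "\<forall>\<^sub>F y in at x within X. y \<in> X" by (simp add: eventually_at_filter)
      ultimately have "\<forall>\<^sub>F y in at x within X. y \<in> B \<longleftrightarrow> x \<in> B"
      proof eventually_elim
        case (elim y)
        have "\<phi> a y \<in> A \<longleftrightarrow> \<phi> a x \<in> A" if "(a, A) \<in> \<G>" for a A
          using elim(1) that by (metis fst_conv snd_conv)
        then show ?case using det[of y x] elim(2) xX by blast
      qed
      then show False using x notin_fr_iff[OF xX] by blast
    qed
  qed
  moreover have "dens (\<Union>p\<in>\<G>. tr (inv (fst p)) (fr (snd p))) \<lesssim>\<^sub>N (\<lambda>_ _. \<Sum>p\<in>\<G>. 0)"
    using G by (intro dens_UN_const[OF fin] dens_tr_le_const) (auto simp: reg_def)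
  ultimately show ?thesis unfolding reg_def by (rule_tac dens_le_mono[where c = "\<Sum>p\<in>\<G>. 0"]) auto
qed

text \<open>Take a castle with levels smaller than \<open>e\<close> and add to \<open>Q\<close>
  every level that meets its boundary. Such a level lies wholly in \<open>Q'\<close>, any other
  level is free of boundary, and levels are open; so the new boundary lies in the remainder of the
  castle.\<close>

lemma refine_boundary:
  assumes e: "e > 0" and h: "\<eta> > 0"
  obtains Q' where "\<And>x. x \<in> X \<Longrightarrow> x \<notin> nbhd (fr Q) e \<Longrightarrow> x \<in> Q' \<longleftrightarrow> x \<in> Q"
    "fr Q' \<subseteq> nbhd (fr Q) (2 * e)" "dens (fr Q') \<lesssim>\<^sub>N (\<lambda>_ _. \<eta>)"
proof -
  obtain m :: nat where m: "m \<ge> 1" "1 / real m \<le> \<eta>"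
    using reals_Archimedean[OF h] by (metis Suc_le_mono One_nat_def inverse_eq_divide le0 less_imp_le)
  show thesis
  proof (rule open_castle_small_remainder[OF m(1) _ _ e, of "{}"], goal_cases)
    case (3 I T V)
    note c = 3(1) and op = 3(3) and dia = 3(4) and R = 3(5)
    note fin = castle_fin[OF c]
    define L where "L = (\<lambda>y. \<exists>i\<in>I. \<exists>t\<in>T i. \<exists>v\<in>V i. \<exists>w\<in>V i. y = \<phi> t v \<and> \<phi> t w \<in> fr Q)"
    define Q' where "Q' = Q \<union> {y. L y}"
    have Lnear: "y \<in> nbhd (fr Q) e" if "L y" for y
      using that dia fin unfolding L_def nbhd_def by blast
    have 1: "x \<in> Q' \<longleftrightarrow> x \<in> Q" if "x \<in> X" "x \<notin> nbhd (fr Q) e" for x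
      using that Lnear by (auto simp: Q'_def)
    have 2: "fr Q' \<subseteq> nbhd (fr Q) (2 * e)"
    proof
      fix x assume x: "x \<in> fr Q'"
      then have xX: "x \<in> X" using fr_sub by blast
      show "x \<in> nbhd (fr Q) (2 * e)"
      proof (rule ccontr)
        assume n: "x \<notin> nbhd (fr Q) (2 * e)"
        then have "x \<notin> fr Q" using e xX by (force simp: nbhd_def)
        then obtain d where d: "d > 0" "\<And>y. y \<in> X \<Longrightarrow> dist x y < d \<Longrightarrow> y \<in> Q \<longleftrightarrow> x \<in> Q"
          using notin_frE[OF xX] by blast
        have "y \<in> Q' \<longleftrightarrow> y \<in> Q" if "y \<in> X" "dist x y < e" for y
        proof (rule 1[OF that(1)])
          show "y \<notin> nbhd (fr Q) e"
          proof
            assume "y \<in> nbhd (fr Q) e"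
            then have "x \<in> nbhd (nbhd (fr Q) e) e" using that xX unfolding nbhd_def by blast
            then show False using n nbhd_nbhd[of "fr Q" e e] by (metis mult_2 subsetD)
          qed
        qed
        then have "x \<notin> fr Q'"
          using d e 1[OF xX] n nbhd_mono[of e "2 * e" "fr Q"] by (intro notin_frI[of "min d e"]) auto
        then show False using x by simp
      qed
    qed
    have 3: "fr Q' \<subseteq> X - tiles I T V"
    proof
      fix x assume x: "x \<in> fr Q'"
      then have xX: "x \<in> X" using fr_sub by blast
      have "x \<notin> tiles I T V"
      proof
        assume "x \<in> tiles I T V"
        then obtain i t v where it: "i \<in> I" "t \<in> T i" "v \<in> V i" "x = \<phi> t v" by (auto simp: mem_tiles)
        have tc: "t \<in> carrier G" and Vi: "V i \<subseteq> X" using fin it by auto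
        have "openin (top_of_set X) (tr t (V i))" using tc op it by (intro openin_tr) auto
        moreover have lev: "tr t (V i) = \<phi> t ` V i" using tc Vi by (rule tr_image)
        ultimately have "openin (top_of_set X) (\<phi> t ` V i)" by simp
        moreover have "x \<in> \<phi> t ` V i" using it by simp
        ultimately obtain d where d: "d > 0" "\<And>y. y \<in> X \<Longrightarrow> dist y x < d \<Longrightarrow> y \<in> \<phi> t ` V i"
          unfolding openin_euclidean_subtopology_iff by metis
        show False
        proof (cases "\<phi> t ` V i \<inter> fr Q = {}")
          case False
          then have "L y" if "y \<in> \<phi> t ` V i" for y using that it unfolding L_def by blast
          then have "x \<notin> fr Q'" using d it by (intro notin_frI[of d]) (auto simp: Q'_def dist_commute)
          then show False using x by simp
        next
          case True
          have nL: "\<not> L y" if y: "y \<in> \<phi> t ` V i" for y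
          proof
            assume "L y"
            then obtain j s u w where js: "j \<in> I" "s \<in> T j" "u \<in> V j" "w \<in> V j" "y = \<phi> s u" "\<phi> s w \<in> fr Q"
              unfolding L_def by blast
            obtain v' where "v' \<in> V i" "y = \<phi> t v'" using y by blast
            then have "i = j \<and> t = s" using castle_unique[OF c it(1) js(1) it(2) js(2)] js by metis
            then show False using True js by blast
          qed
          have "x \<notin> fr Q" using True it by blast
          then obtain d' where d': "d' > 0" "\<And>y. y \<in> X \<Longrightarrow> dist x y < d' \<Longrightarrow> y \<in> Q \<longleftrightarrow> x \<in> Q"
            using notin_frE[OF xX] by blast
          have "x \<notin> fr Q'"
          proof (rule notin_frI[of "min d d'"])
            fix y assume "y \<in> X" "dist x y < min d d'"
            then have "y \<in> \<phi> t ` V i" "y \<in> Q \<longleftrightarrow> x \<in> Q" using d(2) d'(2) by (auto simp: dist_commute)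
            moreover have "x \<in> \<phi> t ` V i" using it by blast
            ultimately show "y \<in> Q' \<longleftrightarrow> x \<in> Q'" using nL by (auto simp: Q'_def)
          qed (use d d' in simp)
          then show False using x by simp
        qed
      qed
      then show "x \<in> X - tiles I T V" using xX by simp
    qed
    have "dens (fr Q') \<lesssim>\<^sub>N (\<lambda>_ _. \<eta>)" using R 3 m(2) by (intro dens_le_mono[OF R]) auto
    with 1 2 show ?case using that by blast
  qed auto
qed

text \<open>The boundary is moved infinitely often inside shrinking neighbourhoods of itself, each time
  decreasing its density; the changes stabilise outside the intersection of the neighbourhoods.\<close>

lemma reg_approximation:
  assumes e: "e > 0"
  obtains U where "reg U" "U \<subseteq> X" "\<And>x. x \<in> X \<Longrightarrow> x \<notin> nbhd (fr Q) e \<Longrightarrow> x \<in> U \<longleftrightarrow> x \<in> Q"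
proof -
  \<comment> \<open>With \<open>r = snd s\<close>, one step moves the boundary by less than
    \<open>2 * r\<close> and at least halves \<open>r\<close>. So the
    \<open>4 * r\<close>-neighbourhoods \<open>M n\<close> below are nested, and the fifth
    \<open>r\<close> keeps an \<open>r\<close>-ball around outside points off \<open>M n\<close>.
    Starting at \<open>e / 4\<close> makes \<open>M 0\<close> the \<open>e\<close>-neighbourhood; at
    stage 0 the density bound is 1, hence automatic.\<close>
  define P where "P = (\<lambda>(n::nat) (s::'x set \<times> real). (n = 0 \<longrightarrow> s = (Q, e/4)) \<and> snd s > 0 \<and>
    dens (nbhd (fr (fst s)) (5 * snd s)) \<lesssim>\<^sub>N (\<lambda>_ _. inverse (Suc n)))"
  define S where "S = (\<lambda>(n::nat) (s::'x set \<times> real) s'.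
    (\<forall>x\<in>X. x \<notin> nbhd (fr (fst s)) (snd s) \<longrightarrow> (x \<in> fst s' \<longleftrightarrow> x \<in> fst s)) \<and>
    fr (fst s') \<subseteq> nbhd (fr (fst s)) (2 * snd s) \<and> snd s' \<le> snd s / 2)"
  have 0: "P 0 (Q, e/4)" using e by (auto simp: P_def intro!: lesim_all dens_le1)
  have step: "\<exists>s'. P (Suc n) s' \<and> S n s s'" if P: "P n s" for n s
  proof -
    have s: "snd s > 0" using P by (simp add: P_def)
    have pos: "inverse (real (Suc (Suc n))) / 2 > 0" by simp
    obtain Q' where Q': "\<And>x. x \<in> X \<Longrightarrow> x \<notin> nbhd (fr (fst s)) (snd s) \<Longrightarrow> x \<in> Q' \<longleftrightarrow> x \<in> fst s"
      "fr Q' \<subseteq> nbhd (fr (fst s)) (2 * snd s)"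
      "dens (fr Q') \<lesssim>\<^sub>N (\<lambda>_ _. inverse (real (Suc (Suc n))) / 2)"
      by (rule refine_boundary[OF s pos, of "fst s"]) blast
    obtain r where r: "r > 0" "dens (nbhd (fr Q') r) \<lesssim>\<^sub>N (\<lambda>_ _. inverse (Suc (Suc n)))"
      by (rule dens_nbhd[OF closedin_fr Q'(3), of "inverse (real (Suc (Suc n)))"]) (auto simp: field_simps)
    let ?s = "(Q', min (snd s / 2) (r / 5))"
    have "nbhd (fr Q') (5 * min (snd s / 2) (r / 5)) \<subseteq> nbhd (fr Q') r" by (rule nbhd_mono) auto
    then have "P (Suc n) ?s" using r s unfolding P_def by (auto intro: dens_le_mono[OF r(2)])
    moreover have "S n s ?s" using Q' unfolding S_def by auto
    ultimately show ?thesis by blast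
  qed
  obtain f where f: "\<And>n. P n (f n)" "\<And>n. S n (f n) (f (Suc n))"
    using dependent_nat_choice[of P S] 0 step by metis
  define M where "M = (\<lambda>n. nbhd (fr (fst (f n))) (4 * snd (f n)))"
  have fpos: "snd (f n) > 0" for n using f(1) by (simp add: P_def)
  have Mstep: "M (Suc n) \<subseteq> M n" for n
  proof -
    have "M (Suc n) \<subseteq> nbhd (nbhd (fr (fst (f n))) (2 * snd (f n))) (4 * snd (f (Suc n)))"
      using f(2)[of n] unfolding M_def S_def nbhd_def by blast
    also have "\<dots> \<subseteq> nbhd (fr (fst (f n))) (2 * snd (f n) + 4 * snd (f (Suc n)))" by (rule nbhd_nbhd)
    also have "\<dots> \<subseteq> M n" unfolding M_def using f(2)[of n] by (intro nbhd_mono) (auto simp: S_def)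
    finally show ?thesis .
  qed
  have fstep: "x \<in> fst (f (Suc n)) \<longleftrightarrow> x \<in> fst (f n)" if "x \<in> X" "x \<notin> M n" for x n
  proof -
    have "nbhd (fr (fst (f n))) (snd (f n)) \<subseteq> M n"
      unfolding M_def using fpos[of n] by (intro nbhd_mono) simp
    then show ?thesis using f(2)[of n] that unfolding S_def by blast
  qed
  have stable: "x \<notin> M (n + k) \<and> (x \<in> fst (f (n + k)) \<longleftrightarrow> x \<in> fst (f n))" if "x \<in> X" "x \<notin> M n" for x n k
  proof (induction k)
    case (Suc k)
    then show ?case using Mstep[of "n + k"] fstep[OF that(1), of "n + k"] by auto
  qed (use that in simp)
  \<comment> \<open>Off \<open>M n\<close> all stages from \<open>n\<close> on agree, so this is the
    limit of the stages; points lying in every \<open>M n\<close> are left out.\<close>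
  define U where "U = {x \<in> X. \<exists>n. x \<notin> M n \<and> x \<in> fst (f n)}"
  have U: "x \<in> U \<longleftrightarrow> x \<in> fst (f n)" if x: "x \<in> X" "x \<notin> M n" for x n
  proof
    assume "x \<in> U"
    then obtain k where k: "x \<notin> M k" "x \<in> fst (f k)" by (auto simp: U_def)
    show "x \<in> fst (f n)"
      using stable[OF x, of k] stable[OF x(1) k(1), of n] k(2) by (simp add: add.commute)
  qed (use x in \<open>auto simp: U_def\<close>)
  have frU: "fr U \<subseteq> nbhd (fr (fst (f n))) (5 * snd (f n))" for n
  proof
    fix x assume x: "x \<in> fr U"
    then have xX: "x \<in> X" using fr_sub by blast
    show "x \<in> nbhd (fr (fst (f n))) (5 * snd (f n))"
    proof (rule ccontr)
      assume ne: "x \<notin> nbhd (fr (fst (f n))) (5 * snd (f n))"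
      then have "x \<notin> fr (fst (f n))" using fpos[of n] xX by (force simp: nbhd_def)
      then obtain d where d: "d > 0" "\<And>y. y \<in> X \<Longrightarrow> dist x y < d \<Longrightarrow> y \<in> fst (f n) \<longleftrightarrow> x \<in> fst (f n)"
        using notin_frE[OF xX] by blast
      have nM: "y \<notin> M n" if "dist x y < snd (f n)" for y
      proof
        assume "y \<in> M n"
        then have "x \<in> nbhd (M n) (snd (f n))" using that xX unfolding nbhd_def by blast
        moreover have "nbhd (M n) (snd (f n)) \<subseteq> nbhd (fr (fst (f n))) (5 * snd (f n))"
          using nbhd_nbhd[of "fr (fst (f n))" "4 * snd (f n)" "snd (f n)"] by (simp add: M_def)
        ultimately show False using ne by blast
      qed
      have "y \<in> U \<longleftrightarrow> x \<in> U" if "y \<in> X" "dist x y < min d (snd (f n))" for y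
        using that d(2) U[OF that(1) nM] U[OF xX nM] fpos[of n] by simp
      then have "x \<notin> fr U" using d fpos[of n] by (intro notin_frI[of "min d (snd (f n))"]) auto
      then show False using x by simp
    qed
  qed
  have "dens (fr U) \<lesssim>\<^sub>N (\<lambda>_ _. 0)"
  proof (rule dens_le_const_limit)
    fix c :: real assume "c > 0"
    then obtain n where "inverse (Suc n) < c" using reals_Archimedean by blast
    moreover have "dens (nbhd (fr (fst (f n))) (5 * snd (f n))) \<lesssim>\<^sub>N (\<lambda>_ _. inverse (Suc n))"
      using f(1)[of n] by (simp add: P_def)
    ultimately show "dens (fr U) \<lesssim>\<^sub>N (\<lambda>_ _. c)" using frU[of n] by (elim dens_le_mono) auto
  qed
  moreover have "f 0 = (Q, e/4)" using f(1)[of 0] by (simp add: P_def)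
  then have "x \<in> U \<longleftrightarrow> x \<in> Q" if "x \<in> X" "x \<notin> nbhd (fr Q) e" for x
    using U[of x 0] that by (simp add: M_def)
  moreover have "U \<subseteq> X" by (auto simp: U_def)
  ultimately show thesis using that unfolding reg_def by blast
qed

text \<open>A Urysohn-type separation by a regular set, obtained by regularising a metric
  neighbourhood of \<open>C\<close>.\<close>

lemma reg_between:
  assumes C: "closedin (top_of_set X) C" and W: "openin (top_of_set X) W" and CW: "C \<subseteq> W"
  obtains U where "reg U" "C \<subseteq> U" "U \<subseteq> W"
proof -
  have CX: "C \<subseteq> X" using C closedin_imp_subset by blast
  have cC: "compact C" using compact C by (rule closedin_compact)
  have "closedin (top_of_set X) (X - W)"
    using W by (simp add: closedin_def openin_imp_subset double_diff)
  then have "closed (X - W)" using compact_imp_closed[OF compact] by (rule closedin_closed_trans)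
  then have oW: "open (- (X - W))" by (rule open_Compl)
  have cov: "C \<subseteq> \<Union>{- (X - W)}" using CW by auto
  have op: "\<And>B. B \<in> {- (X - W)} \<Longrightarrow> open B" using oW by (simp only: singleton_iff)
  obtain d where "d > 0" "\<And>x. x \<in> C \<Longrightarrow> \<exists>B\<in>{- (X - W)}. ball x d \<subseteq> B"
    by (rule Heine_Borel_lemma[OF cC cov op]) (assumption, rule that)
  then have d: "d > 0" "\<And>x. x \<in> C \<Longrightarrow> ball x d \<subseteq> - (X - W)" by (simp_all only: bex_simps singleton_iff simp_thms)
  \<comment> \<open>Boundary points of the \<open>e\<close>-neighbourhood \<open>Q\<close> have
    distance at least \<open>e\<close> from \<open>C\<close>, so changes within \<open>e / 2\<close>
    of them do not touch \<open>C\<close>. Points that are added lie within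
    \<open>e + e / 2 + e / 2 = d\<close> of \<open>C\<close>, hence in \<open>W\<close>.\<close>
  define e where "e = d/2"
  define Q where "Q = nbhd C e"
  have e: "e > 0" using d by (simp add: e_def)
  obtain U where U: "reg U" "U \<subseteq> X" "\<And>x. x \<in> X \<Longrightarrow> x \<notin> nbhd (fr Q) (e/2) \<Longrightarrow> x \<in> U \<longleftrightarrow> x \<in> Q"
    using reg_approximation[of "e/2" Q] e by auto
  have fr: "y \<notin> fr Q" if y: "y \<in> X" "c \<in> C" "dist c y < e" for c y
  proof (rule notin_frI[of "e - dist c y"])
    fix z assume z: "z \<in> X" "dist y z < e - dist c y"
    have "dist c z \<le> dist c y + dist y z" by (rule dist_triangle)
    then have "dist z c < e" using z by (simp add: dist_commute)
    then show "z \<in> Q \<longleftrightarrow> y \<in> Q" using y z by (auto simp: Q_def nbhd_def dist_commute)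
  qed (use y in simp)
  show thesis
  proof (rule that[OF U(1)])
    show "C \<subseteq> U"
    proof
      fix x assume x: "x \<in> C"
      then have xX: "x \<in> X" using CX by blast
      have "x \<in> Q" using x xX e by (auto simp: Q_def nbhd_def intro!: bexI[of _ x])
      moreover have "x \<notin> nbhd (fr Q) (e/2)"
      proof
        assume "x \<in> nbhd (fr Q) (e/2)"
        then obtain y where "y \<in> fr Q" "dist x y < e/2" by (auto simp: nbhd_def)
        then show False using fr[of y x] fr_sub[of Q] x e by auto
      qed
      ultimately show "x \<in> U" using U(3)[OF xX] by simp
    qed
    show "U \<subseteq> W"
    proof
      fix x assume x: "x \<in> U"
      then have xX: "x \<in> X" using U(2) by blast
      have "\<exists>c\<in>C. dist c x < d"
      proof (cases "x \<in> nbhd (fr Q) (e/2)")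
        case True
        then obtain y where y: "y \<in> fr Q" "dist x y < e/2" by (auto simp: nbhd_def)
        then obtain z where "z \<in> X" "dist y z < e/2" "(z \<in> Q) \<noteq> (y \<in> Q)"
          using notin_frI[of "e/2" y Q] e by (metis half_gt_zero)
        then obtain q where q: "q \<in> Q" "dist y q < e/2" using e by (cases "y \<in> Q") auto
        then obtain c where c: "c \<in> C" "dist q c < e" by (auto simp: Q_def nbhd_def)
        have "dist c x \<le> dist q c + (dist y q + dist x y)"
          using dist_triangle[of c x q] dist_triangle[of q x y] by (simp add: dist_commute)
        then have "dist c x < d" using q c y by (simp add: e_def)
        then show ?thesis using c by blast
      next
        case False
        then have "x \<in> Q" using U(3)[OF xX] x by simp
        then obtain c where "c \<in> C" "dist x c < e" by (auto simp: Q_def nbhd_def)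
        moreover have "e \<le> d" using d by (simp add: e_def)
        ultimately show ?thesis by (force simp: dist_commute)
      qed
      then show "x \<in> W" using d(2) xX by (auto simp: subset_iff)
    qed
  qed
qed


section \<open>Comparison from density gaps\<close>

lemma subequivalentI:
  assumes "\<And>C. closedin (top_of_set X) C \<Longrightarrow> C \<subseteq> A \<Longrightarrow> \<exists>(J::'j set) U s. finite J \<and>
    (\<forall>j\<in>J. openin (top_of_set X) (U j) \<and> s j \<in> carrier \<Gamma> \<and> \<phi> (s j) ` U j \<subseteq> B) \<and>
    C \<subseteq> (\<Union>j\<in>J. U j) \<and> disjoint_family_on (\<lambda>j. \<phi> (s j) ` U j) J"
  shows "subequivalent \<Gamma> X \<phi> A B"
  unfolding subequivalent_def
proof (intro allI impI, elim conjE)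
  fix C assume C: "closedin (top_of_set X) C" "C \<subseteq> A"
  obtain J :: "'j set" and U s where J: "finite J"
    "\<forall>j\<in>J. openin (top_of_set X) (U j) \<and> s j \<in> carrier \<Gamma> \<and> \<phi> (s j) ` U j \<subseteq> B"
    "C \<subseteq> (\<Union>j\<in>J. U j)" "disjoint_family_on (\<lambda>j. \<phi> (s j) ` U j) J"
    using assms[OF C] by (elim exE conjE) (rule that)
  obtain f where f: "bij_betw f {0..<card J} J" using ex_bij_betw_nat_finite[OF J(1)] by blast
  have fJ: "f i \<in> J" if "i < card J" for i using f that by (auto simp: bij_betw_def)
  have fs: "f ` {..<card J} = J" using f by (simp add: bij_betw_def lessThan_atLeast0)
  have inj: "f i = f j \<Longrightarrow> i = j" if "i < card J" "j < card J" for i j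
    using f that by (auto simp: bij_betw_def inj_on_def)
  show "\<exists>(n::nat) U s.
        (\<forall>i<n. openin (top_of_set X) (U i) \<and> s i \<in> carrier \<Gamma> \<and> \<phi> (s i) ` U i \<subseteq> B) \<and>
        C \<subseteq> (\<Union>i<n. U i) \<and> disjoint_family_on (\<lambda>i. \<phi> (s i) ` U i) {..<n}"
  proof (intro exI conjI allI impI)
    have "(\<Union>j\<in>J. U j) = (\<Union>i<card J. (U \<circ> f) i)"
      by (simp only: image_comp[symmetric] fs)
    then show "C \<subseteq> (\<Union>i<card J. (U \<circ> f) i)" using J(3) by simp
    show "disjoint_family_on (\<lambda>i. \<phi> ((s \<circ> f) i) ` (U \<circ> f) i) {..<card J}"
      unfolding disjoint_family_on_def
    proof (intro ballI impI)
      fix i j assume "i \<in> {..<card J}" "j \<in> {..<card J}" "i \<noteq> j"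
      then have "f i \<in> J" "f j \<in> J" "f i \<noteq> f j" using fJ inj by auto
      then show "\<phi> ((s \<circ> f) i) ` (U \<circ> f) i \<inter> \<phi> ((s \<circ> f) j) ` (U \<circ> f) j = {}"
        using J(4) unfolding disjoint_family_on_def by simp
    qed
  qed (use J(2) fJ in auto)
qed

lemma subequivalent_carrier_mono:
  assumes "subequivalent (G\<lparr>carrier := N\<rparr>) X \<phi> A B" shows "subequivalent G X \<phi> A B"
  unfolding subequivalent_def
proof (intro allI impI)
  fix C assume "closedin (top_of_set X) C \<and> C \<subseteq> A"
  from assms[unfolded subequivalent_def, THEN spec, THEN mp, OF this]
  show "\<exists>(n::nat) U s.
        (\<forall>i<n. openin (top_of_set X) (U i) \<and> s i \<in> carrier G \<and> \<phi> (s i) ` U i \<subseteq> B) \<and>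
        C \<subseteq> (\<Union>i<n. U i) \<and> disjoint_family_on (\<lambda>i. \<phi> (s i) ` U i) {..<n}"
    by (elim ex_forward conj_forward all_forward imp_forward) auto
qed

lemma closedin_remainder:
  assumes "castle G X \<phi> I T V" "\<And>i. i \<in> I \<Longrightarrow> openin (top_of_set X) (V i)"
  shows "closedin (top_of_set X) (X - tiles I T V)"
  using openin_tiles[OF assms] by (simp add: closedin_def openin_imp_subset double_diff)

text \<open>Inside each tower the levels meeting \<open>A\<close>, together with the levels absorbing the remainder
  of the castle, are outnumbered by the levels contained in \<open>B\<close>.\<close>

lemma comparison:
  assumes A: "closedin (top_of_set X) A" and B: "openin (top_of_set X) B" and e: "\<epsilon> > 0"
    and gap: "ev (\<lambda>F x. dens A F x + \<epsilon> \<le> dens B F x)"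
  shows "subequivalent (G\<lparr>carrier := N\<rparr>) X \<phi> A B"
proof -
  have BX: "B \<subseteq> X" using B openin_imp_subset by blast
  have AX: "A \<subseteq> X" using A closedin_imp_subset by blast
  have cB: "closedin (top_of_set X) (X - B)" using B by (simp add: closedin_def BX double_diff)
  obtain F where F: "finite F" "F \<noteq> {}" "F \<subseteq> N" "\<And>x. x \<in> X \<Longrightarrow> dens A F x + \<epsilon> \<le> dens B F x"
    using gap by (rule ev_exists) blast
  have Fc: "F \<subseteq> carrier G" using F(3) by auto
  obtain r where r: "r > 0" "\<And>x. x \<in> X \<Longrightarrow> \<exists>x'\<in>X. \<forall>t\<in>F.
    (\<phi> t x \<in> nbhd A r \<longrightarrow> \<phi> t x' \<in> A) \<and> (\<phi> t x \<in> nbhd (X - B) r \<longrightarrow> \<phi> t x' \<in> X - B)"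
    by (rule nbhd_counting[OF F(1) Fc A cB]) (rule that)
  \<comment> \<open>\<open>A\<close> is enlarged and \<open>B\<close> shrunk by \<open>r\<close>
    without losing the gap. When levels have diameter below \<open>r\<close>, one point of a level
    then decides: outside \<open>?A\<close> the level misses \<open>A\<close>, and inside
    \<open>?B\<close> it is contained in \<open>B\<close>.\<close>
  let ?A = "nbhd A r" and ?B = "X - nbhd (X - B) r"
  have "dens ?A F x + \<epsilon> \<le> dens ?B F x" if x: "x \<in> X" for x
  proof -
    obtain x' where x': "x' \<in> X" "\<And>t. t \<in> F \<Longrightarrow> \<phi> t x \<in> nbhd A r \<Longrightarrow> \<phi> t x' \<in> A"
      "\<And>t. t \<in> F \<Longrightarrow> \<phi> t x \<in> nbhd (X - B) r \<Longrightarrow> \<phi> t x' \<in> X - B" using r(2)[OF x] by blast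
    have "dens ?A F x \<le> dens A F x'"
      unfolding dens_def using x' F(1) by (intro divide_right_mono) (auto intro!: card_mono)
    moreover have "{t \<in> F. \<phi> t x' \<in> B} \<subseteq> {t \<in> F. \<phi> t x \<in> ?B}"
      using x'(3) x Fc by auto
    then have "dens B F x' \<le> dens ?B F x"
      unfolding dens_def using F(1) by (intro divide_right_mono) (auto intro!: card_mono)
    ultimately show ?thesis using F(4)[OF x'(1)] by linarith
  qed
  from dens_average[OF F(1-3), of ?A \<epsilon> ?B] this
  have "(\<lambda>E x. dens ?A E x + \<epsilon>) \<lesssim>\<^sub>N dens ?B" by blast
  then have "ev (\<lambda>E x. dens ?A E x + \<epsilon> \<le> dens ?B E x + \<epsilon>/2)" using e unfolding lesim_def by simp
  then obtain K d where K: "finite K" "K \<subseteq> N" "d > 0"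
    "\<And>F x. Folner K d F \<Longrightarrow> x \<in> X \<Longrightarrow> dens ?A F x + \<epsilon> \<le> dens ?B F x + \<epsilon>/2"
    unfolding ev_def by blast
  \<comment> \<open>The passage from \<open>F\<close> to general Folner sets has used half of the
    gap; the other half pays for the levels that absorb the remainder.\<close>
  obtain m :: nat where m: "m \<ge> 1" "1 / real m \<le> \<epsilon>/2"
    using reals_Archimedean[of "\<epsilon>/2"] e by (metis Suc_le_mono One_nat_def inverse_eq_divide le0 less_imp_le half_gt_zero)
  have d: "min d r > 0" using K r by simp
  show ?thesis
  proof (rule open_castle_exists[OF m(1) K(1,2) d], goal_cases)
    case (1 I T V T')
    note c = 1(1) and fol = 1(2) and ne = 1(3) and op = 1(4) and dia = 1(5) and T' = 1(6,7) and sub = 1(8)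
    note fin = castle_fin[OF c]
    let ?G = "G\<lparr>carrier := N\<rparr>"
    have TN: "T i \<subseteq> N" "T i \<noteq> {}" if "i \<in> I" for i using fol[OF that] by (auto simp: Folner_def)
    define a where "a = (\<lambda>i. {t \<in> T i. \<phi> t ` V i \<inter> A \<noteq> {}})"
    define b where "b = (\<lambda>i. {t \<in> T i. \<phi> t ` V i \<subseteq> B})"
    \<comment> \<open>Levels meeting \<open>A\<close> and levels absorbing the remainder must go to
      distinct levels inside \<open>B\<close>, hence an injection of the disjoint sum: a level may
      occur in both roles.\<close>
    have "\<exists>f. inj_on f (a i <+> T' i) \<and> f ` (a i <+> T' i) \<subseteq> b i" if i: "i \<in> I" for i
    proof -
      obtain v where v: "v \<in> V i" using ne[OF i] by blast
      have vX: "v \<in> X" using v fin(4)[OF i] by blast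
      have n: "real (card (T i)) > 0" using TN[OF i] fin(2)[OF i] by (simp add: card_gt_0_iff)
      have tX: "\<phi> t w \<in> X" if "t \<in> T i" "w \<in> V i" for t w using fin(3,4)[OF i] that by blast
      have dr: "dist (\<phi> t v) (\<phi> t w) < r" "dist (\<phi> t w) (\<phi> t v) < r" if "t \<in> T i" "w \<in> V i" for t w
        using dia[OF i that(1) v that(2)] dia[OF i that(1) that(2) v] by auto
      have "a i \<subseteq> {t \<in> T i. \<phi> t v \<in> ?A}"
        using dr tX v by (fastforce simp: a_def nbhd_def)
      then have "card (a i) \<le> card {t \<in> T i. \<phi> t v \<in> ?A}" using fin(2)[OF i] by (intro card_mono) auto
      then have 1: "card (a i) \<le> dens ?A (T i) v * card (T i)" using n by (simp add: dens_def)
      have "{t \<in> T i. \<phi> t v \<in> ?B} \<subseteq> b i"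
      proof
        fix t assume t: "t \<in> {t \<in> T i. \<phi> t v \<in> ?B}"
        have "\<phi> t w \<in> B" if w: "w \<in> V i" for w
        proof (rule ccontr)
          assume "\<phi> t w \<notin> B"
          then have "\<phi> t v \<in> nbhd (X - B) r"
            using dr(1)[of t w] tX[of t w] tX[of t v] t v w unfolding nbhd_def by blast
          then show False using t by blast
        qed
        then show "t \<in> b i" using t by (auto simp: b_def)
      qed
      then have "card {t \<in> T i. \<phi> t v \<in> ?B} \<le> card (b i)" using fin(2)[OF i] by (intro card_mono) (auto simp: b_def)
      then have 2: "dens ?B (T i) v * card (T i) \<le> card (b i)" using n by (simp add: dens_def)
      have "Folner K d (T i)" using fol[OF i] by (rule Folner_mono) auto
      then have "dens ?A (T i) v + \<epsilon>/2 \<le> dens ?B (T i) v" using K(4)[of "T i" v] vX by (simp add: field_simps)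
      then have "(dens ?A (T i) v + \<epsilon>/2) * card (T i) \<le> dens ?B (T i) v * card (T i)"
        by (rule mult_right_mono) simp
      moreover have "real (card (T' i)) \<le> \<epsilon>/2 * card (T i)"
      proof -
        have "real (card (T i)) / m = 1 / real m * card (T i)" by simp
        also have "\<dots> \<le> \<epsilon>/2 * card (T i)" using m(2) by (rule mult_right_mono) simp
        finally show ?thesis using T'(2)[OF i] by (rule order_trans[rotated])
      qed
      ultimately have "real (card (a i) + card (T' i)) \<le> card (b i)"
        using 1 2 by (simp add: distrib_right)
      then have "card (a i <+> T' i) \<le> card (b i)"
        using fin(2)[OF i] T'(1)[OF i] by (subst card_Plus) (auto simp: a_def intro: finite_subset)
      moreover have "finite (a i <+> T' i)" "finite (b i)"
        using fin(2)[OF i] T'(1)[OF i] by (auto simp: a_def b_def intro: finite_subset)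
      ultimately show ?thesis using card_le_inj by metis
    qed
    then obtain f where f: "\<And>i. i \<in> I \<Longrightarrow> inj_on (f i) (a i <+> T' i)"
      "\<And>i. i \<in> I \<Longrightarrow> f i ` (a i <+> T' i) \<subseteq> b i" by metis
    have fb: "f i p \<in> T i" "\<phi> (f i p) ` V i \<subseteq> B" if "i \<in> I" "p \<in> a i <+> T' i" for i p
      using f(2)[OF that(1)] that(2) by (auto simp: b_def)
    have T'N: "t \<in> N" if "t \<in> T' i" "i \<in> I" for i t using that T' TN by blast
    have uniq: "i = j \<and> p = q"
      if "i \<in> I" "j \<in> I" "p \<in> a i <+> T' i" "q \<in> a j <+> T' j" "v \<in> V i" "w \<in> V j"
        "\<phi> (f i p) v = \<phi> (f j q) w" for i j p q v w
    proof -
      have ij: "i = j" "f i p = f j q"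
        using castle_unique[OF c that(1,2) fb(1)[OF that(1,3)] fb(1)[OF that(2,4)] that(5-7)] by auto
      then show ?thesis using f(1)[OF that(1)] that(3,4) by (auto simp: inj_on_def)
    qed
    show ?case
    proof (rule subequivalentI)
      fix C assume C: "closedin (top_of_set X) C" "C \<subseteq> A"
      have cR: "closedin (top_of_set X) (C \<inter> (X - tiles I T V))"
        using C(1) closedin_remainder[OF c op] by (rule closedin_Int)
      have "closedin (top_of_set X) (C \<inter> (X - tiles I T V)) \<and> C \<inter> (X - tiles I T V) \<subseteq> X - tiles I T V"
        using cR by blast
      from sub[unfolded subequivalent_def, THEN spec, THEN mp, OF this] obtain n0 :: nat and U s where
        U0: "\<forall>i<n0. openin (top_of_set X) (U i) \<and> s i \<in> carrier ?G \<and> \<phi> (s i) ` U i \<subseteq> tiles I T' V"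
        and cov: "C \<inter> (X - tiles I T V) \<subseteq> (\<Union>i<n0. U i)"
        and dis: "disjoint_family_on (\<lambda>i. \<phi> (s i) ` U i) {..<n0}"
        by (elim exE conjE) (rule that)
      have U: "openin (top_of_set X) (U i)" "s i \<in> N" "\<phi> (s i) ` U i \<subseteq> tiles I T' V" "U i \<subseteq> X" if "i < n0" for i
        using U0 that openin_imp_subset[of _ X "U i"] by auto
      define J :: "(nat \<times> 'g + nat \<times> nat \<times> 'g) set"
        where "J = Inl ` Sigma I a \<union> Inr ` ({..<n0} \<times> Sigma I T')"
      \<comment> \<open>A level meeting \<open>A\<close> moves straight to the level assigned to it.
        The part of \<open>U j\<close> that \<open>s j\<close> sends into the absorbing level
        \<open>t\<close> of tower \<open>i\<close> first follows \<open>s j\<close> and then moves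
        on to the level assigned to \<open>Inr t\<close>.\<close>
      define W where "W = case_sum (\<lambda>(i, t). tr t (V i)) (\<lambda>(j, i, t). U j \<inter> tr (inv (s j)) (tr t (V i)))"
      define l where "l = case_sum (\<lambda>(i, t). f i (Inl t) \<otimes> inv t) (\<lambda>(j, i, t). f i (Inr t) \<otimes> inv t \<otimes> s j)"
      have Wl: "W (Inl (i, t)) = tr t (V i)" "l (Inl (i, t)) = f i (Inl t) \<otimes> inv t"
        "W (Inr (j, i, t)) = U j \<inter> tr (inv (s j)) (tr t (V i))"
        "l (Inr (j, i, t)) = f i (Inr t) \<otimes> inv t \<otimes> s j" for i j t
        by (simp_all add: W_def l_def)
      have J: "(\<exists>i t. q = Inl (i, t) \<and> i \<in> I \<and> t \<in> a i) \<or>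
          (\<exists>j i t. q = Inr (j, i, t) \<and> j < n0 \<and> i \<in> I \<and> t \<in> T' i)" if "q \<in> J" for q
        using that by (auto simp: J_def)
      have aT: "t \<in> T i" "t \<in> N" if "t \<in> a i" "i \<in> I" for t i
        using that TN by (auto simp: a_def)
      have fN: "f i p \<in> N" if "i \<in> I" "p \<in> a i <+> T' i" for i p
        using fb(1)[OF that] TN[OF that(1)] by blast
      have fN1: "f i (Inl t) \<in> N" if "i \<in> I" "t \<in> a i" for i t using fN that by blast
      have fN2: "f i (Inr t) \<in> N" if "i \<in> I" "t \<in> T' i" for i t using fN that by blast
      have kL: "\<phi> (inv t) x \<in> V i" "\<phi> (l (Inl (i, t))) x = \<phi> (f i (Inl t)) (\<phi> (inv t) x)"
        if "i \<in> I" "t \<in> a i" "x \<in> W (Inl (i, t))" for i t x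
        using that fN1[of i t] aT[of t i] unfolding Wl by (auto simp: tr_def act_mult)
      have kR: "\<phi> (inv t) (\<phi> (s j) x) \<in> V i"
        "\<phi> (l (Inr (j, i, t))) x = \<phi> (f i (Inr t)) (\<phi> (inv t) (\<phi> (s j) x))"
        if "j < n0" "i \<in> I" "t \<in> T' i" "x \<in> W (Inr (j, i, t))" for i j t x
        using that fN2[of i t] T'N[of t i] U(2)[of j] unfolding Wl by (auto simp: tr_def act_mult)
      show "\<exists>(J :: (nat \<times> 'g + nat \<times> nat \<times> 'g) set) U s. finite J \<and>
        (\<forall>j\<in>J. openin (top_of_set X) (U j) \<and> s j \<in> carrier ?G \<and> \<phi> (s j) ` U j \<subseteq> B) \<and>
        C \<subseteq> (\<Union>j\<in>J. U j) \<and> disjoint_family_on (\<lambda>j. \<phi> (s j) ` U j) J"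
      proof (intro exI conjI ballI)
        have "finite (a i)" "finite (T' i)" if "i \<in> I" for i
          using fin(2)[OF that] T'(1)[OF that] by (auto simp: a_def intro: finite_subset)
        then show "finite J" using fin(1) by (auto simp: J_def)
        show "openin (top_of_set X) (W q)" if q: "q \<in> J" for q
          using J[OF q]
        proof (elim disjE exE conjE)
          fix i t assume "q = Inl (i, t)" "i \<in> I" "t \<in> a i"
          then show ?thesis using aT op by (auto simp: Wl intro!: openin_tr)
        next
          fix j i t assume "q = Inr (j, i, t)" "j < n0" "i \<in> I" "t \<in> T' i"
          then show ?thesis using U T'N op by (auto simp: Wl intro!: openin_tr openin_Int)
        qed
        show "l q \<in> carrier ?G" if q: "q \<in> J" for q
          using J[OF q]
        proof (elim disjE exE conjE)
          fix i t assume "q = Inl (i, t)" "i \<in> I" "t \<in> a i"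
          then show ?thesis using aT fN1 by (auto simp: Wl)
        next
          fix j i t assume "q = Inr (j, i, t)" "j < n0" "i \<in> I" "t \<in> T' i"
          then show ?thesis using U(2) T'N fN2 by (auto simp: Wl)
        qed
        show "\<phi> (l q) ` W q \<subseteq> B" if q: "q \<in> J" for q
          using J[OF q]
        proof (elim disjE exE conjE)
          fix i t assume [simp]: "q = Inl (i, t)" and it: "i \<in> I" "t \<in> a i"
          show ?thesis using kL[OF it] fb(2)[of i "Inl t"] it by auto
        next
          fix j i t assume [simp]: "q = Inr (j, i, t)" and it: "j < n0" "i \<in> I" "t \<in> T' i"
          show ?thesis using kR[OF it] fb(2)[of i "Inr t"] it by auto
        qed
        show "C \<subseteq> (\<Union>q\<in>J. W q)"
        proof
          fix x assume x: "x \<in> C"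
          then have xA: "x \<in> A" "x \<in> X" using C(2) AX by auto
          show "x \<in> (\<Union>q\<in>J. W q)"
          proof (cases "x \<in> tiles I T V")
            case True
            then obtain i t v where it: "i \<in> I" "t \<in> T i" "v \<in> V i" "x = \<phi> t v" by (auto simp: mem_tiles)
            have "t \<in> a i" using it xA by (auto simp: a_def)
            moreover have "x \<in> tr t (V i)"
              using it fin(3,4)[OF it(1)] by (auto simp: mem_tr_act subset_iff)
            ultimately have "Inl (i, t) \<in> J" "x \<in> W (Inl (i, t))" using it by (auto simp: J_def Wl)
            then show ?thesis by blast
          next
            case False
            then obtain j where j: "j < n0" "x \<in> U j" using cov x xA by blast
            then have "\<phi> (s j) x \<in> tiles I T' V" using U(3)[OF j(1)] by blast
            then obtain i t v where it: "i \<in> I" "t \<in> T' i" "v \<in> V i" "\<phi> (s j) x = \<phi> t v"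
              by (auto simp: mem_tiles)
            have "t \<in> carrier G" "v \<in> X" using T'N[OF it(2,1)] fin(4)[OF it(1)] it(3) by auto
            then have "\<phi> (s j) x \<in> tr t (V i)"
              using it by (simp add: mem_tr_act)
            then have "Inr (j, i, t) \<in> J" "x \<in> W (Inr (j, i, t))"
              using it j U(2)[OF j(1)] xA by (auto simp: J_def Wl mem_tr_inv)
            then show ?thesis by blast
          qed
        qed
        show "disjoint_family_on (\<lambda>q. \<phi> (l q) ` W q) J"
          unfolding disjoint_family_on_def
        proof (intro ballI impI, rule ccontr)
          fix q q' assume q: "q \<in> J" "q' \<in> J" "q \<noteq> q'" and "\<phi> (l q) ` W q \<inter> \<phi> (l q') ` W q' \<noteq> {}"
          then obtain x y where xy: "x \<in> W q" "y \<in> W q'" "\<phi> (l q) x = \<phi> (l q') y" by blast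
          show False
            using J[OF q(1)] J[OF q(2)]
          proof (elim disjE exE conjE)
            fix i t i' t' assume [simp]: "q = Inl (i, t)" "q' = Inl (i', t')"
              and it: "i \<in> I" "t \<in> a i" and it': "i' \<in> I" "t' \<in> a i'"
            show False
              using uniq[OF it(1) it'(1) InlI[OF it(2)] InlI[OF it'(2)] kL(1)[OF it] kL(1)[OF it']]
                kL(2)[OF it] kL(2)[OF it'] xy q(3) by simp
          next
            fix i t j' i' t' assume [simp]: "q = Inl (i, t)" "q' = Inr (j', i', t')"
              and it: "i \<in> I" "t \<in> a i" and it': "j' < n0" "i' \<in> I" "t' \<in> T' i'"
            show False
              using uniq[OF it(1) it'(2) InlI[OF it(2)] InrI[OF it'(3)] kL(1)[OF it] kR(1)[OF it']]
                kL(2)[OF it] kR(2)[OF it'] xy by simp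
          next
            fix j i t i' t' assume [simp]: "q = Inr (j, i, t)" "q' = Inl (i', t')"
              and it: "j < n0" "i \<in> I" "t \<in> T' i" and it': "i' \<in> I" "t' \<in> a i'"
            show False
              using uniq[OF it(2) it'(1) InrI[OF it(3)] InlI[OF it'(2)] kR(1)[OF it] kL(1)[OF it']]
                kR(2)[OF it] kL(2)[OF it'] xy by simp
          next
            fix j i t j' i' t' assume [simp]: "q = Inr (j, i, t)" "q' = Inr (j', i', t')"
              and it: "j < n0" "i \<in> I" "t \<in> T' i" and it': "j' < n0" "i' \<in> I" "t' \<in> T' i'"
            let ?x = "\<phi> (inv t) (\<phi> (s j) x)" and ?y = "\<phi> (inv t') (\<phi> (s j') y)"
            have k: "?x \<in> V i" "?y \<in> V i'" "\<phi> (f i (Inr t)) ?x = \<phi> (f i' (Inr t')) ?y"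
              using kR[OF it, of x] kR[OF it', of y] xy by auto
            have eq: "i = i'" "t = t'"
              using uniq[OF it(2) it'(2) InrI[OF it(3)] InrI[OF it'(3)] k] by simp_all
            have xyX: "x \<in> X" "y \<in> X" using xy U(4) it it' by (auto simp: Wl)
            have c: "t \<in> carrier G" "s j \<in> carrier G" "s j' \<in> carrier G" "f i (Inr t) \<in> carrier G"
              using T'N[of t i] it it' U(2) fN2[of i t] by auto
            have sX: "\<phi> (s j) x \<in> X" "\<phi> (s j') y \<in> X" using c xyX by simp_all
            have "?x = ?y"
              by (rule act_inj[OF c(4)]) (use k(3) c sX in \<open>simp_all add: eq[symmetric]\<close>)
            then have "\<phi> (inv t) (\<phi> (s j) x) = \<phi> (inv t) (\<phi> (s j') y)" by (simp only: eq(2)[symmetric])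
            then have "\<phi> (s j) x = \<phi> (s j') y"
              by (rule act_inj[rotated -1]) (use c sX in simp_all)
            moreover have "\<phi> (s j) x \<in> \<phi> (s j) ` U j" "\<phi> (s j') y \<in> \<phi> (s j') ` U j'"
              using xy by (simp_all add: Wl)
            moreover have "j \<noteq> j'" using q(3) eq by simp
            then have "\<phi> (s j) ` U j \<inter> \<phi> (s j') ` U j' = {}"
              using dis it(1) it'(1) unfolding disjoint_family_on_def by simp
            ultimately show False by (metis IntI empty_iff)
          qed
        qed
      qed
    qed
  qed
qed


section \<open>Castles with regular bases\<close>

text \<open>A finite partition into small regular cells: finitely many regular sets cover
  \<open>X\<close>, and a point is coded by the first of them that contains it. Each of these sets
  lies in a ball of radius \<open>r / 2\<close>.\<close>

lemma small_code:
  assumes r: "r > 0"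
  obtains \<kappa> :: "'x \<Rightarrow> nat" and q where "\<And>x. x \<in> X \<Longrightarrow> \<kappa> x < q" "\<And>c. reg {x \<in> X. \<kappa> x = c}"
    "\<And>x y. x \<in> X \<Longrightarrow> y \<in> X \<Longrightarrow> \<kappa> x = \<kappa> y \<Longrightarrow> dist x y < r"
proof -
  have "X \<subseteq> (\<Union>d\<in>X. ball d (r/4))" using r by auto
  then obtain D where D: "D \<subseteq> X" "finite D" "X \<subseteq> (\<Union>d\<in>D. ball d (r/4))"
    using compactE_image[OF compact, of X "\<lambda>d. ball d (r/4)"] by auto
  have "\<exists>U. reg U \<and> cball d (r/4) \<inter> X \<subseteq> U \<and> U \<subseteq> ball d (r/2) \<inter> X" for d
  proof -
    have 1: "closedin (top_of_set X) (cball d (r/4) \<inter> X)" by (metis closed_cball closedin_closed_Int inf_commute)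
    have 2: "openin (top_of_set X) (ball d (r/2) \<inter> X)" by (metis open_ball openin_open_Int inf_commute)
    have 3: "cball d (r/4) \<inter> X \<subseteq> ball d (r/2) \<inter> X" using r by auto
    show ?thesis using reg_between[OF 1 2 3] by metis
  qed
  then obtain U where U: "\<And>d. reg (U d)" "\<And>d. cball d (r/4) \<inter> X \<subseteq> U d" "\<And>d. U d \<subseteq> ball d (r/2) \<inter> X"
    by metis
  obtain ds where ds: "set ds = D" using D(2) finite_list by blast
  define \<kappa> where "\<kappa> = (\<lambda>x. LEAST j. j < length ds \<and> x \<in> U (ds ! j))"
  have ex: "\<exists>j. j < length ds \<and> x \<in> U (ds ! j)" if x: "x \<in> X" for x
  proof -
    obtain d where "d \<in> D" "x \<in> ball d (r/4)" using D(3) x by blast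
    moreover then have "x \<in> U d" using U(2)[of d] x by auto
    ultimately show ?thesis using ds by (metis in_set_conv_nth)
  qed
  have k: "\<kappa> x < length ds" "x \<in> U (ds ! \<kappa> x)" if "x \<in> X" for x
    using LeastI_ex[OF ex[OF that]] unfolding \<kappa>_def by auto
  show thesis
  proof (rule that)
    show "\<kappa> x < length ds" if "x \<in> X" for x using k(1)[OF that] .
    show "reg {x \<in> X. \<kappa> x = c}" for c
    proof (rule reg_determined[of "(\<lambda>d. (\<one>, U d)) ` D"])
      fix x y assume xy: "x \<in> X" "y \<in> X"
        and eq: "\<And>a A. (a, A) \<in> (\<lambda>d. (\<one>, U d)) ` D \<Longrightarrow> (\<phi> a x \<in> A) = (\<phi> a y \<in> A)"
      have "x \<in> U d \<longleftrightarrow> y \<in> U d" if "d \<in> D" for d using eq[of \<one> "U d"] that xy by auto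
      then have "\<kappa> x = \<kappa> y" unfolding \<kappa>_def using ds by (metis nth_mem)
      then show "x \<in> {x \<in> X. \<kappa> x = c} \<longleftrightarrow> y \<in> {x \<in> X. \<kappa> x = c}" using xy by simp
    qed (use D U in auto)
    show "dist x y < r" if "x \<in> X" "y \<in> X" "\<kappa> x = \<kappa> y" for x y
    proof -
      have "dist (ds ! \<kappa> x) x < r/2" "dist (ds ! \<kappa> x) y < r/2"
        using k(2)[OF that(1)] k(2)[OF that(2)] that(3) U(3) by fastforce+
      then show ?thesis using dist_triangle3[of x y "ds ! \<kappa> x"] by linarith
    qed
  qed
qed

text \<open>By freeness the displacement function of each element is positive, and it attains its
  minimum on the compact space.\<close>

lemma uniformly_free:
  assumes E: "finite E" "E \<subseteq> carrier G - {\<one>}"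
  obtains r where "r > 0" "\<And>a x. a \<in> E \<Longrightarrow> x \<in> X \<Longrightarrow> r \<le> dist x (\<phi> a x)"
proof -
  have "\<exists>r>0. \<forall>a\<in>E. \<forall>x\<in>X. r \<le> dist x (\<phi> a x)"
    using E
  proof (induction E rule: finite_induct)
    case (insert a E)
    then obtain r where r: "r > 0" "\<forall>a\<in>E. \<forall>x\<in>X. r \<le> dist x (\<phi> a x)" by auto
    have a: "a \<in> carrier G" "a \<noteq> \<one>" using insert by auto
    have "continuous_on X (\<lambda>x. dist x (\<phi> a x))"
      using act_cont[OF a(1)] by (intro continuous_intros)
    then obtain x where x: "x \<in> X" "\<And>y. y \<in> X \<Longrightarrow> dist x (\<phi> a x) \<le> dist y (\<phi> a y)"
      using continuous_attains_inf[OF compact nonempty, of "\<lambda>x. dist x (\<phi> a x)"] by metis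
    have "dist x (\<phi> a x) > 0" using act_free[OF a(1) x(1)] a(2) by (auto simp: eq_commute)
    then have "min r (dist x (\<phi> a x)) > 0" using r(1) by simp
    moreover have "min r (dist x (\<phi> a x)) \<le> dist y (\<phi> b y)" if "b \<in> insert a E" "y \<in> X" for b y
      using that r(2) x(2) by (metis insertE min.coboundedI1 min.coboundedI2)
    ultimately show ?case by blast
  qed (auto intro: exI[of _ 1])
  then show thesis using that by blast
qed

text \<open>The open bases are shrunk to regular ones. Base points having a level point at distance
  at least \<open>r\<close> from the remainder form a closed set \<open>Z i\<close>, so a regular
  set fits between \<open>Z i\<close> and \<open>V i\<close>. Whatever is lost lies within
  \<open>r\<close> of the old remainder, and this neighbourhood still has small density.\<close>

lemma reg_castle_exists:
  assumes K: "finite K" "K \<subseteq> N" and d: "\<delta> > 0" and h: "\<eta> > 0"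
  obtains I :: "nat set" and T V where
    "castle G X \<phi> I T V" "\<And>i. i \<in> I \<Longrightarrow> Folner K \<delta> (T i)" "\<And>i. i \<in> I \<Longrightarrow> reg (V i)"
    "dens (X - tiles I T V) \<lesssim>\<^sub>N (\<lambda>_ _. \<eta>)"
proof -
  obtain m :: nat where m: "m \<ge> 1" "1 / real m < \<eta>"
    using reals_Archimedean[OF h] by (metis Suc_le_mono One_nat_def inverse_eq_divide le0)
  show thesis
  proof (rule open_castle_small_remainder[OF m(1) K d], goal_cases)
    case (1 I T V)
    note c = 1(1) and fol = 1(2) and op = 1(3) and R = 1(5)
    note fin = castle_fin[OF c]
    let ?R = "X - tiles I T V"
    have cR: "closedin (top_of_set X) ?R" by (rule closedin_remainder[OF c op])
    obtain r where r: "r > 0" "dens (nbhd ?R r) \<lesssim>\<^sub>N (\<lambda>_ _. \<eta>)"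
      by (rule dens_nbhd[OF cR R m(2)])
    have nb: "openin (top_of_set X) (nbhd ?R r)"
    proof -
      have "nbhd ?R r = X \<inter> (\<Union>y\<in>?R. ball y r)" by (auto simp: nbhd_def dist_commute)
      then show ?thesis by auto
    qed
    define Z where "Z = (\<lambda>i. {v \<in> V i. \<exists>t\<in>T i. \<phi> t v \<notin> nbhd ?R r})"
    have "\<exists>U. reg U \<and> Z i \<subseteq> U \<and> U \<subseteq> V i" if i: "i \<in> I" for i
    proof -
      have cl: "closedin (top_of_set X) {v \<in> V i. \<phi> t v \<notin> nbhd ?R r}" if t: "t \<in> T i" for t
      proof -
        have tc: "t \<in> carrier G" using fin i t by blast
        let ?S = "Sigma I T - {(i, t)}"
        \<comment> \<open>Removing this open set from \<open>X\<close> leaves the part of level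
          \<open>t\<close> of tower \<open>i\<close> that is far from the remainder: the
          neighbourhood swallows the remainder, the union swallows all other levels.\<close>
        let ?O = "nbhd ?R r \<union> (\<Union>p\<in>?S. tr (snd p) (V (fst p)))"
        have "openin (top_of_set X) ?O"
        proof (intro openin_Un nb openin_Union)
          fix B assume "B \<in> (\<lambda>p. tr (snd p) (V (fst p))) ` ?S"
          then obtain p where "p \<in> Sigma I T" "B = tr (snd p) (V (fst p))" by blast
          then obtain j s where "j \<in> I" "s \<in> T j" "B = tr s (V j)" by auto
          then show "openin (top_of_set X) B" using fin(3)[of j] op by (auto intro!: openin_tr)
        qed
        then have "closedin (top_of_set X) (X - ?O)" by (rule closedin_diff[OF closedin_self])
        then have "closedin (top_of_set X) (tr (inv t) (X - ?O))" using tc by (intro closedin_tr) auto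
        moreover have "tr (inv t) (X - ?O) = {v \<in> V i. \<phi> t v \<notin> nbhd ?R r}"
        proof (intro equalityI subsetI)
          fix v assume "v \<in> tr (inv t) (X - ?O)"
          then have v: "v \<in> X" "\<phi> t v \<in> X" "\<phi> t v \<notin> ?O" using tc by (auto simp: mem_tr_inv)
          have "\<phi> t v \<notin> ?R" using v(2,3) r(1) by (force simp: nbhd_def)
          then obtain j s w where j: "j \<in> I" "s \<in> T j" "w \<in> V j" "\<phi> t v = \<phi> s w"
            using v(2) by (auto simp: mem_tiles)
          have sc: "s \<in> carrier G" "w \<in> X" using fin(3,4)[OF j(1)] j by auto
          have lev: "\<phi> t v \<in> tr s (V j)" using j sc by (simp add: mem_tr_act)
          have js: "j = i \<and> s = t"
          proof (rule ccontr)
            assume "\<not> (j = i \<and> s = t)"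
            then have "(j, s) \<in> ?S" using j by simp
            then have "\<phi> t v \<in> (\<Union>p\<in>?S. tr (snd p) (V (fst p)))" by (rule UN_I) (simp add: lev)
            then show False using v(3) by simp
          qed
          then have "\<phi> t v = \<phi> t w" using j by simp
          then have "v = w" by (rule act_inj[OF tc v(1) sc(2)])
          then show "v \<in> {v \<in> V i. \<phi> t v \<notin> nbhd ?R r}" using j v js by auto
        next
          fix v assume v: "v \<in> {v \<in> V i. \<phi> t v \<notin> nbhd ?R r}"
          then have vX: "v \<in> X" "v \<in> V i" using fin(4)[OF i] by auto
          have "\<phi> t v \<notin> tr s (V j)" if "(j, s) \<in> ?S" for j s
          proof
            assume a: "\<phi> t v \<in> tr s (V j)"
            have js: "j \<in> I" "s \<in> T j" using that by auto
            then have "tr s (V j) = \<phi> s ` V j" using fin by (intro tr_image) auto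
            then obtain w where "w \<in> V j" "\<phi> t v = \<phi> s w" using a by auto
            then have "i = j \<and> t = s" using castle_unique[OF c i js(1) t js(2) vX(2)] by blast
            then show False using that by simp
          qed
          then have "\<phi> t v \<notin> tr (snd p) (V (fst p))" if "p \<in> ?S" for p
            using that by (metis prod.collapse)
          then have "\<phi> t v \<notin> (\<Union>p\<in>?S. tr (snd p) (V (fst p)))" by (simp only: UN_iff) blast
          then have "\<phi> t v \<notin> ?O" using v by simp
          then show "v \<in> tr (inv t) (X - ?O)" using vX tc by (simp add: mem_tr_inv)
        qed
        ultimately show ?thesis by simp
      qed
      have "Z i = (\<Union>t\<in>T i. {v \<in> V i. \<phi> t v \<notin> nbhd ?R r})" by (auto simp: Z_def)
      then have "closedin (top_of_set X) (Z i)" using cl fin(2)[OF i] by (auto intro!: closedin_Union)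
      then show ?thesis
        by (rule reg_between[OF _ op[OF i]]) (auto simp: Z_def)
    qed
    then obtain U where U: "\<And>i. i \<in> I \<Longrightarrow> reg (U i) \<and> Z i \<subseteq> U i \<and> U i \<subseteq> V i" by metis
    have "castle G X \<phi> I T U" using c by (rule castle_sub) (use U in auto)
    moreover have "X - tiles I T U \<subseteq> nbhd ?R r"
    proof
      fix x assume x: "x \<in> X - tiles I T U"
      show "x \<in> nbhd ?R r"
      proof (cases "x \<in> tiles I T V")
        case True
        then obtain i t v where it: "i \<in> I" "t \<in> T i" "v \<in> V i" "x = \<phi> t v" by (auto simp: mem_tiles)
        then have "v \<notin> U i" using x by (auto simp: mem_tiles)
        then have "v \<notin> Z i" using U it(1) by blast
        then show ?thesis using it by (auto simp: Z_def)
      next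
        case False
        then show ?thesis using x r(1) by (force simp: nbhd_def)
      qed
    qed
    then have "dens (X - tiles I T U) \<lesssim>\<^sub>N (\<lambda>_ _. \<eta>)" by (intro dens_le_mono[OF r(2)]) auto
    ultimately show ?case using that[of I T U] fol U by blast
  qed
qed

definition ks :: "nat \<Rightarrow> int set" where "ks n = {k. k \<noteq> 0 \<and> \<bar>k\<bar> \<le> int n}"

lemma finite_ks [simp]: "finite (ks n)"
  by (rule finite_subset[of _ "{- int n..int n}"]) (auto simp: ks_def)

lemma ks_minus: "k \<in> ks n \<Longrightarrow> - k \<in> ks n" by (auto simp: ks_def)

lemma reg_Int: "reg A \<Longrightarrow> reg B \<Longrightarrow> reg (A \<inter> B)"
proof (rule reg_determined[of "{(\<one>, A), (\<one>, B)}"])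
  fix x y assume xy: "x \<in> X" "y \<in> X"
    and eq: "\<And>a C. (a, C) \<in> {(\<one>, A), (\<one>, B)} \<Longrightarrow> (\<phi> a x \<in> C) = (\<phi> a y \<in> C)"
  show "(x \<in> A \<inter> B) = (y \<in> A \<inter> B)" using eq[of \<one> A] eq[of \<one> B] xy by simp
qed auto

text \<open>The bases are cut according to a code whose cells are smaller than the displacement of the
  relevant group elements, so that no tower meets its own translates under \<open>\<gamma> k\<close>.\<close>

lemma separated_castle_exists:
  assumes K: "finite K" "K \<subseteq> N" and d: "\<delta> > 0" and h: "\<eta> > 0"
  obtains M :: nat and T V where
    "castle G X \<phi> {..<M} T V" "\<And>i. i < M \<Longrightarrow> Folner K \<delta> (T i)" "\<And>i. i < M \<Longrightarrow> reg (V i)"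
    "\<And>i k s t v w. i < M \<Longrightarrow> k \<in> ks n \<Longrightarrow> s \<in> T i \<Longrightarrow> t \<in> T i \<Longrightarrow> v \<in> V i \<Longrightarrow> w \<in> V i \<Longrightarrow>
      \<phi> (\<gamma> k) (\<phi> s v) \<noteq> \<phi> t w"
    "dens (X - tiles {..<M} T V) \<lesssim>\<^sub>N (\<lambda>_ _. \<eta>)"
proof -
  show thesis
  proof (rule reg_castle_exists[OF K d h], goal_cases)
    case (1 I T V)
    note c = 1(1) and fol = 1(2) and rg = 1(3) and R = 1(4)
    note fin = castle_fin[OF c]
    have TN: "t \<in> N" if "i \<in> I" "t \<in> T i" for i t using fol[OF that(1)] that(2) by (auto simp: Folner_def)
    \<comment> \<open>\<open>\<phi> (\<gamma> k) (\<phi> s v) = \<phi> t w\<close> means that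
      \<open>inv t \<otimes> \<gamma> k \<otimes> s\<close> moves \<open>v\<close> to
      \<open>w\<close>. This element is never the unit, as \<open>\<gamma> k\<close> lies outside
      \<open>N\<close> for \<open>k \<noteq> 0\<close>, so it moves points by at least
      \<open>r\<close>, out of their code cell.\<close>
    define E where "E = (\<Union>i\<in>I. \<Union>k\<in>ks n. \<Union>s\<in>T i. \<Union>t\<in>T i. {inv t \<otimes> \<gamma> k \<otimes> s})"
    have "finite E" using fin by (auto simp: E_def)
    moreover have "E \<subseteq> carrier G - {\<one>}"
    proof
      fix a assume "a \<in> E"
      then obtain i k s t where a: "i \<in> I" "k \<in> ks n" "s \<in> T i" "t \<in> T i" "a = inv t \<otimes> \<gamma> k \<otimes> s"
        by (auto simp: E_def)
      have st: "s \<in> N" "t \<in> N" using TN a by auto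
      have "a \<noteq> \<one>"
      proof
        assume "a = \<one>"
        then have "\<gamma> k = t \<otimes> inv s"
          using a(5) st by (metis N_carrier gam_closed inv_closed inv_inv inv_solve_left inv_solve_right l_one m_closed r_one)
        then have "\<gamma> k \<in> N" using st by simp
        then show False using gam_N a(2) by (auto simp: ks_def)
      qed
      then show "a \<in> carrier G - {\<one>}" using a(5) st by auto
    qed
    ultimately obtain r where r: "r > 0" "\<And>a x. a \<in> E \<Longrightarrow> x \<in> X \<Longrightarrow> r \<le> dist x (\<phi> a x)"
      by (rule uniformly_free) blast
    obtain \<kappa> :: "'x \<Rightarrow> nat" and q where k: "\<And>x. x \<in> X \<Longrightarrow> \<kappa> x < q" "\<And>c. reg {x \<in> X. \<kappa> x = c}"
      "\<And>x y. x \<in> X \<Longrightarrow> y \<in> X \<Longrightarrow> \<kappa> x = \<kappa> y \<Longrightarrow> dist x y < r" by (rule small_code[OF r(1)]) blast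
    define M where "M = card (I \<times> {..<q})"
    obtain f where "bij_betw f {0..<M} (I \<times> {..<q})"
      using ex_bij_betw_nat_finite[of "I \<times> {..<q}"] fin(1) unfolding M_def by auto
    then have f: "f ` {..<M} = I \<times> {..<q}" "inj_on f {..<M}" by (auto simp: bij_betw_def lessThan_atLeast0)
    have fI: "fst (f i) \<in> I" if "i < M" for i using f(1) that by (metis imageI lessThan_iff mem_Times_iff)
    let ?T = "\<lambda>i. T (fst (f i))" and ?V = "\<lambda>i. V (fst (f i)) \<inter> {x \<in> X. \<kappa> x = snd (f i)}"
    have "castle G X \<phi> {..<M} ?T ?V"
    proof (rule castleI)
      fix i j s t v w assume a: "i \<in> {..<M}" "j \<in> {..<M}" "s \<in> ?T i" "t \<in> ?T j" "v \<in> ?V i" "w \<in> ?V j"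
        "\<phi> s v = \<phi> t w"
      then have "fst (f i) = fst (f j) \<and> s = t \<and> v = w"
        using castle_unique[OF c, of "fst (f i)" "fst (f j)" s t v w] fI by auto
      moreover then have "snd (f i) = snd (f j)" using a by auto
      ultimately show "i = j \<and> s = t" using f(2) a(1,2) by (metis inj_onD prod.collapse)
    qed (use fin fI in auto)
    moreover have "tiles {..<M} ?T ?V = tiles I T V"
    proof (intro equalityI subsetI)
      fix x assume "x \<in> tiles I T V"
      then obtain i t v where it: "i \<in> I" "t \<in> T i" "v \<in> V i" "x = \<phi> t v" by (auto simp: mem_tiles)
      then have vX: "v \<in> X" using fin by blast
      then have "(i, \<kappa> v) \<in> f ` {..<M}" using k(1) it(1) f(1) by auto
      then obtain j where "j < M" "f j = (i, \<kappa> v)" by auto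
      then show "x \<in> tiles {..<M} ?T ?V" using it vX unfolding mem_tiles
        by (intro bexI[of _ j] bexI[of _ t] bexI[of _ v]) auto
    qed (use fI in \<open>auto simp: mem_tiles\<close>)
    moreover have "\<phi> (\<gamma> l) (\<phi> s v) \<noteq> \<phi> t w"
      if a: "i < M" "l \<in> ks n" "s \<in> ?T i" "t \<in> ?T i" "v \<in> ?V i" "w \<in> ?V i" for i l s t v w
    proof
      assume eq: "\<phi> (\<gamma> l) (\<phi> s v) = \<phi> t w"
      have st: "s \<in> carrier G" "t \<in> carrier G" "v \<in> X" "w \<in> X" using fin(3)[OF fI[OF a(1)]] a by auto
      have "\<phi> (inv t \<otimes> \<gamma> l \<otimes> s) v = \<phi> (inv t) (\<phi> (\<gamma> l) (\<phi> s v))" using st by (simp add: act_mult)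
      also have "\<dots> = w" using eq st by simp
      finally have w: "\<phi> (inv t \<otimes> \<gamma> l \<otimes> s) v = w" .
      have "inv t \<otimes> \<gamma> l \<otimes> s \<in> E" using a fI[OF a(1)] by (auto simp: E_def)
      then have "r \<le> dist v w" using r(2)[of _ v] st w by metis
      moreover have "dist v w < r" using a st by (intro k(3)) auto
      ultimately show False by simp
    qed
    moreover have "reg (?V i)" if "i < M" for i using rg[OF fI[OF that]] k(2) by (rule reg_Int)
    moreover have "Folner K \<delta> (?T i)" if "i < M" for i using fol[OF fI[OF that]] .
    ultimately show ?case using that[of M ?T ?V] R by simp
  qed
qed


section \<open>Markers for the quotient group of integers\<close>

text \<open>Where \<open>A\<close> fails to be \<open>L\<close>-invariant, in either direction.
  Small density of this set is the form that near invariance of subsets of \<open>X\<close> takes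
  here.\<close>

definition bd :: "'g set \<Rightarrow> 'x set \<Rightarrow> 'x set"
  where "bd L A = {x \<in> X. \<exists>l\<in>L. (\<phi> l x \<in> A) \<noteq> (x \<in> A)}"

text \<open>The scheme of \<open>reg_determined\<close> for algebraic boundaries. Applying
  \<open>l\<close> before \<open>a\<close> amounts to applying the conjugate
  \<open>a \<otimes> l \<otimes> inv a\<close> after \<open>a\<close>, hence the passage from
  \<open>L\<close> to \<open>L'\<close>.\<close>

lemma bd_determined:
  assumes G: "\<And>a A. (a, A) \<in> \<G> \<Longrightarrow> a \<in> carrier G \<and> (\<forall>l\<in>L. a \<otimes> l \<otimes> inv a \<in> L')" and L: "L \<subseteq> carrier G"
    and det: "\<And>x y. x \<in> X \<Longrightarrow> y \<in> X \<Longrightarrow> (\<And>a A. (a, A) \<in> \<G> \<Longrightarrow> \<phi> a x \<in> A \<longleftrightarrow> \<phi> a y \<in> A) \<Longrightarrow>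
      x \<in> B \<longleftrightarrow> y \<in> B"
  shows "bd L B \<subseteq> (\<Union>p\<in>\<G>. tr (inv (fst p)) (bd L' (snd p)))"
proof
  fix x assume "x \<in> bd L B"
  then obtain l where l: "x \<in> X" "l \<in> L" "(\<phi> l x \<in> B) \<noteq> (x \<in> B)" by (auto simp: bd_def)
  have lc: "l \<in> carrier G" using l L by blast
  then obtain a A where a: "(a, A) \<in> \<G>" "(\<phi> a (\<phi> l x) \<in> A) \<noteq> (\<phi> a x \<in> A)"
    using det[of "\<phi> l x" x] l by auto
  have ac: "a \<in> carrier G" "a \<otimes> l \<otimes> inv a \<in> L'" using G[OF a(1)] l by auto
  have "\<phi> (a \<otimes> l \<otimes> inv a) (\<phi> a x) = \<phi> a (\<phi> l x)" using ac lc l by (simp add: act_mult)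
  then have "(\<phi> (a \<otimes> l \<otimes> inv a) (\<phi> a x) \<in> A) \<noteq> (\<phi> a x \<in> A)" using a(2) by simp
  then have "\<phi> a x \<in> bd L' A" using ac l unfolding bd_def by blast
  then have "x \<in> tr (inv (fst (a, A))) (bd L' (snd (a, A)))" using ac l by (simp add: mem_tr_inv)
  then show "x \<in> (\<Union>p\<in>\<G>. tr (inv (fst p)) (bd L' (snd p)))" using a(1) by blast
qed

section \<open>Greedy colouring of towers with boundedly many colours\<close>

definition colour_class :: "(nat \<Rightarrow> 'g set) \<Rightarrow> (nat \<Rightarrow> 'x set) \<Rightarrow> (nat \<Rightarrow> 'x \<Rightarrow> nat) \<Rightarrow> nat \<Rightarrow> nat \<Rightarrow> 'x set"
  where "colour_class T V col j c = {x. \<exists>i<j. \<exists>t\<in>T i. \<exists>v\<in>V i. x = \<phi> t v \<and> col i v = c}"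

lemma colour_classI:
  "i < j \<Longrightarrow> t \<in> T i \<Longrightarrow> v \<in> V i \<Longrightarrow> x = \<phi> t v \<Longrightarrow> col i v = c \<Longrightarrow> x \<in> colour_class T V col j c"
  unfolding colour_class_def by blast

lemma pigeonhole_average:
  fixes f :: "nat \<Rightarrow> nat"
  assumes m: "m \<ge> 1" and le: "(\<Sum>c<m. f c) \<le> b"
  shows "\<exists>c<m. m * f c \<le> b"
proof (rule ccontr)
  assume "\<not> ?thesis"
  then have "b < m * f c" if "c < m" for c using that by (simp add: not_le)
  then have "(\<Sum>c<m. b) < (\<Sum>c<m. m * f c)" using m by (intro sum_strict_mono) (auto simp: lessThan_empty_iff)
  also have "\<dots> = m * (\<Sum>c<m. f c)" by (simp add: sum_distrib_left)
  also have "\<dots> \<le> m * b" using le by simp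
  finally show False by simp
qed

lemma reg_colour_class:
  assumes T: "\<And>i. i < j \<Longrightarrow> finite (T i) \<and> T i \<subseteq> carrier G \<and> V i \<subseteq> X"
    and r: "\<And>i. i < j \<Longrightarrow> reg {v \<in> V i. col i v = c}"
  shows "reg (colour_class T V col j c)"
proof -
  let ?G = "(\<lambda>(i, t). (inv t, {v \<in> V i. col i v = c})) ` Sigma {..<j} T"
  have iff: "x \<in> colour_class T V col j c \<longleftrightarrow> (\<exists>p\<in>?G. \<phi> (fst p) x \<in> snd p)" if x: "x \<in> X" for x
  proof
    assume "x \<in> colour_class T V col j c"
    then obtain i t v where it: "i < j" "t \<in> T i" "v \<in> V i" "x = \<phi> t v" "col i v = c"
      by (auto simp: colour_class_def)
    then have "t \<in> carrier G" "v \<in> X" using T[OF it(1)] by auto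
    then have "\<phi> (inv t) x = v" using it by simp
    then show "\<exists>p\<in>?G. \<phi> (fst p) x \<in> snd p"
      using it by (intro bexI[of _ "(inv t, {v \<in> V i. col i v = c})"]) auto
  next
    assume "\<exists>p\<in>?G. \<phi> (fst p) x \<in> snd p"
    then obtain i t where it: "i < j" "t \<in> T i" "\<phi> (inv t) x \<in> V i" "col i (\<phi> (inv t) x) = c" by auto
    then have "t \<in> carrier G" using T[OF it(1)] by auto
    then have "x = \<phi> t (\<phi> (inv t) x)" using x by simp
    then show "x \<in> colour_class T V col j c" using it unfolding colour_class_def by blast
  qed
  show ?thesis
  proof (rule reg_determined[of ?G])
    show "finite ?G" using T by auto
    show "a \<in> carrier G \<and> reg A" if aA: "(a, A) \<in> ?G" for a A
    proof -
      obtain i t where it: "i < j" "t \<in> T i" "a = inv t" "A = {v \<in> V i. col i v = c}" using aA by auto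
      then show ?thesis using T[OF it(1)] r[OF it(1)] by auto
    qed
    fix x y assume xy: "x \<in> X" "y \<in> X"
      and eq: "\<And>a A. (a, A) \<in> ?G \<Longrightarrow> (\<phi> a x \<in> A) = (\<phi> a y \<in> A)"
    have "(\<phi> (fst p) x \<in> snd p) = (\<phi> (fst p) y \<in> snd p)" if "p \<in> ?G" for p
      using eq[of "fst p" "snd p"] that by simp
    then show "(x \<in> colour_class T V col j c) = (y \<in> colour_class T V col j c)"
      unfolding iff[OF xy(1)] iff[OF xy(2)] by (rule bex_cong[OF refl])
  qed
qed

text \<open>Towers are coloured in order, and all points of a tile share the colour of their base
  point. The shifts of a tile by \<open>ks n\<close> make at most
  \<open>card (ks n) * card (T i)\<close> visits to the earlier colour classes, which are pairwise
  disjoint; so one of \<open>m\<close> colours receives at most an \<open>m\<close>-th of them. The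
  least such colour depends on finitely many regular conditions, so regularity persists. Nothing
  here ties \<open>m\<close> to the castle.\<close>

lemma colouring_exists:
  assumes c: "castle G X \<phi> {..<M} T V" and rg: "\<And>i. i < M \<Longrightarrow> reg (V i)" and m: "m \<ge> 1"
  shows "\<exists>col. \<forall>i<M. (\<forall>c. reg {v \<in> V i. col i v = c}) \<and> (\<forall>v\<in>V i. col i v < m \<and>
    m * card {t \<in> T i. \<exists>k\<in>ks n. \<phi> (\<gamma> k) (\<phi> t v) \<in> colour_class T V col i (col i v)}
      \<le> card (ks n) * card (T i))"
proof -
  note fin = castle_fin[OF c]
  have TV: "finite (T i) \<and> T i \<subseteq> carrier G \<and> V i \<subseteq> X" if "i < M" for i using fin that by auto
  let ?ok = "\<lambda>col i. (\<forall>c. reg {v \<in> V i. col i v = c}) \<and> (\<forall>v\<in>V i. col i v < m \<and>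
    m * card {t \<in> T i. \<exists>k\<in>ks n. \<phi> (\<gamma> k) (\<phi> t v) \<in> colour_class T V col i (col i v)}
      \<le> card (ks n) * card (T i))"
  have "\<exists>col. \<forall>i<j. ?ok col i" if "j \<le> M" for j
    using that
  proof (induction j)
    case (Suc j)
    then obtain col where col: "\<And>i. i < j \<Longrightarrow> ?ok col i" by auto
    have jM: "j < M" using Suc by simp
    let ?P = "\<lambda>c. colour_class T V col j c"
    define f where "f = (\<lambda>v c. card {t \<in> T j. \<exists>k\<in>ks n. \<phi> (\<gamma> k) (\<phi> t v) \<in> ?P c})"
    define Q where "Q = (\<lambda>v c. c < m \<and> m * f v c \<le> card (ks n) * card (T j))"
    define col' where "col' = col(j := \<lambda>v. LEAST c. Q v c)"
    have uniq: "c = c'" if P: "x \<in> ?P c" "x \<in> ?P c'" for x c c'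
    proof -
      obtain i t v where i: "i < j" "t \<in> T i" "v \<in> V i" "x = \<phi> t v" "col i v = c"
        using P(1) unfolding colour_class_def by blast
      obtain i' t' v' where i': "i' < j" "t' \<in> T i'" "v' \<in> V i'" "x = \<phi> t' v'" "col i' v' = c'"
        using P(2) unfolding colour_class_def by blast
      have "i = i' \<and> t = t' \<and> v = v'"
        using castle_unique[OF c, of i i' t t' v v'] i i' jM by simp
      then show ?thesis using i i' by simp
    qed
    have exQ: "\<exists>c. Q v c" for v
    proof -
      have "(\<Sum>c<m. f v c) \<le> (\<Sum>c<m. \<Sum>k\<in>ks n. card {t \<in> T j. \<phi> (\<gamma> k) (\<phi> t v) \<in> ?P c})"
      proof (rule sum_mono)
        fix c
        have "{t \<in> T j. \<exists>k\<in>ks n. \<phi> (\<gamma> k) (\<phi> t v) \<in> ?P c} = (\<Union>k\<in>ks n. {t \<in> T j. \<phi> (\<gamma> k) (\<phi> t v) \<in> ?P c})"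
          by auto
        then show "f v c \<le> (\<Sum>k\<in>ks n. card {t \<in> T j. \<phi> (\<gamma> k) (\<phi> t v) \<in> ?P c})"
          unfolding f_def using card_UN_le[OF finite_ks] by simp
      qed
      also have "\<dots> = (\<Sum>k\<in>ks n. \<Sum>c<m. card {t \<in> T j. \<phi> (\<gamma> k) (\<phi> t v) \<in> ?P c})" by (rule sum.swap)
      also have "\<dots> = (\<Sum>k\<in>ks n. \<Sum>t\<in>T j. card {c \<in> {..<m}. \<phi> (\<gamma> k) (\<phi> t v) \<in> ?P c})"
        using TV[OF jM] by (intro sum.cong refl card_sum_swap) auto
      also have "\<dots> \<le> (\<Sum>k\<in>ks n. \<Sum>t\<in>T j. 1)"
      proof (intro sum_mono)
        fix k t
        show "card {c \<in> {..<m}. \<phi> (\<gamma> k) (\<phi> t v) \<in> ?P c} \<le> 1"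
          using uniq by (intro card_le_Suc0_iff_eq[THEN iffD2, folded One_nat_def]) auto
      qed
      also have "\<dots> = card (ks n) * card (T j)" by simp
      finally show ?thesis using pigeonhole_average[OF m] unfolding Q_def by blast
    qed
    have Q: "Q v (LEAST c. Q v c)" for v using exQ[of v] by (rule LeastI_ex)
    have same: "colour_class T V col' i c = colour_class T V col i c" if "i \<le> j" for i c
      unfolding colour_class_def col'_def using that by (intro Collect_cong ex_cong1 conj_cong refl) auto
    have rP: "reg (?P c)" for c using TV jM col by (intro reg_colour_class) auto
    have "reg {v \<in> V j. (LEAST c. Q v c) = c}" for c
    proof -
      let ?G = "insert (\<one>, V j) ((\<lambda>(k, t, c). (\<gamma> k \<otimes> t, ?P c)) ` (ks n \<times> T j \<times> {..<m}))"
      show ?thesis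
      proof (rule reg_determined[of ?G])
        show "finite ?G" using TV[OF jM] by auto
        show "a \<in> carrier G \<and> reg A" if "(a, A) \<in> ?G" for a A using that TV[OF jM] rg[OF jM] rP by auto
        fix x y assume xy: "x \<in> X" "y \<in> X" and eq: "\<And>a A. (a, A) \<in> ?G \<Longrightarrow> (\<phi> a x \<in> A) = (\<phi> a y \<in> A)"
        have V: "x \<in> V j \<longleftrightarrow> y \<in> V j" using eq[of \<one> "V j"] xy by simp
        have e: "\<phi> (\<gamma> k) (\<phi> t x) \<in> ?P c \<longleftrightarrow> \<phi> (\<gamma> k) (\<phi> t y) \<in> ?P c" if "k \<in> ks n" "t \<in> T j" "c < m" for k t c
        proof -
          have "t \<in> carrier G" using TV[OF jM] that by blast
          moreover have "(\<gamma> k \<otimes> t, ?P c) \<in> ?G" using that by force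
          ultimately show ?thesis using eq xy by (simp add: act_mult[symmetric])
        qed
        then have "f x c = f y c" if "c < m" for c
          unfolding f_def using that by (intro arg_cong[where f = card] Collect_cong conj_cong bex_cong refl) auto
        then have "Q x = Q y" unfolding Q_def by auto
        then show "(x \<in> {v \<in> V j. (LEAST c. Q v c) = c}) = (y \<in> {v \<in> V j. (LEAST c. Q v c) = c})" for c
          using V by simp
      qed
    qed
    then have "?ok col' i" if "i < Suc j" for i
    proof (cases "i = j")
      case True
      then show ?thesis
        using Q \<open>\<And>c. reg {v \<in> V j. (LEAST c. Q v c) = c}\<close> unfolding same[OF order.refl, unfolded True[symmetric]]
        by (auto simp: col'_def Q_def f_def)
    next
      case False
      then have "i < j" "col' i = col i" using that by (auto simp: col'_def)
      then show ?thesis using col[of i] same[of i] by simp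
    qed
    then show ?case by blast
  qed simp
  then show ?thesis by blast
qed


text \<open>\<open>m\<close> is fixed by \<open>\<eta>\<close> and \<open>n\<close> before
  \<open>L\<close> and \<open>\<eta>'\<close> are given: in \<open>marker_exists\<close> the set
  \<open>L\<close> arises from a window whose length depends on \<open>m\<close>.\<close>

lemma coloured_cover:
  assumes h: "\<eta> > 0"
  obtains m :: nat where "\<And>L \<eta>'. finite L \<Longrightarrow> L \<subseteq> N \<Longrightarrow> \<eta>' > 0 \<Longrightarrow> \<exists>P::nat \<Rightarrow> 'x set.
    (\<forall>c<m. reg (P c) \<and> dens (bd L (P c)) \<lesssim>\<^sub>N (\<lambda>_ _. \<eta>')) \<and>
    dens (X - (\<Union>c<m. P c)) \<lesssim>\<^sub>N (\<lambda>_ _. \<eta>) \<and>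
    dens {x \<in> X. \<exists>c<m. x \<in> P c \<and> (\<exists>k\<in>ks n. \<phi> (\<gamma> k) x \<in> P c)} \<lesssim>\<^sub>N (\<lambda>_ _. \<eta>)"
proof -
  define b where "b = real (card (ks n))"
  have b: "b \<ge> 0" by (simp add: b_def)
  \<comment> \<open>Conflicts with earlier tiles have density at most \<open>b / m\<close>; those
    with later tiles are covered by the translates of the former under the \<open>b\<close> shifts.
    The total \<open>b / m * (1 + b)\<close> has to stay below \<open>\<eta>\<close>.\<close>
  obtain m0 :: nat where m0: "b * (1 + b) / \<eta> < m0" using reals_Archimedean2 by blast
  define m where "m = Suc m0"
  have m: "m \<ge> 1" "b / m * (1 + b) \<le> \<eta>"
    using m0 h by (auto simp: m_def field_simps)
  show thesis
  proof (rule that[of m])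
    fix L \<eta>' assume L: "finite L" "L \<subseteq> N" and h': "(\<eta>'::real) > 0"
    \<comment> \<open>Inverses are included because \<open>bd\<close> also counts points outside a
      colour class that are moved into it.\<close>
    define K where "K = L \<union> m_inv G ` L"
    have K: "finite K" "K \<subseteq> N" using L by (auto simp: K_def)
    define d where "d = \<eta>' / (1 + card L)"
    have d: "d > 0" "(1 + card L) * d = \<eta>'" using h' by (auto simp: d_def)
    show "\<exists>P::nat \<Rightarrow> 'x set.
      (\<forall>c<m. reg (P c) \<and> dens (bd L (P c)) \<lesssim>\<^sub>N (\<lambda>_ _. \<eta>')) \<and>
      dens (X - (\<Union>c<m. P c)) \<lesssim>\<^sub>N (\<lambda>_ _. \<eta>) \<and>
      dens {x \<in> X. \<exists>c<m. x \<in> P c \<and> (\<exists>k\<in>ks n. \<phi> (\<gamma> k) x \<in> P c)} \<lesssim>\<^sub>N (\<lambda>_ _. \<eta>)"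
    proof (rule separated_castle_exists[OF K d(1) h, of n], goal_cases)
      case (1 M T V)
      note c = 1(1) and fol = 1(2) and rg = 1(3) and sep = 1(4) and R = 1(5)
      note fin = castle_fin[OF c]
      have TV: "finite (T i) \<and> T i \<subseteq> carrier G \<and> V i \<subseteq> X" if "i < M" for i using fin that by auto
      have TN: "T i \<subseteq> N" if "i \<in> {..<M}" for i using fol that by (auto simp: Folner_def)
      obtain col where col: "\<forall>i<M. (\<forall>c. reg {v \<in> V i. col i v = c}) \<and> (\<forall>v\<in>V i. col i v < m \<and>
        m * card {t \<in> T i. \<exists>k\<in>ks n. \<phi> (\<gamma> k) (\<phi> t v) \<in> colour_class T V col i (col i v)}
          \<le> card (ks n) * card (T i))"
        using colouring_exists[OF c rg m(1)] by blast
      define P where "P = colour_class T V col M"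
      have PX: "P c \<subseteq> X" for c
      proof
        fix x assume "x \<in> P c"
        then obtain i t v where "i < M" "t \<in> T i" "v \<in> V i" "x = \<phi> t v" by (auto simp: P_def colour_class_def)
        then show "x \<in> X" using TV[of i] by auto
      qed
      have Pmem: "x \<in> P (col i v)" if "i < M" "t \<in> T i" "v \<in> V i" "x = \<phi> t v" for x i t v
        using that unfolding P_def colour_class_def by blast
      define Y where "Y = {x. \<exists>i<M. \<exists>t\<in>T i. \<exists>v\<in>V i. x = \<phi> t v \<and>
        (\<exists>k\<in>ks n. \<phi> (\<gamma> k) x \<in> colour_class T V col i (col i v))}"
      have dY: "dens Y \<lesssim>\<^sub>N (\<lambda>_ _. b / m)"
      proof (rule castle_average_const[OF c TN])
        show "Y \<subseteq> tiles {..<M} T V" unfolding Y_def mem_tiles subset_iff by blast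
        fix i v assume i: "i \<in> {..<M}" and v: "v \<in> V i"
        have "{t \<in> T i. \<phi> t v \<in> Y} \<subseteq>
          {t \<in> T i. \<exists>k\<in>ks n. \<phi> (\<gamma> k) (\<phi> t v) \<in> colour_class T V col i (col i v)}"
        proof
          fix t assume t: "t \<in> {t \<in> T i. \<phi> t v \<in> Y}"
          then obtain i' t' v' where i': "i' < M" "t' \<in> T i'" "v' \<in> V i'" "\<phi> t v = \<phi> t' v'"
            "\<exists>k\<in>ks n. \<phi> (\<gamma> k) (\<phi> t v) \<in> colour_class T V col i' (col i' v')"
            unfolding Y_def mem_Collect_eq by (elim conjE exE bexE) metis
          then have "i = i' \<and> t = t' \<and> v = v'" using castle_unique[OF c, of i i' t t' v v'] i t v by simp
          then show "t \<in> {t \<in> T i. \<exists>k\<in>ks n. \<phi> (\<gamma> k) (\<phi> t v) \<in> colour_class T V col i (col i v)}"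
            using i'(5) t by simp
        qed
        then have "card {t \<in> T i. \<phi> t v \<in> Y} \<le>
          card {t \<in> T i. \<exists>k\<in>ks n. \<phi> (\<gamma> k) (\<phi> t v) \<in> colour_class T V col i (col i v)}"
          using TV i by (intro card_mono) auto
        then have "m * card {t \<in> T i. \<phi> t v \<in> Y} \<le> card (ks n) * card (T i)"
          using col i v by (meson le_trans lessThan_iff mult_le_mono2)
        then have "real m * card {t \<in> T i. \<phi> t v \<in> Y} \<le> b * card (T i)"
          unfolding b_def by (metis of_nat_le_iff of_nat_mult)
        then show "card {t \<in> T i. \<phi> t v \<in> Y} \<le> b / m * card (T i)" using m(1) by (simp add: field_simps)
      qed (use b in \<open>simp_all add: divide_nonneg_nonneg\<close>)
      \<comment> \<open>A conflict is charged to the tile with the larger index: either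
        \<open>x\<close> lies in \<open>Y\<close> or its shifted partner does. Equal indices are
        excluded since no tower meets its own shifts.\<close>
      have confl: "x \<in> Y \<union> (\<Union>k\<in>ks n. tr (\<gamma> k) Y)"
        if xc: "x \<in> X" "x \<in> P c" "k \<in> ks n" "\<phi> (\<gamma> k) x \<in> P c" for x c k
      proof -
        obtain i t v where i: "i < M" "t \<in> T i" "v \<in> V i" "x = \<phi> t v" "col i v = c"
          using xc(2) unfolding P_def colour_class_def by blast
        obtain j s w where j: "j < M" "s \<in> T j" "w \<in> V j" "\<phi> (\<gamma> k) x = \<phi> s w" "col j w = c"
          using xc(4) unfolding P_def colour_class_def by blast
        consider "j < i" | "j = i" | "i < j" by linarith
        then show ?thesis
        proof cases
          case 1
          then have "\<phi> (\<gamma> k) x \<in> colour_class T V col i (col i v)"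
            using i(5) j(5) by (intro colour_classI[of j i s T w V, OF 1 j(2-4)]) simp
          then have "x \<in> Y" using i(1-4) xc(3) unfolding Y_def by blast
          then show ?thesis by blast
        next
          case 2
          then show ?thesis using sep[of i k t s v w] i j xc(3) by simp
        next
          case 3
          let ?y = "\<phi> (\<gamma> k) x"
          have y: "\<phi> (\<gamma> (- k)) ?y = x" using xc(1) by (simp add: act_gam)
          then have "\<phi> (\<gamma> (- k)) ?y \<in> colour_class T V col j (col j w)"
            using i(4,5) j(5) y by (intro colour_classI[of i j t T v V, OF 3 i(2,3)]) simp_all
          then have "?y \<in> Y" using j(1-4) ks_minus[OF xc(3)] unfolding Y_def by blast
          then have "x \<in> tr (\<gamma> (- k)) Y" using xc(1) by (simp add: tr_def gam_minus)
          then show ?thesis using ks_minus[OF xc(3)] by blast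
        qed
      qed
      have "dens (\<Union>k\<in>ks n. tr (\<gamma> k) Y) \<lesssim>\<^sub>N (\<lambda>_ _. \<Sum>k\<in>ks n. b / m)"
        using dY by (intro dens_UN_const dens_tr_le_const) auto
      from dens_Un_const[OF dY this]
      have "dens (Y \<union> (\<Union>k\<in>ks n. tr (\<gamma> k) Y)) \<lesssim>\<^sub>N (\<lambda>_ _. b / m + (\<Sum>k\<in>ks n. b / m))" .
      then have A: "dens {x \<in> X. \<exists>c<m. x \<in> P c \<and> (\<exists>k\<in>ks n. \<phi> (\<gamma> k) x \<in> P c)} \<lesssim>\<^sub>N (\<lambda>_ _. \<eta>)"
        using confl m(2) by (elim dens_le_mono) (auto simp: b_def distrib_left add_divide_distrib)
      have "tiles {..<M} T V \<subseteq> (\<Union>c<m. P c)"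
      proof
        fix x assume "x \<in> tiles {..<M} T V"
        then obtain i t v where it: "i < M" "t \<in> T i" "v \<in> V i" "x = \<phi> t v" by (auto simp: mem_tiles)
        then have "col i v < m" using col by blast
        then show "x \<in> (\<Union>c<m. P c)" using Pmem[OF it] by blast
      qed
      then have B: "dens (X - (\<Union>c<m. P c)) \<lesssim>\<^sub>N (\<lambda>_ _. \<eta>)" by (intro dens_le_mono[OF R]) auto
      \<comment> \<open>Tiles are monochromatic, so a colour class can change only where
        \<open>K\<close> leaves a tile. The constant \<open>d\<close> is such that the bounds for
        \<open>Z\<close> and its \<open>card L\<close> translates add up to
        \<open>\<eta>'\<close>.\<close>
      define Z where "Z = {x. \<exists>i<M. \<exists>t\<in>T i. \<exists>v\<in>V i. x = \<phi> t v \<and> (\<exists>l\<in>K. l \<otimes> t \<notin> T i)}"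
      have dZ: "dens Z \<lesssim>\<^sub>N (\<lambda>_ _. d)"
      proof (rule castle_average_const[OF c TN])
        show "Z \<subseteq> tiles {..<M} T V" unfolding Z_def mem_tiles subset_iff by blast
        fix i v assume i: "i \<in> {..<M}" and v: "v \<in> V i"
        have "{t \<in> T i. \<phi> t v \<in> Z} \<subseteq> inner_boundary K (T i)"
        proof
          fix t assume t: "t \<in> {t \<in> T i. \<phi> t v \<in> Z}"
          then obtain i' t' v' where i': "i' < M" "t' \<in> T i'" "v' \<in> V i'" "\<phi> t v = \<phi> t' v'"
            "\<exists>l\<in>K. l \<otimes> t' \<notin> T i'"
            unfolding Z_def mem_Collect_eq by (elim conjE exE bexE) metis
          then have "i = i' \<and> t = t' \<and> v = v'" using castle_unique[OF c, of i i' t t' v v'] i t v by simp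
          then show "t \<in> inner_boundary K (T i)" using i'(5) t by (simp add: inner_boundary_def)
        qed
        then have "card {t \<in> T i. \<phi> t v \<in> Z} \<le> card (inner_boundary K (T i))"
          using TV i by (intro card_mono) (auto simp: inner_boundary_def)
        then show "card {t \<in> T i. \<phi> t v \<in> Z} \<le> d * card (T i)"
          using fol[of i] i unfolding Folner_def by simp
      qed (use less_imp_le[OF d(1)] in simp_all)
      have bdP: "bd L (P c) \<subseteq> Z \<union> (\<Union>l\<in>L. tr (inv l) Z)" for c
      proof
        have key: "x \<in> Z" if x: "x \<in> P c" "l \<in> K" "\<phi> l x \<notin> P c" for x l
        proof -
          obtain i t v where i: "i < M" "t \<in> T i" "v \<in> V i" "x = \<phi> t v" "col i v = c"
            using x(1) unfolding P_def colour_class_def by blast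
          have "t \<in> carrier G" "v \<in> X" "l \<in> carrier G" using TV[OF i(1)] i x(2) K by auto
          then have "\<phi> l x = \<phi> (l \<otimes> t) v" using i by (simp add: act_mult)
          then have "l \<otimes> t \<notin> T i" using Pmem[OF i(1) _ i(3)] i(5) x(3) by blast
          then show ?thesis using i x(2) unfolding Z_def by blast
        qed
        fix x assume "x \<in> bd L (P c)"
        then obtain l where l: "x \<in> X" "l \<in> L" "(\<phi> l x \<in> P c) \<noteq> (x \<in> P c)" by (auto simp: bd_def)
        have lc: "l \<in> carrier G" "l \<in> K" "inv l \<in> K" using l L by (auto simp: K_def)
        show "x \<in> Z \<union> (\<Union>l\<in>L. tr (inv l) Z)"
        proof (cases "x \<in> P c")
          case True
          then show ?thesis using key[of x l] l lc by blast
        next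
          case False
          then have "\<phi> l x \<in> Z" using key[of "\<phi> l x" "inv l"] l lc by simp
          then have "x \<in> tr (inv l) Z" using l lc by (simp add: mem_tr_inv)
          then show ?thesis using l by blast
        qed
      qed
      have "dens (\<Union>l\<in>L. tr (inv l) Z) \<lesssim>\<^sub>N (\<lambda>_ _. \<Sum>l\<in>L. d)"
        using dZ L by (intro dens_UN_const dens_tr_le_const) auto
      from dens_Un_const[OF dZ this]
      have "dens (bd L (P c)) \<lesssim>\<^sub>N (\<lambda>_ _. \<eta>')" for c
        using bdP[of c] d(2) by (elim dens_le_mono) (auto simp: algebra_simps)
      moreover have "reg (P c)" for c unfolding P_def using TV col by (intro reg_colour_class) auto
      ultimately show ?case using A B by blast
    qed
  qed
qed

section \<open>Markers chosen colour by colour\<close>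

primrec greedy_marker :: "(nat \<Rightarrow> 'x set) \<Rightarrow> nat \<Rightarrow> nat \<Rightarrow> 'x set" where
  "greedy_marker P n 0 = {}"
| "greedy_marker P n (Suc c) = greedy_marker P n c \<union>
    {x \<in> X. x \<in> P c \<and> (\<forall>k\<in>ks n. \<phi> (\<gamma> k) x \<notin> P c) \<and> (\<forall>k\<in>ks n. \<phi> (\<gamma> k) x \<notin> greedy_marker P n c)}"

lemma greedy_marker_sub: "greedy_marker P n c \<subseteq> X"
  by (induction c) auto

lemma greedy_marker_mono: "c \<le> d \<Longrightarrow> greedy_marker P n c \<subseteq> greedy_marker P n d"
  by (induction d) (auto simp: le_Suc_eq)

lemma greedy_marker_separated:
  "x \<in> greedy_marker P n c \<Longrightarrow> k \<in> ks n \<Longrightarrow> \<phi> (\<gamma> k) x \<notin> greedy_marker P n c"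
proof (induction c arbitrary: x k)
  case (Suc c)
  have x: "x \<in> X" using Suc.prems(1) greedy_marker_sub by blast
  have undo: "\<phi> (\<gamma> (- k)) (\<phi> (\<gamma> k) x) = x" using x by (simp add: act_gam)
  show ?case
  proof
    assume y: "\<phi> (\<gamma> k) x \<in> greedy_marker P n (Suc c)"
    show False
    proof (cases "x \<in> greedy_marker P n c")
      case True
      then have "\<phi> (\<gamma> k) x \<notin> greedy_marker P n c" using Suc by blast
      then have "\<phi> (\<gamma> (- k)) (\<phi> (\<gamma> k) x) \<notin> greedy_marker P n c" using y ks_minus[OF Suc.prems(2)] by simp
      then show False using undo True by simp
    next
      case False
      then show False using Suc.prems y by auto
    qed
  qed
qed simp

text \<open>Every colour lets the rule look \<open>n\<close> steps further, so membership is decided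
  on a window whose size depends only on \<open>c\<close> and \<open>n\<close>. This makes
  \<open>reg_determined\<close> and \<open>bd_determined\<close> applicable.\<close>

lemma greedy_marker_local:
  assumes "x \<in> X" "y \<in> X"
    "\<And>k c'. \<bar>k\<bar> \<le> (int c + 1) * int n \<Longrightarrow> c' < c \<Longrightarrow> \<phi> (\<gamma> k) x \<in> P c' \<longleftrightarrow> \<phi> (\<gamma> k) y \<in> P c'"
  shows "x \<in> greedy_marker P n c \<longleftrightarrow> y \<in> greedy_marker P n c"
  using assms
proof (induction c arbitrary: x y)
  case (Suc c)
  have bound: "\<bar>k\<bar> \<le> (int (Suc c) + 1) * int n" if "\<bar>k\<bar> \<le> (int c + 1) * int n" for k :: int
    using that by (simp add: algebra_simps)
  have 1: "x \<in> greedy_marker P n c \<longleftrightarrow> y \<in> greedy_marker P n c"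
    using Suc.prems bound by (intro Suc.IH) auto
  have 2: "\<phi> (\<gamma> k) x \<in> greedy_marker P n c \<longleftrightarrow> \<phi> (\<gamma> k) y \<in> greedy_marker P n c" if k: "k \<in> ks n" for k
  proof (rule Suc.IH)
    fix l c' assume l: "\<bar>l\<bar> \<le> (int c + 1) * int n" "c' < c"
    have "\<bar>l + k\<bar> \<le> (int (Suc c) + 1) * int n"
      using l(1) k abs_triangle_ineq[of l k] by (simp add: ks_def algebra_simps)
    then show "(\<phi> (\<gamma> l) (\<phi> (\<gamma> k) x) \<in> P c') = (\<phi> (\<gamma> l) (\<phi> (\<gamma> k) y) \<in> P c')"
      using Suc.prems l(2) by (simp add: act_gam)
  qed (use Suc.prems in auto)
  have 3: "\<phi> (\<gamma> k) x \<in> P c \<longleftrightarrow> \<phi> (\<gamma> k) y \<in> P c" if "\<bar>k\<bar> \<le> int n" for k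
  proof (rule Suc.prems(3))
    have "int n \<le> (int (Suc c) + 1) * int n" by (simp add: algebra_simps)
    then show "\<bar>k\<bar> \<le> (int (Suc c) + 1) * int n" using that by linarith
  qed simp
  have "x \<in> P c \<longleftrightarrow> y \<in> P c" using 3[of 0] Suc.prems by simp
  then show ?case using 1 2 3 Suc.prems(1,2) by (auto simp: ks_def)
qed simp

text \<open>A coloured point in no conflict with its own colour is either marked itself or within
  \<open>n\<close> steps of an earlier marker. The uncovered points are therefore uncoloured or in
  conflict, and both kinds have small density. Near invariance is inherited from the colour classes,
  the marker rule being a finite local function of them.\<close>

lemma marker_exists:
  assumes h: "\<eta> > 0" and L: "finite L" "L \<subseteq> N" and h': "\<eta>' > 0"
  obtains W where "reg W" "dens (bd L W) \<lesssim>\<^sub>N (\<lambda>_ _. \<eta>')" "W \<subseteq> X"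
    "\<And>x k. x \<in> W \<Longrightarrow> k \<in> ks n \<Longrightarrow> \<phi> (\<gamma> k) x \<notin> W"
    "dens {x \<in> X. \<forall>k. \<bar>k\<bar> \<le> int n \<longrightarrow> \<phi> (\<gamma> k) x \<notin> W} \<lesssim>\<^sub>N (\<lambda>_ _. \<eta>)"
proof -
  have h2: "\<eta> / 2 > 0" using h by simp
  obtain m :: nat where m: "\<And>L \<eta>'. finite L \<Longrightarrow> L \<subseteq> N \<Longrightarrow> \<eta>' > 0 \<Longrightarrow> \<exists>P::nat \<Rightarrow> 'x set.
    (\<forall>c<m. reg (P c) \<and> dens (bd L (P c)) \<lesssim>\<^sub>N (\<lambda>_ _. \<eta>')) \<and>
    dens (X - (\<Union>c<m. P c)) \<lesssim>\<^sub>N (\<lambda>_ _. \<eta> / 2) \<and>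
    dens {x \<in> X. \<exists>c<m. x \<in> P c \<and> (\<exists>k\<in>ks n. \<phi> (\<gamma> k) x \<in> P c)} \<lesssim>\<^sub>N (\<lambda>_ _. \<eta> / 2)"
    by (rule coloured_cover[OF h2, of n]) (rule that)
  \<comment> \<open>The window on which membership in the marker set depends. The colour classes
    must be nearly invariant under all conjugates of \<open>L\<close> by \<open>\<gamma> k\<close>
    from this window, each with its share of \<open>\<eta>'\<close>.\<close>
  define R where "R = (int m + 1) * int n"
  define Q where "Q = {- R..R} \<times> {..<m}"
  have Q: "finite Q" by (simp add: Q_def)
  define L' where "L' = (\<Union>k\<in>{- R..R}. (\<lambda>l. \<gamma> k \<otimes> l \<otimes> inv (\<gamma> k)) ` L)"
  have L': "finite L'" "L' \<subseteq> N" using L N_conj by (auto simp: L'_def)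
  have d: "\<eta>' / (1 + card Q) > 0" using h' by simp
  obtain P :: "nat \<Rightarrow> 'x set" where P: "\<And>c. c < m \<Longrightarrow> reg (P c)"
    "\<And>c. c < m \<Longrightarrow> dens (bd L' (P c)) \<lesssim>\<^sub>N (\<lambda>_ _. \<eta>' / (1 + card Q))"
    "dens (X - (\<Union>c<m. P c)) \<lesssim>\<^sub>N (\<lambda>_ _. \<eta> / 2)"
    "dens {x \<in> X. \<exists>c<m. x \<in> P c \<and> (\<exists>k\<in>ks n. \<phi> (\<gamma> k) x \<in> P c)} \<lesssim>\<^sub>N (\<lambda>_ _. \<eta> / 2)"
    using m[OF L' d] by blast
  define W where "W = greedy_marker P n m"
  let ?G = "(\<lambda>(k, c). (\<gamma> k, P c)) ` Q"
  have det: "x \<in> W \<longleftrightarrow> y \<in> W"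
    if xy: "x \<in> X" "y \<in> X" "\<And>a A. (a, A) \<in> ?G \<Longrightarrow> \<phi> a x \<in> A \<longleftrightarrow> \<phi> a y \<in> A" for x y
    unfolding W_def
  proof (rule greedy_marker_local[OF xy(1,2)])
    fix k c' assume "\<bar>k\<bar> \<le> (int m + 1) * int n" "c' < m"
    then have "(\<gamma> k, P c') \<in> ?G" by (force simp: Q_def R_def)
    then show "(\<phi> (\<gamma> k) x \<in> P c') = (\<phi> (\<gamma> k) y \<in> P c')" by (rule xy(3))
  qed
  show thesis
  proof (rule that)
    show "reg W"
      by (rule reg_determined[of ?G, OF _ _ det]) (use Q P(1) in \<open>auto simp: Q_def\<close>)
    have "bd L W \<subseteq> (\<Union>p\<in>?G. tr (inv (fst p)) (bd L' (snd p)))"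
    proof (rule bd_determined[OF _ _ det])
      show "a \<in> carrier G \<and> (\<forall>l\<in>L. a \<otimes> l \<otimes> inv a \<in> L')" if "(a, A) \<in> ?G" for a A
        using that by (auto simp: Q_def L'_def)
    qed (use L in auto)
    moreover have "dens (\<Union>q\<in>Q. tr (inv (\<gamma> (fst q))) (bd L' (P (snd q)))) \<lesssim>\<^sub>N
        (\<lambda>_ _. \<Sum>q\<in>Q. \<eta>' / (1 + card Q))"
      using P(2) by (intro dens_UN_const[OF Q] dens_tr_le_const) (auto simp: Q_def)
    ultimately show "dens (bd L W) \<lesssim>\<^sub>N (\<lambda>_ _. \<eta>')"
      using h' by (elim dens_le_mono) (auto simp: case_prod_beta' field_simps)
    show "W \<subseteq> X" unfolding W_def by (rule greedy_marker_sub)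
    show "\<phi> (\<gamma> k) x \<notin> W" if "x \<in> W" "k \<in> ks n" for x k
      using greedy_marker_separated that unfolding W_def by blast
    have "{x \<in> X. \<forall>k. \<bar>k\<bar> \<le> int n \<longrightarrow> \<phi> (\<gamma> k) x \<notin> W} \<subseteq>
      (X - (\<Union>c<m. P c)) \<union> {x \<in> X. \<exists>c<m. x \<in> P c \<and> (\<exists>k\<in>ks n. \<phi> (\<gamma> k) x \<in> P c)}"
    proof
      fix x assume "x \<in> {x \<in> X. \<forall>k. \<bar>k\<bar> \<le> int n \<longrightarrow> \<phi> (\<gamma> k) x \<notin> W}"
      then have x: "x \<in> X" "\<And>k. \<bar>k\<bar> \<le> int n \<Longrightarrow> \<phi> (\<gamma> k) x \<notin> W" by auto
      show "x \<in> (X - (\<Union>c<m. P c)) \<union> {x \<in> X. \<exists>c<m. x \<in> P c \<and> (\<exists>k\<in>ks n. \<phi> (\<gamma> k) x \<in> P c)}"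
      proof (rule ccontr)
        assume neg: "\<not> ?thesis"
        then obtain c where c: "c < m" "x \<in> P c" using x(1) by blast
        then have "\<forall>k\<in>ks n. \<phi> (\<gamma> k) x \<notin> P c" using neg x(1) by blast
        moreover have sub: "greedy_marker P n c \<subseteq> W" "greedy_marker P n (Suc c) \<subseteq> W"
          unfolding W_def using c(1) by (intro greedy_marker_mono; simp)+
        then have "\<forall>k\<in>ks n. \<phi> (\<gamma> k) x \<notin> greedy_marker P n c" using x(2) by (auto simp: ks_def)
        ultimately have "x \<in> greedy_marker P n (Suc c)" using x(1) c(2) by simp
        then have "x \<in> W" using sub(2) by blast
        then show False using x(2)[of 0] x(1) by simp
      qed
    qed
    then show "dens {x \<in> X. \<forall>k. \<bar>k\<bar> \<le> int n \<longrightarrow> \<phi> (\<gamma> k) x \<notin> W} \<lesssim>\<^sub>N (\<lambda>_ _. \<eta>)"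
      by (intro dens_le_mono[OF dens_Un_const[OF P(3,4)]]) auto
  qed
qed


section \<open>Columns over the markers\<close>

lemma gam_unique:
  assumes "\<gamma> k \<otimes> s = \<gamma> l \<otimes> t" "s \<in> N" "t \<in> N"
  shows "k = l \<and> s = t"
proof -
  have "\<gamma> (- l + k) \<otimes> s = \<gamma> (- l) \<otimes> (\<gamma> k \<otimes> s)" using assms(2) by (simp only: gam_add) (simp add: m_assoc)
  also have "\<dots> = \<gamma> (- l) \<otimes> (\<gamma> l \<otimes> t)" using assms(1) by simp
  also have "\<dots> = \<gamma> (- l + l) \<otimes> t" using assms(3) by (simp only: gam_add) (simp add: m_assoc)
  finally have eq: "\<gamma> (k - l) \<otimes> s = t" using assms(3) by simp
  then have "\<gamma> (k - l) = t \<otimes> inv s" using assms by (auto simp: m_assoc)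
  then have "\<gamma> (k - l) \<in> N" using assms by simp
  then have "k = l" using gam_N by force
  then show ?thesis using eq assms by simp
qed

lemma finite_decomposition:
  assumes "finite \<Gamma>" "\<Gamma> \<subseteq> carrier G"
  obtains L and k0 :: nat where "finite L" "L \<subseteq> N"
    "\<And>a. a \<in> \<Gamma> \<Longrightarrow> \<exists>l\<in>L. \<exists>k. \<bar>k\<bar> \<le> int k0 \<and> a = l \<otimes> \<gamma> k"
proof -
  have "\<exists>p. fst p \<in> N \<and> a = fst p \<otimes> \<gamma> (snd p)" if a: "a \<in> \<Gamma>" for a
  proof -
    have "a \<in> carrier G" using a assms(2) by blast
    then obtain t k where "t \<in> N" "a = t \<otimes> \<gamma> k" using decomp by blast
    then show ?thesis by (intro exI[of _ "(t, k)"]) simp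
  qed
  then obtain f where f: "\<And>a. a \<in> \<Gamma> \<Longrightarrow> fst (f a) \<in> N \<and> a = fst (f a) \<otimes> \<gamma> (snd (f a))" by metis
  define k0 where "k0 = (\<Sum>a\<in>\<Gamma>. nat \<bar>snd (f a)\<bar>)"
  show thesis
  proof (rule that[of "(fst \<circ> f) ` \<Gamma>" k0])
    fix a assume a: "a \<in> \<Gamma>"
    have "nat \<bar>snd (f a)\<bar> \<le> k0" unfolding k0_def using assms(1) a by (intro member_le_sum) auto
    then have "\<bar>snd (f a)\<bar> \<le> int k0" by linarith
    then show "\<exists>l\<in>(fst \<circ> f) ` \<Gamma>. \<exists>k. \<bar>k\<bar> \<le> int k0 \<and> a = l \<otimes> \<gamma> k" using f[OF a] a by auto
  qed (use assms f in auto)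
qed

text \<open>If \<open>k \<otimes> t\<close> lies in \<open>S\<close> and
  \<open>l \<otimes> t\<close> does not, then \<open>k \<otimes> t\<close> is an inner boundary
  point for \<open>l \<otimes> inv k\<close>, and \<open>t\<close> is recovered from
  \<open>k\<close> and \<open>k \<otimes> t\<close>.\<close>

lemma card_Folner_boundary_le:
  assumes K: "finite K" "K \<subseteq> carrier G" and S: "finite S" "S \<subseteq> carrier G"
  shows "card (Folner_boundary G K S) \<le>
    card K * card (inner_boundary ((\<lambda>(a, b). a \<otimes> inv b) ` (K \<times> K)) S)"
proof -
  let ?I = "inner_boundary ((\<lambda>(a, b). a \<otimes> inv b) ` (K \<times> K)) S"
  have "finite ?I" using S by (simp add: inner_boundary_def)
  have "Folner_boundary G K S \<subseteq> (\<lambda>(k, b). inv k \<otimes> b) ` (K \<times> ?I)"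
  proof
    fix t assume "t \<in> Folner_boundary G K S"
    then obtain k l where t: "t \<in> carrier G" "k \<in> K" "l \<in> K" "k \<otimes> t \<in> S" "l \<otimes> t \<notin> S"
      by (auto simp: Folner_boundary_def r_coset_def)
    have kl: "k \<in> carrier G" "l \<in> carrier G" using t K by auto
    have "l \<otimes> inv k \<otimes> (k \<otimes> t) = l \<otimes> t"
      using t kl by (simp add: m_assoc) (simp add: m_assoc[symmetric])
    then have "k \<otimes> t \<in> ?I" using t by (force simp: inner_boundary_def)
    moreover have "t = inv k \<otimes> (k \<otimes> t)" using t kl by (simp add: m_assoc[symmetric])
    ultimately show "t \<in> (\<lambda>(k, b). inv k \<otimes> b) ` (K \<times> ?I)" using t by force
  qed
  then have "card (Folner_boundary G K S) \<le> card ((\<lambda>(k, b). inv k \<otimes> b) ` (K \<times> ?I))"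
    using K \<open>finite ?I\<close> by (intro card_mono) auto
  also have "\<dots> \<le> card (K \<times> ?I)" using K \<open>finite ?I\<close> by (intro card_image_le) auto
  finally show ?thesis by (simp add: card_cartesian_product)
qed

text \<open>The column over a marker stops just before the next marker above it. Heights run up to
  \<open>2 * h\<close> because a marker within \<open>h\<close> steps of
  \<open>\<phi> (\<gamma> (- int h)) x\<close> lies between 0 and \<open>2 * h\<close> steps below
  \<open>x\<close>.\<close>

definition in_column :: "nat \<Rightarrow> 'x set \<Rightarrow> 'x \<Rightarrow> nat \<Rightarrow> bool"
  where "in_column h W x j \<longleftrightarrow> j \<le> 2 * h \<and> (\<forall>i\<in>{1..j}. \<phi> (\<gamma> (int i)) x \<notin> W)"

definition column_shape :: "nat \<Rightarrow> 'x set \<Rightarrow> 'g set \<Rightarrow> 'x \<Rightarrow> 'g set"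
  where "column_shape h W T v =
    {s. \<exists>j t. s = \<gamma> (int j) \<otimes> t \<and> t \<in> T \<and> \<phi> t v \<in> W \<and> in_column h W (\<phi> t v) j}"

lemma column_shapeI:
  "s = \<gamma> (int j) \<otimes> t \<Longrightarrow> t \<in> T \<Longrightarrow> \<phi> t v \<in> W \<Longrightarrow> in_column h W (\<phi> t v) j \<Longrightarrow> s \<in> column_shape h W T v"
  unfolding column_shape_def by blast

lemma column_shapeE:
  assumes "s \<in> column_shape h W T v"
  obtains j t where "s = \<gamma> (int j) \<otimes> t" "t \<in> T" "\<phi> t v \<in> W" "in_column h W (\<phi> t v) j" "j \<le> 2 * h"
  using assms unfolding column_shape_def in_column_def by blast

lemma column_shape_sub:
  "column_shape h W T v \<subseteq> (\<lambda>(j, t). \<gamma> (int j) \<otimes> t) ` ({..2 * h} \<times> T)"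
  by (force elim: column_shapeE)

lemma in_column_down: "in_column h W x j \<Longrightarrow> i \<le> j \<Longrightarrow> in_column h W x i"
  by (auto simp: in_column_def)

lemma in_column_top: obtains r where "\<And>j. in_column h W x j \<longleftrightarrow> j \<le> r"
proof -
  let ?A = "{j. in_column h W x j}"
  have fin: "finite ?A" by (rule finite_subset[of _ "{..2 * h}"]) (auto simp: in_column_def)
  have "0 \<in> ?A" by (simp add: in_column_def)
  then have "Max ?A \<in> ?A" using fin by (intro Max_in) auto
  then have "in_column h W x j \<longleftrightarrow> j \<le> Max ?A" for j
    using Max_ge[OF fin, of j] in_column_down[of h W x "Max ?A" j] by auto
  then show thesis using that by blast
qed

text \<open>No marker lies within \<open>h\<close> steps above another, so each column has at least
  its \<open>h + 1\<close> lowest positions.\<close>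

lemma card_column_shape_ge:
  assumes T: "finite T" "T \<subseteq> N" and sep: "\<And>x k. x \<in> W \<Longrightarrow> k \<in> ks h \<Longrightarrow> \<phi> (\<gamma> k) x \<notin> W"
  shows "(h + 1) * card {t \<in> T. \<phi> t v \<in> W} \<le> card (column_shape h W T v)"
proof -
  let ?T = "{t \<in> T. \<phi> t v \<in> W}"
  let ?f = "\<lambda>(j, t). \<gamma> (int j) \<otimes> t"
  have inj: "inj_on ?f ({..h} \<times> ?T)"
    using gam_unique T by (fastforce intro!: inj_onI)
  have sub: "?f ` ({..h} \<times> ?T) \<subseteq> column_shape h W T v"
  proof
    fix s assume "s \<in> ?f ` ({..h} \<times> ?T)"
    then obtain j t where s: "s = \<gamma> (int j) \<otimes> t" "j \<le> h" "t \<in> T" "\<phi> t v \<in> W" by auto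
    have "in_column h W (\<phi> t v) j"
      using s sep[OF s(4)] by (auto simp: in_column_def ks_def)
    then show "s \<in> column_shape h W T v" using s by (intro column_shapeI)
  qed
  have fin: "finite (column_shape h W T v)"
    using column_shape_sub by (rule finite_subset) (use T in auto)
  have "card ({..h} \<times> ?T) \<le> card (column_shape h W T v)"
    using card_inj_on_le[OF inj sub fin] .
  then show ?thesis by (simp add: card_cartesian_product)
qed

text \<open>Multiplication by \<open>l \<otimes> \<gamma> k\<close> takes height \<open>j\<close>
  over \<open>t\<close> to height \<open>p = j + k\<close> over \<open>l' \<otimes> t\<close>, with
  \<open>l'\<close> a conjugate of \<open>l\<close> by \<open>\<gamma> p\<close>. For
  \<open>t\<close> outside \<open>D\<close> the markers above \<open>t\<close> and above
  \<open>l' \<otimes> t\<close> agree up to height \<open>2 * h\<close>, so the two columns coincide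
  and only the \<open>k0\<close> lowest and \<open>k0\<close> highest positions can leave the shape.
  Each \<open>t\<close> in \<open>D\<close> is charged with a whole column.\<close>

lemma card_inner_boundary_column_shape:
  assumes T: "finite T" "T \<subseteq> N" and v: "v \<in> X"
    and \<Gamma>: "\<And>a. a \<in> \<Gamma> \<Longrightarrow> \<exists>l\<in>L0. \<exists>k. \<bar>k\<bar> \<le> int k0 \<and> a = l \<otimes> \<gamma> k" and L0: "L0 \<subseteq> N"
    and L1: "\<And>l p. l \<in> L0 \<Longrightarrow> p \<le> 2 * h \<Longrightarrow> inv (\<gamma> (int p)) \<otimes> l \<otimes> \<gamma> (int p) \<in> L1" and L1N: "L1 \<subseteq> N"
    and L2: "\<And>l i. l \<in> L1 \<Longrightarrow> i \<le> 2 * h \<Longrightarrow> \<gamma> (int i) \<otimes> l \<otimes> inv (\<gamma> (int i)) \<in> L2"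
    and D: "D \<subseteq> T"
    and good: "\<And>t l. t \<in> T \<Longrightarrow> t \<notin> D \<Longrightarrow> l \<in> L1 \<Longrightarrow> l \<otimes> t \<in> T"
      "\<And>t i. t \<in> T \<Longrightarrow> t \<notin> D \<Longrightarrow> i \<le> 2 * h \<Longrightarrow> \<phi> (\<gamma> (int i)) (\<phi> t v) \<notin> bd L2 W"
  shows "card (inner_boundary \<Gamma> (column_shape h W T v)) \<le>
    2 * k0 * card {t \<in> T. \<phi> t v \<in> W} + (2 * h + 1) * card D"
proof -
  let ?T = "{t \<in> T. \<phi> t v \<in> W}"
  let ?S = "column_shape h W T v"
  have "\<forall>t. \<exists>r. \<forall>j. in_column h W (\<phi> t v) j \<longleftrightarrow> j \<le> r" using in_column_top by metis
  then obtain r where r: "\<And>t j. in_column h W (\<phi> t v) j \<longleftrightarrow> j \<le> r t" by metis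
  \<comment> \<open>The bottom and top \<open>k0\<close> positions of a column. Subtraction is
    truncated: for a column shorter than \<open>k0\<close> the second interval is all of it.\<close>
  define P where "P = (\<lambda>t. {..<k0} \<union> {r t + 1 - k0..r t})"
  have sub: "inner_boundary \<Gamma> ?S \<subseteq>
    (\<Union>t\<in>?T. (\<lambda>j. \<gamma> (int j) \<otimes> t) ` P t) \<union> (\<Union>t\<in>D. (\<lambda>j. \<gamma> (int j) \<otimes> t) ` {..2 * h})"
  proof
    fix b assume "b \<in> inner_boundary \<Gamma> ?S"
    then obtain a where b: "b \<in> ?S" "a \<in> \<Gamma>" "a \<otimes> b \<notin> ?S" by (auto simp: inner_boundary_def)
    obtain j t where jt: "b = \<gamma> (int j) \<otimes> t" "t \<in> T" "\<phi> t v \<in> W" "in_column h W (\<phi> t v) j" "j \<le> 2 * h"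
      using b(1) by (rule column_shapeE)
    obtain l k where lk: "l \<in> L0" "\<bar>k\<bar> \<le> int k0" "a = l \<otimes> \<gamma> k" using \<Gamma>[OF b(2)] by blast
    have tN: "t \<in> N" "l \<in> N" using jt lk T L0 by auto
    show "b \<in> (\<Union>t\<in>?T. (\<lambda>j. \<gamma> (int j) \<otimes> t) ` P t) \<union> (\<Union>t\<in>D. (\<lambda>j. \<gamma> (int j) \<otimes> t) ` {..2 * h})"
    proof (cases "j \<in> P t \<or> t \<in> D")
      case True
      then show ?thesis using jt by blast
    next
      case False
      then have j: "k0 \<le> j" "j + k0 \<le> r t" and tD: "t \<notin> D" using r[of t j] jt(4) by (auto simp: P_def)
      define p where "p = nat (int j + k)"
      have p: "int p = int j + k" "p \<le> r t" using j lk(2) by (auto simp: p_def)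
      have pc: "in_column h W (\<phi> t v) p" using r p by blast
      then have p2: "p \<le> 2 * h" by (simp add: in_column_def)
      define l' where "l' = inv (\<gamma> (int p)) \<otimes> l \<otimes> \<gamma> (int p)"
      have l': "l' \<in> L1" "l' \<in> N" using L1[OF lk(1) p2] L1N by (auto simp: l'_def)
      have l't: "l' \<otimes> t \<in> T" using good(1)[OF jt(2) tD l'(1)] .
      have "a \<otimes> b = l \<otimes> (\<gamma> (int p) \<otimes> t)"
        unfolding lk(3) jt(1) p(1) add.commute[of "int j"] gam_add using tN by (simp add: m_assoc)
      also have "\<dots> = \<gamma> (int p) \<otimes> (l' \<otimes> t)"
        unfolding l'_def using tN by (simp add: m_assoc) (simp add: m_assoc[symmetric])
      finally have ab: "a \<otimes> b = \<gamma> (int p) \<otimes> (l' \<otimes> t)" .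
      have iff: "\<phi> (\<gamma> (int i)) (\<phi> (l' \<otimes> t) v) \<in> W \<longleftrightarrow> \<phi> (\<gamma> (int i)) (\<phi> t v) \<in> W" if i: "i \<le> 2 * h" for i
      proof -
        let ?y = "\<phi> (\<gamma> (int i)) (\<phi> t v)"
        have tv: "\<phi> t v \<in> X" "l' \<in> carrier G" using tN v l' by auto
        have "\<phi> (\<gamma> (int i)) (\<phi> (l' \<otimes> t) v) = \<phi> (\<gamma> (int i) \<otimes> l' \<otimes> inv (\<gamma> (int i))) ?y"
          using tv tN v by (simp add: act_mult)
        moreover have "?y \<notin> bd L2 W" by (rule good(2)[OF jt(2) tD i])
        ultimately show ?thesis using L2[OF l'(1) i] tv unfolding bd_def by auto
      qed
      have "\<phi> (l' \<otimes> t) v \<in> W" using iff[of 0] jt(3) tN l' v by simp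
      moreover have "in_column h W (\<phi> (l' \<otimes> t) v) p"
        using pc iff by (auto simp: in_column_def)
      ultimately have "a \<otimes> b \<in> ?S" using ab l't by (intro column_shapeI)
      then show ?thesis using b(3) by simp
    qed
  qed
  have finT: "finite ?T" "finite D" using T D by (auto intro: finite_subset)
  have cP: "card (P t) \<le> 2 * k0" for t
  proof -
    have "card (P t) \<le> card {..<k0} + card {r t + 1 - k0..r t}" unfolding P_def by (rule card_Un_le)
    then show ?thesis by simp
  qed
  have "card (inner_boundary \<Gamma> ?S) \<le>
    card ((\<Union>t\<in>?T. (\<lambda>j. \<gamma> (int j) \<otimes> t) ` P t) \<union> (\<Union>t\<in>D. (\<lambda>j. \<gamma> (int j) \<otimes> t) ` {..2 * h}))"
    using finT by (intro card_mono[OF _ sub]) (auto simp: P_def)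
  also have "\<dots> \<le> card (\<Union>t\<in>?T. (\<lambda>j. \<gamma> (int j) \<otimes> t) ` P t) + card (\<Union>t\<in>D. (\<lambda>j. \<gamma> (int j) \<otimes> t) ` {..2 * h})"
    by (rule card_Un_le)
  also have "\<dots> \<le> (\<Sum>t\<in>?T. card ((\<lambda>j. \<gamma> (int j) \<otimes> t) ` P t)) + (\<Sum>t\<in>D. card ((\<lambda>j. \<gamma> (int j) \<otimes> t) ` {..2 * h}))"
    using finT by (intro add_mono card_UN_le)
  also have "\<dots> \<le> (\<Sum>t\<in>?T. 2 * k0) + (\<Sum>t\<in>D. 2 * h + 1)"
  proof (intro add_mono sum_mono)
    show "card ((\<lambda>j. \<gamma> (int j) \<otimes> t) ` P t) \<le> 2 * k0" for t
      using card_image_le[of "P t"] cP[of t] by (force simp: P_def intro: order_trans)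
    show "card ((\<lambda>j. \<gamma> (int j) \<otimes> t) ` {..2 * h}) \<le> 2 * h + 1" for t
      using card_image_le[of "{..2 * h}" "\<lambda>j. \<gamma> (int j) \<otimes> t"] by simp
  qed
  finally show ?thesis by (simp add: mult.commute)
qed

lemma uniformly_equicontinuous:
  assumes E: "finite E" "E \<subseteq> carrier G" and d: "\<delta> > 0"
  obtains r where "r > 0" "\<And>s v w. s \<in> E \<Longrightarrow> v \<in> X \<Longrightarrow> w \<in> X \<Longrightarrow> dist v w < r \<Longrightarrow> dist (\<phi> s v) (\<phi> s w) < \<delta>"
proof -
  have "\<exists>r>0. \<forall>s\<in>E. \<forall>v\<in>X. \<forall>w\<in>X. dist v w < r \<longrightarrow> dist (\<phi> s v) (\<phi> s w) < \<delta>"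
    using E
  proof (induction E rule: finite_induct)
    case (insert a E)
    then obtain r where r: "r > 0" "\<forall>s\<in>E. \<forall>v\<in>X. \<forall>w\<in>X. dist v w < r \<longrightarrow> dist (\<phi> s v) (\<phi> s w) < \<delta>" by auto
    have "uniformly_continuous_on X (\<phi> a)"
      using insert.prems act_cont compact by (intro compact_uniformly_continuous) auto
    then obtain r' where r': "r' > 0" "\<forall>v\<in>X. \<forall>w\<in>X. dist v w < r' \<longrightarrow> dist (\<phi> a v) (\<phi> a w) < \<delta>"
      using d unfolding uniformly_continuous_on_def by (metis dist_commute)
    show ?case using r r' by (intro exI[of _ "min r r'"]) auto
  qed (auto intro: exI[of _ 1])
  then show thesis using that by blast
qed

text \<open>Without inner boundary points \<open>F\<close> contains a right translate of
  \<open>K\<close>. A single inner boundary point already forces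
  \<open>1 \<le> \<delta> * card F\<close>, and then \<open>\<delta> * \<tau> \<le> 1\<close> gives
  the claim.\<close>

lemma Folner_large:
  assumes F: "Folner K \<delta> F" and K: "finite K" "K \<subseteq> N" "\<tau> \<le> card K" and d: "\<delta> * real \<tau> \<le> 1"
  shows "\<tau> \<le> card F"
proof -
  have fin: "finite F" "F \<noteq> {}" "F \<subseteq> N" and b: "card (inner_boundary K F) \<le> \<delta> * card F"
    using F by (auto simp: Folner_def)
  obtain f where f: "f \<in> F" using fin by blast
  show ?thesis
  proof (cases "inner_boundary K F = {}")
    case True
    then have "(\<lambda>k. k \<otimes> f) ` K \<subseteq> F" using f by (auto simp: inner_boundary_def)
    moreover have "inj_on (\<lambda>k. k \<otimes> f) K"
      using K(2) f fin(3) by (intro inj_onI) (metis N_carrier right_cancel subsetD)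
    ultimately have "card K \<le> card F" using fin(1) by (metis card_inj_on_le)
    then show ?thesis using K by simp
  next
    case False
    have "finite (inner_boundary K F)" using fin by (auto simp: inner_boundary_def)
    then have "card (inner_boundary K F) \<ge> 1" using False by (simp add: card_gt_0_iff Suc_le_eq)
    then have 1: "1 \<le> \<delta> * card F" using b by linarith
    then have dpos: "\<delta> > 0" by (metis less_le_trans mult_nonpos_nonneg not_le of_nat_0_le_iff zero_less_one)
    have "\<delta> * real \<tau> \<le> \<delta> * real (card F)" using 1 d by linarith
    then show ?thesis using dpos by simp
  qed
qed

text \<open>A finite \<open>N\<close> is itself invariant under every test set, and along it a
  nonempty set has density at least \<open>1 / card N\<close> at each of its points.\<close>

lemma small_density_empty:
  assumes N: "finite N" and A: "A \<subseteq> X" "dens A \<lesssim>\<^sub>N (\<lambda>_ _. c)" and c: "c < 1 / card N"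
  shows "A = {}"
proof -
  have N0: "card N > 0" using N N_one by (auto simp: card_gt_0_iff)
  define e where "e = (1 / card N - c) / 2"
  have e: "e > 0" "c + e < 1 / card N" using c by (auto simp: e_def field_simps)
  then have "ev (\<lambda>F x. dens A F x \<le> c + e)" using A(2) by (simp add: lesim_def)
  then obtain K d where K: "K \<subseteq> N" "d > 0" "\<And>F x. Folner K d F \<Longrightarrow> x \<in> X \<Longrightarrow> dens A F x \<le> c + e"
    unfolding ev_def by blast
  have "inner_boundary K N = {}" using K(1) by (auto simp: inner_boundary_def)
  then have "Folner K d N" using N K(2) N_one by (auto simp: Folner_def)
  then have small: "dens A N x < 1 / card N" if "x \<in> X" for x using K(3)[of N x] that e(2) by simp
  show ?thesis
  proof (rule ccontr)
    assume "A \<noteq> {}"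
    then obtain x where x: "x \<in> A" by blast
    then have xX: "x \<in> X" using A by blast
    then have "real (card {t \<in> N. \<phi> t x \<in> A}) < 1" using small[OF xX] N0 by (simp add: dens_def divide_less_cancel)
    then have "card {t \<in> N. \<phi> t x \<in> A} = 0" by simp
    then have "{t \<in> N. \<phi> t x \<in> A} = {}" using N by simp
    then show False using x xX N_one by auto
  qed
qed


lemma column_shape_cong:
  assumes T: "T \<subseteq> N" and eq: "\<And>j t. j \<le> 2 * h \<Longrightarrow> t \<in> T \<Longrightarrow>
    \<phi> (\<gamma> (int j)) (\<phi> t v) \<in> W \<longleftrightarrow> \<phi> (\<gamma> (int j)) (\<phi> t w) \<in> W" and vw: "v \<in> X" "w \<in> X"
  shows "column_shape h W T v = column_shape h W T w"
proof -
  have 0: "\<phi> t v \<in> W \<longleftrightarrow> \<phi> t w \<in> W" if "t \<in> T" for t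
  proof -
    have "t \<in> carrier G" using T that by auto
    then show ?thesis using eq[of 0 t] that vw by simp
  qed
  have "in_column h W (\<phi> t v) j = in_column h W (\<phi> t w) j" if "t \<in> T" for t j
    unfolding in_column_def using eq[OF _ that] by (intro conj_cong ball_cong refl) auto
  then show ?thesis unfolding column_shape_def using 0 by (intro Collect_cong ex_cong1 conj_cong refl) auto
qed

text \<open>If two columns met at different heights, the marker of the lower height would lie
  strictly above the other marker inside that one's column, which \<open>in_column\<close> forbids.
  At equal heights \<open>\<gamma>\<close> can be cancelled.\<close>

lemma in_column_unique:
  assumes w: "w \<in> W" "w' \<in> W" "W \<subseteq> X" and c: "in_column h W w j" "in_column h W w' j'"
    and eq: "\<phi> (\<gamma> (int j)) w = \<phi> (\<gamma> (int j')) w'"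
  shows "j = j' \<and> w = w'"
proof -
  have no: False if a: "u \<in> W" "u' \<in> W" "in_column h W u' k'" "k < k'" "\<phi> (\<gamma> (int k)) u = \<phi> (\<gamma> (int k')) u'" for u u' k k'
  proof -
    have uX: "u \<in> X" "u' \<in> X" using a w(3) by auto
    have "u = \<phi> (\<gamma> (- int k)) (\<phi> (\<gamma> (int k)) u)" using uX by (simp add: act_gam)
    also have "\<dots> = \<phi> (\<gamma> (int (k' - k))) u'" using a uX by (simp add: act_gam of_nat_diff)
    finally have "\<phi> (\<gamma> (int (k' - k))) u' \<in> W" using a(1) by simp
    moreover have "k' - k \<in> {1..k'}" using a(4) by auto
    ultimately show False using a(3) unfolding in_column_def by blast
  qed
  have "j = j'" using no[OF w(1,2) c(2) _ eq] no[OF w(2,1) c(1) _ eq[symmetric]] by (metis nat_neq_iff)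
  moreover have "w \<in> X" "w' \<in> X" using w by auto
  ultimately show ?thesis using eq act_inj[OF gam_closed] by metis
qed

text \<open>A column system whose shape over \<open>v\<close> is not Folner forces many points of the tile of \<open>v\<close> into
  the set where the marker set or the tiling has an \<open>N\<close>-boundary; the latter has small density.\<close>

lemma column_castle_exists:
  assumes n: "n \<ge> (1::nat)" and K: "finite K" "K \<subseteq> carrier G" and d: "\<delta> > 0" and hf: "\<eta> > 0"
  obtains h :: nat and I :: "nat set" and T V and J :: "(nat \<times> 'g set \<times> nat) set" and U where
    "castle G X \<phi> J (\<lambda>p. fst (snd p)) U"
    "\<And>p. p \<in> J \<Longrightarrow> Folner_invariant G K \<delta> (fst (snd p))"
    "\<And>p. p \<in> J \<Longrightarrow> openin (top_of_set X) (U p)"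
    "\<And>p s v w. p \<in> J \<Longrightarrow> s \<in> fst (snd p) \<Longrightarrow> v \<in> U p \<Longrightarrow> w \<in> U p \<Longrightarrow> dist (\<phi> s v) (\<phi> s w) < \<delta>"
    "\<And>p. p \<in> J \<Longrightarrow> fst p \<in> I \<and> U p \<subseteq> V (fst p)"
    "\<And>p q x. p \<in> J \<Longrightarrow> q \<in> J \<Longrightarrow> fst p = fst q \<Longrightarrow> x \<in> U p \<Longrightarrow> x \<in> U q \<Longrightarrow> p = q"
    "\<And>p s. p \<in> J \<Longrightarrow> s \<in> fst (snd p) \<Longrightarrow> \<exists>j\<le>2 * h. \<exists>t\<in>N. s = \<gamma> (int j) \<otimes> t"
    "castle G X \<phi> I T V" "\<And>i. i \<in> I \<Longrightarrow> T i \<subseteq> N"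
    "\<And>i. i \<in> I \<Longrightarrow> infinite N \<Longrightarrow> 4 * n * (2 * h + 1) \<le> card (T i)"
    "dens (X - tiles J (\<lambda>p. fst (snd p)) U) \<lesssim>\<^sub>N (\<lambda>_ _. \<eta>)"
proof -
  define kk where "kk = real (card K) + 1"
  have kk: "kk > 0" "card K \<le> kk" by (auto simp: kk_def)
  let ?\<Gamma> = "(\<lambda>(a, b). a \<otimes> inv b) ` (K \<times> K)"
  have \<Gamma>: "finite ?\<Gamma>" "?\<Gamma> \<subseteq> carrier G" using K by auto
  obtain L0 and k0 :: nat where L0: "finite L0" "L0 \<subseteq> N"
    "\<And>a. a \<in> ?\<Gamma> \<Longrightarrow> \<exists>l\<in>L0. \<exists>k. \<bar>k\<bar> \<le> int k0 \<and> a = l \<otimes> \<gamma> k"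
    by (rule finite_decomposition[OF \<Gamma>]) (rule that)
  \<comment> \<open>The ends of a column cost at most \<open>2 * k0\<close> boundary elements, times
    \<open>card K\<close>, while a column has at least \<open>h + 1\<close> elements. With this
    \<open>h\<close> the ends consume at most half of the allowance
    \<open>\<delta> * card S\<close>.\<close>
  obtain h :: nat where "4 * kk * k0 / \<delta> < h" using reals_Archimedean2 by blast
  then have h: "4 * kk * k0 \<le> \<delta> * (real h + 1)" using d by (simp add: field_simps)
  define L1 where "L1 = (\<Union>p\<in>{..2 * h}. (\<lambda>l. inv (\<gamma> (int p)) \<otimes> l \<otimes> \<gamma> (int p)) ` L0)"
  define L2 where "L2 = (\<Union>i\<in>{..2 * h}. (\<lambda>l. \<gamma> (int i) \<otimes> l \<otimes> inv (\<gamma> (int i))) ` L1)"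
  have L1: "finite L1" "L1 \<subseteq> N" using L0 N_conj' by (auto simp: L1_def)
  have L2: "finite L2" "L2 \<subseteq> N" using L1 N_conj by (auto simp: L2_def)
  define q where "q = real (2 * h + 1)"
  have q: "q > 0" by (simp add: q_def)
  \<comment> \<open>In a shape that is not invariant, the other half of the allowance is exceeded by
    bad positions, each costing at most \<open>q\<close> elements, times \<open>kk\<close>. Solving
    for the number of markers in the tile gives the factor \<open>b\<close>.\<close>
  define b where "b = 2 * q * kk / \<delta>"
  have b: "b > 0" using q kk d by (simp add: b_def)
  \<comment> \<open>The permitted density of bad positions. Markers under non-invariant shapes then
    have density at most \<open>b * \<omega>\<close>, and the \<open>q\<close> heights above them
    use up \<open>\<eta> / 4\<close>.\<close>
  define \<omega> where "\<omega> = \<eta> / (4 * q * b)"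
  have \<omega>: "\<omega> > 0" "q * (b * \<omega>) = \<eta> / 4" using hf q b by (auto simp: \<omega>_def)
  have pos: "\<eta> / 4 > 0" "\<omega> / (2 * q) > 0" "\<eta> / (4 * q) > 0" using hf \<omega> q by auto
  obtain W where W: "reg W" "dens (bd L2 W) \<lesssim>\<^sub>N (\<lambda>_ _. \<omega> / (2 * q))" "W \<subseteq> X"
    and sep: "\<And>x k. x \<in> W \<Longrightarrow> k \<in> ks h \<Longrightarrow> \<phi> (\<gamma> k) x \<notin> W"
    and cov: "dens {x \<in> X. \<forall>k. \<bar>k\<bar> \<le> int h \<longrightarrow> \<phi> (\<gamma> k) x \<notin> W} \<lesssim>\<^sub>N (\<lambda>_ _. \<eta> / 4)"
    by (rule marker_exists[OF pos(1) L2 pos(2), of h]) (rule that)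
  \<comment> \<open>For infinite \<open>N\<close>, a test set of \<open>\<tau>\<close> elements
    forces shapes of at least \<open>\<tau>\<close> elements. The value makes the rounding loss
    \<open>n * (2 * h + 1) / \<tau>\<close> of the final count equal to 1/4.\<close>
  define \<tau> where "\<tau> = 4 * n * (2 * h + 1)"
  have "\<exists>K'\<subseteq>N. finite K' \<and> (infinite N \<longrightarrow> card K' = \<tau>)"
    using infinite_arbitrarily_large[of N \<tau>] by (cases "finite N") auto
  then obtain K' where K': "K' \<subseteq> N" "finite K'" "infinite N \<Longrightarrow> card K' = \<tau>" by blast
  define \<delta>2 where "\<delta>2 = min (\<omega> / 2) (1 / real \<tau>)"
  have \<tau>: "\<tau> > 0" using n by (simp add: \<tau>_def)
  have \<delta>2: "\<delta>2 > 0" "\<delta>2 \<le> \<omega> / 2" "\<delta>2 * \<tau> \<le> 1" using \<omega> \<tau> by (auto simp: \<delta>2_def min_def field_simps)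
  have K2: "finite (L1 \<union> K')" "L1 \<union> K' \<subseteq> N" using L1 K' by auto
  show thesis
  proof (rule reg_castle_exists[OF K2 \<delta>2(1) pos(3)], goal_cases)
    case (1 I T V)
    note c = 1(1) and fol = 1(2) and rgV = 1(3) and R = 1(4)
    note fin = castle_fin[OF c]
    have TN: "T i \<subseteq> N" if "i \<in> I" for i using fol[OF that] by (auto simp: Folner_def)
    have large: "4 * n * (2 * h + 1) \<le> card (T i)" if "i \<in> I" "infinite N" for i
    proof -
      have "card K' \<le> card (L1 \<union> K')" using K2 by (intro card_mono) auto
      then have "\<tau> \<le> card (L1 \<union> K')" using K'(3)[OF that(2)] by simp
      from Folner_large[OF fol[OF that(1)] K2 this \<delta>2(3)] show ?thesis by (simp add: \<tau>_def)
    qed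
    define E where "E = (\<Union>i\<in>I. (\<lambda>(j, t). \<gamma> (int j) \<otimes> t) ` ({..2 * h} \<times> T i))"
    have E: "finite E" "E \<subseteq> carrier G" using fin TN by (auto simp: E_def subset_iff)
    obtain r where r: "r > 0" "\<And>s v w. s \<in> E \<Longrightarrow> v \<in> X \<Longrightarrow> w \<in> X \<Longrightarrow> dist v w < r \<Longrightarrow> dist (\<phi> s v) (\<phi> s w) < \<delta>"
      by (rule uniformly_equicontinuous[OF E d]) (rule that)
    obtain \<kappa> :: "'x \<Rightarrow> nat" and qc where k: "\<And>x. x \<in> X \<Longrightarrow> \<kappa> x < qc" "\<And>c. reg {x \<in> X. \<kappa> x = c}"
      "\<And>x y. x \<in> X \<Longrightarrow> y \<in> X \<Longrightarrow> \<kappa> x = \<kappa> y \<Longrightarrow> dist x y < r" by (rule small_code[OF r(1)]) (rule that)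
    define shp where "shp = (\<lambda>i v. column_shape h W (T i) v)"
    have shpE: "shp i v \<subseteq> E" if "i \<in> I" for i v
      using column_shape_sub[of h W "T i" v] that unfolding shp_def E_def by blast
    define J where "J = {p \<in> I \<times> Pow E \<times> {..<qc}. Folner_invariant G K \<delta> (fst (snd p))}"
    \<comment> \<open>Bases are split by the column shape they see and by a code cell: on each piece
      the shape is constant, and cells smaller than \<open>r\<close> keep distances within a level
      below \<open>\<delta>\<close>. Passing from \<open>B p\<close> to \<open>U p\<close> makes the
      pieces open at the price of boundaries of density zero.\<close>
    define B where "B = (\<lambda>p. {v \<in> V (fst p). shp (fst p) v = fst (snd p) \<and> \<kappa> v = snd (snd p)})"
    define U where "U = (\<lambda>p. B p \<inter> X - fr (B p))"
    have finJ: "finite J" using fin E by (auto simp: J_def)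
    have UB: "U p \<subseteq> B p" for p by (auto simp: U_def)
    have J: "fst p \<in> I" "fst (snd p) \<subseteq> E" if "p \<in> J" for p using that by (auto simp: J_def)
    have Sj: "\<exists>j\<le>2 * h. \<exists>t\<in>N. s = \<gamma> (int j) \<otimes> t" if ps: "p \<in> J" "s \<in> fst (snd p)" for p s
    proof -
      have "s \<in> E" using J ps by blast
      then obtain i j t where "i \<in> I" "j \<le> 2 * h" "t \<in> T i" "s = \<gamma> (int j) \<otimes> t" by (auto simp: E_def)
      then show ?thesis using TN by blast
    qed
    have castJ: "castle G X \<phi> J (\<lambda>p. fst (snd p)) U"
    proof (rule castleI)
      fix p p' s s' v v'
      assume p: "p \<in> J" "p' \<in> J" "s \<in> fst (snd p)" "s' \<in> fst (snd p')" "v \<in> U p" "v' \<in> U p'" "\<phi> s v = \<phi> s' v'"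
      have "v \<in> B p" "v' \<in> B p'" using p(5,6) UB[of p] UB[of p'] by blast+
      then have v: "v \<in> V (fst p)" "shp (fst p) v = fst (snd p)" "\<kappa> v = snd (snd p)"
        and v': "v' \<in> V (fst p')" "shp (fst p') v' = fst (snd p')" "\<kappa> v' = snd (snd p')"
        by (simp_all add: B_def)
      have I: "fst p \<in> I" "fst p' \<in> I" using J p by auto
      have "s \<in> column_shape h W (T (fst p)) v" using v(2) p(3) by (simp add: shp_def)
      then obtain j t where jt: "s = \<gamma> (int j) \<otimes> t" "t \<in> T (fst p)" "\<phi> t v \<in> W" "in_column h W (\<phi> t v) j"
        by (rule column_shapeE)
      have "s' \<in> column_shape h W (T (fst p')) v'" using v'(2) p(4) by (simp add: shp_def)
      then obtain j' t' where jt': "s' = \<gamma> (int j') \<otimes> t'" "t' \<in> T (fst p')" "\<phi> t' v' \<in> W" "in_column h W (\<phi> t' v') j'"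
        by (rule column_shapeE)
      have cc: "t \<in> carrier G" "t' \<in> carrier G" "v \<in> X" "v' \<in> X" using jt(2) jt'(2) TN I v v' fin(4) by blast+
      have "\<phi> (\<gamma> (int j)) (\<phi> t v) = \<phi> (\<gamma> (int j')) (\<phi> t' v')" using p(7) jt jt' cc by (simp add: act_mult)
      then have w: "j = j'" "\<phi> t v = \<phi> t' v'" using in_column_unique[OF jt(3) jt'(3) W(3) jt(4) jt'(4)] by auto
      then have "fst p = fst p' \<and> t = t' \<and> v = v'" using castle_unique[OF c I jt(2) jt'(2) v(1) v'(1)] by blast
      then show "p = p' \<and> s = s'" using w jt jt' v v' by (metis prod.collapse)
    next
      fix p assume "p \<in> J"
      then show "finite (fst (snd p))" "fst (snd p) \<subseteq> carrier G" using J E by (blast intro: finite_subset)+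
    qed (use finJ in \<open>auto simp: U_def\<close>)
    have regB: "reg (B p)" if p: "p \<in> J" for p
    proof -
      let ?G = "insert (\<one>, V (fst p)) (insert (\<one>, {x \<in> X. \<kappa> x = snd (snd p)})
        ((\<lambda>(j, t). (\<gamma> (int j) \<otimes> t, W)) ` ({..2 * h} \<times> T (fst p))))"
      have I: "fst p \<in> I" using J p by auto
      show ?thesis
      proof (rule reg_determined[of ?G])
        show "finite ?G" using fin(2)[OF I] by auto
        show "a \<in> carrier G \<and> reg A" if "(a, A) \<in> ?G" for a A
          using that rgV[OF I] k(2) W(1) fin(3)[OF I] by auto
        fix x y assume xy: "x \<in> X" "y \<in> X" and eq: "\<And>a A. (a, A) \<in> ?G \<Longrightarrow> (\<phi> a x \<in> A) = (\<phi> a y \<in> A)"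
        have 1: "x \<in> V (fst p) \<longleftrightarrow> y \<in> V (fst p)" using eq[of \<one> "V (fst p)"] xy by simp
        have 2: "\<kappa> x = snd (snd p) \<longleftrightarrow> \<kappa> y = snd (snd p)"
          using eq[of \<one> "{x \<in> X. \<kappa> x = snd (snd p)}"] xy by simp
        have "shp (fst p) x = shp (fst p) y" unfolding shp_def
        proof (rule column_shape_cong[OF TN[OF I] _ xy])
          fix j t assume jt: "j \<le> 2 * h" "t \<in> T (fst p)"
          then have "(\<gamma> (int j) \<otimes> t, W) \<in> ?G" by force
          then have "(\<phi> (\<gamma> (int j) \<otimes> t) x \<in> W) = (\<phi> (\<gamma> (int j) \<otimes> t) y \<in> W)" by (rule eq)
          moreover have "t \<in> carrier G" using jt fin(3)[OF I] by blast
          ultimately show "(\<phi> (\<gamma> (int j)) (\<phi> t x) \<in> W) = (\<phi> (\<gamma> (int j)) (\<phi> t y) \<in> W)"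
            using xy by (simp add: act_mult)
        qed
        then show "(x \<in> B p) = (y \<in> B p)" unfolding B_def using 1 2 by auto
      qed
    qed
    define Z where "Z = {x. \<exists>i\<in>I. \<exists>t\<in>T i. \<exists>v\<in>V i. x = \<phi> t v \<and> (\<exists>l\<in>L1. l \<otimes> t \<notin> T i)}"
    have dZ: "dens Z \<lesssim>\<^sub>N (\<lambda>_ _. \<omega> / 2)"
    proof (rule castle_average_const[OF c TN])
      show "Z \<subseteq> tiles I T V" unfolding Z_def mem_tiles subset_iff by blast
      fix i v assume i: "i \<in> I" and v: "v \<in> V i"
      have "{t \<in> T i. \<phi> t v \<in> Z} \<subseteq> inner_boundary (L1 \<union> K') (T i)"
      proof
        fix t assume t: "t \<in> {t \<in> T i. \<phi> t v \<in> Z}"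
        then obtain i' t' v' where i': "i' \<in> I" "t' \<in> T i'" "v' \<in> V i'" "\<phi> t v = \<phi> t' v'"
          "\<exists>l\<in>L1. l \<otimes> t' \<notin> T i'"
          unfolding Z_def mem_Collect_eq by (elim conjE exE bexE) metis
        then have "i = i' \<and> t = t' \<and> v = v'" using castle_unique[OF c, of i i' t t' v v'] i t v by simp
        then show "t \<in> inner_boundary (L1 \<union> K') (T i)" using i'(5) t by (auto simp: inner_boundary_def)
      qed
      then have "card {t \<in> T i. \<phi> t v \<in> Z} \<le> card (inner_boundary (L1 \<union> K') (T i))"
        using fin(2)[OF i] by (intro card_mono) (auto simp: inner_boundary_def)
      also have "\<dots> \<le> \<delta>2 * card (T i)" using fol[OF i] by (simp add: Folner_def)
      also have "\<dots> \<le> \<omega> / 2 * card (T i)" using \<delta>2(2) by (rule mult_right_mono) simp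
      finally show "card {t \<in> T i. \<phi> t v \<in> Z} \<le> \<omega> / 2 * card (T i)" by simp
    qed (use \<omega> in simp_all)
    define \<Omega> where "\<Omega> = Z \<union> (\<Union>j\<in>{..2 * h}. tr (inv (\<gamma> (int j))) (bd L2 W))"
    have "dens (\<Union>j\<in>{..2 * h}. tr (inv (\<gamma> (int j))) (bd L2 W)) \<lesssim>\<^sub>N (\<lambda>_ _. \<Sum>j\<in>{..2 * h}. \<omega> / (2 * q))"
      using W(2) by (intro dens_UN_const dens_tr_le_const) auto
    from dens_Un_const[OF dZ this]
    have d\<Omega>: "dens \<Omega> \<lesssim>\<^sub>N (\<lambda>_ _. \<omega>)" using q unfolding \<Omega>_def
      by (elim dens_le_mono) (auto simp: q_def field_simps)
    \<comment> \<open>Markers under shapes that are not invariant. In one tile either there are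
      none, or all its markers count, and the choice of \<open>h\<close> and \<open>b\<close> bounds
      them by \<open>b\<close> times the positions in \<open>\<Omega>\<close>.\<close>
    define Q where "Q = {x. \<exists>i\<in>I. \<exists>t\<in>T i. \<exists>v\<in>V i. x = \<phi> t v \<and> x \<in> W \<and> \<not> Folner_invariant G K \<delta> (shp i v)}"
    have "dens Q \<lesssim>\<^sub>N (\<lambda>F x. b * dens \<Omega> F x)"
    proof (rule castle_average[OF c TN])
      show "Q \<subseteq> tiles I T V" unfolding Q_def mem_tiles subset_iff by blast
      fix i v assume i: "i \<in> I" and v: "v \<in> V i"
      let ?D = "{t \<in> T i. \<phi> t v \<in> \<Omega>}" and ?w = "{t \<in> T i. \<phi> t v \<in> W}"
      have vX: "v \<in> X" using v fin(4)[OF i] by blast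
      have Qi: "t \<in> ?w \<and> \<not> Folner_invariant G K \<delta> (shp i v)" if t: "t \<in> {t \<in> T i. \<phi> t v \<in> Q}" for t
      proof -
        obtain i' t' v' where i': "i' \<in> I" "t' \<in> T i'" "v' \<in> V i'" "\<phi> t v = \<phi> t' v'"
          "\<phi> t v \<in> W" "\<not> Folner_invariant G K \<delta> (shp i' v')"
          using t unfolding Q_def mem_Collect_eq by (elim conjE exE bexE) metis
        then have "i = i' \<and> t = t' \<and> v = v'" using castle_unique[OF c, of i i' t t' v v'] i t v by simp
        then show ?thesis using i' t by simp
      qed
      show "card {t \<in> T i. \<phi> t v \<in> Q} \<le> b * card ?D"
      proof (cases "Folner_invariant G K \<delta> (shp i v)")
        case True
        then have "{t \<in> T i. \<phi> t v \<in> Q} = {}" using Qi by blast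
        then have "card {t \<in> T i. \<phi> t v \<in> Q} = 0" by (simp only: card.empty)
        then show ?thesis using b by simp
      next
        case False
        let ?S = "shp i v"
        have S: "finite ?S" "?S \<subseteq> carrier G" using shpE[OF i] E by (auto intro: finite_subset)
        have cQ: "card {t \<in> T i. \<phi> t v \<in> Q} \<le> card ?w" using Qi fin(2)[OF i] by (intro card_mono) auto
        have "(h + 1) * card ?w \<le> card ?S"
          using card_column_shape_ge[OF fin(2)[OF i] TN[OF i] sep, where v = v] unfolding shp_def by simp
        then have "real ((h + 1) * card ?w) \<le> card ?S" by (simp only: of_nat_le_iff)
        then have 1: "(real h + 1) * card ?w \<le> card ?S" by (simp add: algebra_simps)
        have "card (inner_boundary ?\<Gamma> ?S) \<le> 2 * k0 * card ?w + (2 * h + 1) * card ?D"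
          unfolding shp_def
        proof (rule card_inner_boundary_column_shape[OF fin(2)[OF i] TN[OF i] vX L0(3) L0(2) _ L1(2)])
          show "inv (\<gamma> (int p)) \<otimes> l \<otimes> \<gamma> (int p) \<in> L1" if "l \<in> L0" "p \<le> 2 * h" for l p
            using that by (auto simp: L1_def)
          show "\<gamma> (int i) \<otimes> l \<otimes> inv (\<gamma> (int i)) \<in> L2" if "l \<in> L1" "i \<le> 2 * h" for l i
            using that by (auto simp: L2_def)
          fix t assume t: "t \<in> T i" "t \<notin> ?D"
          show "l \<otimes> t \<in> T i" if "l \<in> L1" for l
          proof (rule ccontr)
            assume "l \<otimes> t \<notin> T i"
            then have "\<phi> t v \<in> Z" using that i t(1) v unfolding Z_def by blast
            then show False using t by (simp add: \<Omega>_def)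
          qed
          show "\<phi> (\<gamma> (int j)) (\<phi> t v) \<notin> bd L2 W" if "j \<le> 2 * h" for j
          proof
            assume "\<phi> (\<gamma> (int j)) (\<phi> t v) \<in> bd L2 W"
            moreover have "\<phi> t v \<in> X" using t(1) TN[OF i] vX by auto
            ultimately have "\<phi> t v \<in> tr (inv (\<gamma> (int j))) (bd L2 W)" by (simp add: mem_tr_inv)
            then show False using t that by (auto simp: \<Omega>_def)
          qed
        qed auto
        then have "card K * card (inner_boundary ?\<Gamma> ?S) \<le> card K * (2 * k0 * card ?w + (2 * h + 1) * card ?D)"
          by (rule mult_le_mono2)
        with card_Folner_boundary_le[OF K S]
        have "card (Folner_boundary G K ?S) \<le> card K * (2 * k0 * card ?w + (2 * h + 1) * card ?D)" by linarith
        then have "real (card (Folner_boundary G K ?S)) \<le> real (card K * (2 * k0 * card ?w + (2 * h + 1) * card ?D))"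
          by (simp only: of_nat_le_iff)
        also have "\<dots> = card K * (2 * k0 * real (card ?w) + q * card ?D)" by (simp add: q_def distrib_right)
        also have "\<dots> \<le> kk * (2 * k0 * real (card ?w) + q * card ?D)"
          using kk(2) q by (intro mult_right_mono) auto
        finally have "\<delta> * card ?S < kk * (2 * k0 * real (card ?w) + q * card ?D)"
          using False unfolding Folner_invariant_def by linarith
        moreover have "\<delta> * ((real h + 1) * card ?w) \<le> \<delta> * card ?S" using 1 d by (intro mult_left_mono) auto
        moreover have "4 * kk * k0 * card ?w \<le> \<delta> * (real h + 1) * card ?w" using h by (rule mult_right_mono) simp
        ultimately have "\<delta> * (real h + 1) * card ?w \<le> 2 * (kk * (q * card ?D))"
          by (simp add: algebra_simps)
        moreover have "\<delta> * card ?w \<le> \<delta> * (real h + 1) * card ?w" using d by (simp add: algebra_simps)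
        ultimately have "\<delta> * card ?w \<le> 2 * (kk * (q * card ?D))" by linarith
        then have "card ?w \<le> b * card ?D" using d by (simp add: b_def field_simps)
        then show ?thesis using cQ by linarith
      qed
    qed (use b in simp_all)
    also have "\<dots> \<lesssim>\<^sub>N (\<lambda>_ _. b * \<omega>)" by (rule lesim_cmult[OF d\<Omega>]) (use b in simp)
    finally have dQ: "dens Q \<lesssim>\<^sub>N (\<lambda>_ _. b * \<omega>)" .
    \<comment> \<open>The four reasons for a point to be uncovered: no marker at most
      \<open>2 * h\<close> steps below it; a marker outside the tiles; a marker under a
      non-invariant shape; a base point on the boundary of its piece.\<close>
    define A1 where "A1 = tr (\<gamma> (int h)) {x \<in> X. \<forall>k. \<bar>k\<bar> \<le> int h \<longrightarrow> \<phi> (\<gamma> k) x \<notin> W}"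
    define A2 where "A2 = (\<Union>j\<in>{..2 * h}. tr (\<gamma> (int j)) (X - tiles I T V))"
    define A3 where "A3 = (\<Union>j\<in>{..2 * h}. tr (\<gamma> (int j)) Q)"
    define A4 where "A4 = (\<Union>p\<in>J. \<Union>s\<in>fst (snd p). tr s (fr (B p)))"
    have d1: "dens A1 \<lesssim>\<^sub>N (\<lambda>_ _. \<eta> / 4)" unfolding A1_def using cov by (intro dens_tr_le_const) auto
    have d2: "dens A2 \<lesssim>\<^sub>N (\<lambda>_ _. \<Sum>j\<in>{..2 * h}. \<eta> / (4 * q))"
      unfolding A2_def using R by (intro dens_UN_const dens_tr_le_const) auto
    have d3: "dens A3 \<lesssim>\<^sub>N (\<lambda>_ _. \<Sum>j\<in>{..2 * h}. b * \<omega>)"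
      unfolding A3_def using dQ by (intro dens_UN_const dens_tr_le_const) auto
    have d4: "dens A4 \<lesssim>\<^sub>N (\<lambda>_ _. \<Sum>p\<in>J. \<Sum>s\<in>fst (snd p). 0)"
      unfolding A4_def
    proof (intro dens_UN_const dens_tr_le_const finJ)
      fix p assume p: "p \<in> J"
      show "finite (fst (snd p))" using J(2)[OF p] E(1) by (rule finite_subset)
      show "dens (fr (B p)) \<lesssim>\<^sub>N (\<lambda>_ _. 0)" using regB[OF p] by (simp add: reg_def)
      show "s \<in> carrier G" if "s \<in> fst (snd p)" for s using J(2)[OF p] E(2) that by blast
    qed
    have rem: "X - tiles J (\<lambda>p. fst (snd p)) U \<subseteq> A1 \<union> A2 \<union> (A3 \<union> A4)"
    proof
      fix x assume "x \<in> X - tiles J (\<lambda>p. fst (snd p)) U"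
      then have x: "x \<in> X" "x \<notin> tiles J (\<lambda>p. fst (snd p)) U" by auto
      show "x \<in> A1 \<union> A2 \<union> (A3 \<union> A4)"
      proof (rule ccontr)
        assume neg: "\<not> ?thesis"
        have "\<exists>j. j \<le> 2 * h \<and> \<phi> (\<gamma> (- int j)) x \<in> W"
        proof -
          let ?y = "\<phi> (\<gamma> (- int h)) x"
          have "x \<notin> A1" using neg by blast
          then have "?y \<notin> {x \<in> X. \<forall>k. \<bar>k\<bar> \<le> int h \<longrightarrow> \<phi> (\<gamma> k) x \<notin> W}"
            using x(1) unfolding A1_def by (simp add: tr_def gam_minus)
          then obtain k where k: "\<bar>k\<bar> \<le> int h" "\<phi> (\<gamma> k) ?y \<in> W" using x(1) by auto
          have "k - int h = - int (nat (int h - k))" using k by simp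
          then have "\<phi> (\<gamma> (- int (nat (int h - k)))) x \<in> W" using k x(1) by (simp add: act_gam)
          moreover have "nat (int h - k) \<le> 2 * h" using k by linarith
          ultimately show ?thesis by blast
        qed
        \<comment> \<open>The least \<open>j\<close> gives the nearest marker below
          \<open>x\<close>; no further marker occurs on the way up, so \<open>x\<close> belongs to
          the column over it.\<close>
        then obtain j where j: "j \<le> 2 * h" "\<phi> (\<gamma> (- int j)) x \<in> W"
          and min: "\<And>i. i < j \<Longrightarrow> \<not> (i \<le> 2 * h \<and> \<phi> (\<gamma> (- int i)) x \<in> W)"
          using exists_least_iff[of "\<lambda>j. j \<le> 2 * h \<and> \<phi> (\<gamma> (- int j)) x \<in> W"] by blast
        let ?w = "\<phi> (\<gamma> (- int j)) x"
        have wX: "?w \<in> X" "\<phi> (\<gamma> (int j)) ?w = x" using x(1) by (auto simp: act_gam)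
        have trw: "x \<in> tr (\<gamma> (int j)) C" if "?w \<in> C" for C using that x(1) by (simp add: tr_def gam_minus)
        have inc: "in_column h W ?w j"
          unfolding in_column_def
        proof (intro conjI ballI)
          fix i assume i: "i \<in> {1..j}"
          have "\<phi> (\<gamma> (int i)) ?w = \<phi> (\<gamma> (- int (j - i))) x"
            using i x(1) by (simp add: act_gam of_nat_diff)
          then show "\<phi> (\<gamma> (int i)) ?w \<notin> W" using min[of "j - i"] i j(1) by auto
        qed (rule j(1))
        have "x \<notin> A2" using neg by blast
        then have "?w \<in> tiles I T V" using trw[of "X - tiles I T V"] wX(1) j(1) unfolding A2_def by blast
        then obtain i t v where it: "i \<in> I" "t \<in> T i" "v \<in> V i" "?w = \<phi> t v" by (auto simp: mem_tiles)
        have cc: "t \<in> carrier G" "v \<in> X" using TN it fin(4) by blast+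
        let ?s = "\<gamma> (int j) \<otimes> t" and ?p = "(i, shp i v, \<kappa> v)"
        have s: "?s \<in> shp i v" unfolding shp_def
          using j(2) inc it by (intro column_shapeI[OF refl it(2)]) simp_all
        have "x \<notin> A3" using neg by blast
        then have "?w \<notin> Q" using trw[of Q] j(1) unfolding A3_def by blast
        then have "Folner_invariant G K \<delta> (shp i v)" using it j(2) unfolding Q_def by blast
        then have pJ: "?p \<in> J" using it(1) shpE k(1)[OF cc(2)] by (auto simp: J_def)
        have xs: "x = \<phi> ?s v" using cc wX(2) it(4) by (simp add: act_mult)
        then have xt: "x \<in> tr ?s C" if "v \<in> C" for C using that cc by (simp add: mem_tr_act)
        have "x \<notin> A4" using neg by blast
        then have "v \<notin> fr (B ?p)" using xt[of "fr (B ?p)"] pJ s unfolding A4_def by fastforce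
        moreover have "v \<in> B ?p" using it by (simp add: B_def)
        ultimately have "v \<in> U ?p" using cc by (simp add: U_def)
        then have "x \<in> tiles J (\<lambda>p. fst (snd p)) U"
          unfolding mem_tiles using pJ s xs by (intro bexI[of _ ?p] bexI[of _ ?s] bexI[of _ v]) auto
        then show False using x(2) by simp
      qed
    qed
    have "\<eta> / 4 + (\<Sum>j\<in>{..2 * h}. \<eta> / (4 * q)) + ((\<Sum>j\<in>{..2 * h}. b * \<omega>) + (\<Sum>p\<in>J. \<Sum>s\<in>fst (snd p). 0)) \<le> \<eta>"
    proof -
      have "(\<Sum>j\<in>{..2 * h}. \<eta> / (4 * q)) = q * (\<eta> / (4 * q))" by (simp add: q_def)
      also have "\<dots> = \<eta> / 4" using q by simp
      finally have 1: "(\<Sum>j\<in>{..2 * h}. \<eta> / (4 * q)) = \<eta> / 4" .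
      have "(\<Sum>j\<in>{..2 * h}. b * \<omega>) = q * (b * \<omega>)" by (simp add: q_def)
      then have 2: "(\<Sum>j\<in>{..2 * h}. b * \<omega>) = \<eta> / 4" using \<omega>(2) by (simp only:)
      show ?thesis unfolding 1 2 using hf by simp
    qed
    then have rd: "dens (X - tiles J (\<lambda>p. fst (snd p)) U) \<lesssim>\<^sub>N (\<lambda>_ _. \<eta>)"
      using rem by (intro dens_le_mono[OF dens_Un_const[OF dens_Un_const[OF d1 d2] dens_Un_const[OF d3 d4]]]) auto
    show ?case
    proof (rule that[OF castJ _ _ _ _ _ Sj c TN large rd])
      show "Folner_invariant G K \<delta> (fst (snd p))" if "p \<in> J" for p using that by (simp add: J_def)
      show "openin (top_of_set X) (U p)" for p unfolding U_def by (rule openin_minus_fr)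
      show "dist (\<phi> s v) (\<phi> s w) < \<delta>" if a: "p \<in> J" "s \<in> fst (snd p)" "v \<in> U p" "w \<in> U p" for p s v w
      proof (rule r(2))
        show "s \<in> E" using J a by blast
        show vw: "v \<in> X" "w \<in> X" using a by (auto simp: U_def)
        have "v \<in> B p" "w \<in> B p" using a UB[of p] by blast+
        then show "dist v w < r" by (intro k(3) vw) (simp add: B_def)
      qed
      show "fst p \<in> I \<and> U p \<subseteq> V (fst p)" if "p \<in> J" for p
        using J(1)[OF that] UB[of p] unfolding B_def by blast
      show "p = p'" if "p \<in> J" "p' \<in> J" "fst p = fst p'" "x \<in> U p" "x \<in> U p'" for p p' x
      proof -
        have "x \<in> B p" "x \<in> B p'" using that(4,5) UB[of p] UB[of p'] by blast+
        then have "snd p = snd p'" using that(3) by (simp add: B_def prod_eq_iff)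
        then show ?thesis using that(3) by (simp add: prod_eq_iff)
      qed
    qed
  qed
qed


section \<open>Densities of column castles and the final comparison\<close>

lemma sum_columns:
  assumes A: "\<And>j. j \<in> {..m} \<Longrightarrow> finite (A j) \<and> A j \<subseteq> N"
  shows "sum f (\<Union>j\<in>{..m}. (\<lambda>t. \<gamma> (int j) \<otimes> t) ` A j) = (\<Sum>j\<in>{..m}. \<Sum>t\<in>A j. f (\<gamma> (int j) \<otimes> t))"
proof -
  have "sum f (\<Union>j\<in>{..m}. (\<lambda>t. \<gamma> (int j) \<otimes> t) ` A j) = (\<Sum>j\<in>{..m}. sum f ((\<lambda>t. \<gamma> (int j) \<otimes> t) ` A j))"
  proof (rule sum.UNION_disjoint)
    show "\<forall>i\<in>{..m}. \<forall>j\<in>{..m}. i \<noteq> j \<longrightarrow>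
      (\<lambda>t. \<gamma> (int i) \<otimes> t) ` A i \<inter> (\<lambda>t. \<gamma> (int j) \<otimes> t) ` A j = {}"
    proof (intro ballI impI)
      fix i j assume ij: "i \<in> {..m}" "j \<in> {..m}" "i \<noteq> j"
      have "\<gamma> (int i) \<otimes> s \<noteq> \<gamma> (int j) \<otimes> t" if "s \<in> A i" "t \<in> A j" for s t
        using gam_unique[of "int i" s "int j" t] A[OF ij(1)] A[OF ij(2)] that ij(3) by auto
      then show "(\<lambda>t. \<gamma> (int i) \<otimes> t) ` A i \<inter> (\<lambda>t. \<gamma> (int j) \<otimes> t) ` A j = {}" by blast
    qed
  qed (use A in auto)
  also have "\<dots> = (\<Sum>j\<in>{..m}. \<Sum>t\<in>A j. f (\<gamma> (int j) \<otimes> t))"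
  proof (rule sum.cong[OF refl])
    fix j assume j: "j \<in> {..m}"
    have "inj_on (\<lambda>t. \<gamma> (int j) \<otimes> t) (A j)"
      using gam_unique A[OF j] by (intro inj_onI) blast
    then show "sum f ((\<lambda>t. \<gamma> (int j) \<otimes> t) ` A j) = (\<Sum>t\<in>A j. f (\<gamma> (int j) \<otimes> t))"
      by (simp add: sum.reindex)
  qed
  finally show ?thesis .
qed

text \<open>\<open>\<gamma> j\<close> may change densities, but
  \<open>\<gamma> j \<otimes> t\<close> equals \<open>\<gamma> j\<close> multiplied on the left by a
  conjugate of \<open>t\<close>, which lies in \<open>N\<close>. So over one base all levels of the
  same height have the same density, and levels must be counted height by height.\<close>

lemma dens_columns:
  assumes c: "castle G X \<phi> J S U"
    and S: "\<And>p. p \<in> J \<Longrightarrow> S p = (\<Union>j\<in>{..m}. (\<lambda>t. \<gamma> (int j) \<otimes> t) ` A p j)"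
    and A: "\<And>p j. p \<in> J \<Longrightarrow> j \<in> {..m} \<Longrightarrow> finite (A p j) \<and> A p j \<subseteq> N"
  shows "dens (tiles J S U) \<lesssim>\<^sub>N (\<lambda>F x. \<Sum>p\<in>J. \<Sum>j\<in>{..m}. card (A p j) * dens (tr (\<gamma> (int j)) (U p)) F x)"
    (is "_ \<lesssim>\<^sub>N ?R")
    and "(\<lambda>F x. \<Sum>p\<in>J. \<Sum>j\<in>{..m}. card (A p j) * dens (tr (\<gamma> (int j)) (U p)) F x) \<lesssim>\<^sub>N dens (tiles J S U)"
proof -
  note fin = castle_fin[OF c]
  let ?L = "\<lambda>F x. \<Sum>p\<in>J. \<Sum>j\<in>{..m}. \<Sum>t\<in>A p j. dens (tr (\<gamma> (int j) \<otimes> t) (U p)) F x"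
  let ?M = "\<lambda>F x. \<Sum>p\<in>J. \<Sum>j\<in>{..m}. \<Sum>t\<in>A p j. dens (tr (\<gamma> (int j)) (U p)) F x"
  have RM: "?R = ?M" by simp
  have L: "dens (tiles J S U) F x = ?L F x" if F: "finite F" "F \<subseteq> N" "x \<in> X" for F x
  proof -
    have "dens (tiles J S U) F x = (\<Sum>p\<in>J. \<Sum>s\<in>S p. dens (tr s (U p)) F x)"
      using dens_castle[OF c F, of UNIV] fin by (simp add: sum.Sigma)
    also have "\<dots> = ?L F x"
      by (rule sum.cong[OF refl], subst S, assumption, rule sum_columns[OF A])
    finally show ?thesis .
  qed
  have tr: "tr (\<gamma> (int j) \<otimes> t) B = tr (\<gamma> (int j) \<otimes> t \<otimes> inv (\<gamma> (int j))) (tr (\<gamma> (int j)) B)" if "t \<in> N" for j t B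
    using that by (simp add: tr_tr m_assoc)
  have "?L \<lesssim>\<^sub>N ?M"
  proof (intro lesim_sum)
    fix p j t assume "p \<in> J" "j \<in> {..m}" "t \<in> A p j"
    then have t: "t \<in> N" using A by blast
    show "dens (tr (\<gamma> (int j) \<otimes> t) (U p)) \<lesssim>\<^sub>N dens (tr (\<gamma> (int j)) (U p))"
      unfolding tr[OF t] by (rule dens_translate) (intro N_conj t gam_closed)
  qed (use fin A in auto)
  then show "dens (tiles J S U) \<lesssim>\<^sub>N ?R"
    unfolding RM by (rule le_lesim[rotated]) (simp only: L)
  have "?M \<lesssim>\<^sub>N ?L"
  proof (intro lesim_sum)
    fix p j t assume "p \<in> J" "j \<in> {..m}" "t \<in> A p j"
    then have t: "t \<in> N" using A by blast
    show "dens (tr (\<gamma> (int j)) (U p)) \<lesssim>\<^sub>N dens (tr (\<gamma> (int j) \<otimes> t) (U p))"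
      unfolding tr[OF t] by (rule dens_translate') (intro N_conj t gam_closed)
  qed (use fin A in auto)
  then show "?R \<lesssim>\<^sub>N dens (tiles J S U)"
    unfolding RM by (rule lesim_le) (simp only: L)
qed

text \<open>Tiles are disjoint and have at least \<open>\<tau>\<close> points, so the bases together
  have density at most \<open>1 / \<tau>\<close>. The constant bound on the whole sum survives
  translation by \<open>a\<close> through \<open>ev_conjugate\<close>.\<close>

lemma dens_bases:
  assumes c: "castle G X \<phi> I T V" and N: "\<And>i. i \<in> I \<Longrightarrow> T i \<subseteq> N"
    and \<tau>: "\<tau> > 0" "\<And>i. i \<in> I \<Longrightarrow> \<tau> \<le> card (T i)" and a: "a \<in> carrier G"
  shows "(\<lambda>F x. \<Sum>i\<in>I. dens (tr a (V i)) F x) \<lesssim>\<^sub>N (\<lambda>_ _. 1 / real \<tau>)"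
proof -
  note fin = castle_fin[OF c]
  have "(\<lambda>F x. real \<tau> * (\<Sum>i\<in>I. dens (V i) F x)) \<lesssim>\<^sub>N (\<lambda>F x. \<Sum>(i, t)\<in>Sigma I T. dens {v \<in> V i. \<phi> t v \<in> UNIV} F x)"
  proof (rule lesim_all)
    fix F x
    have "real \<tau> * (\<Sum>i\<in>I. dens (V i) F x) \<le> (\<Sum>i\<in>I. card (T i) * dens (V i) F x)"
      unfolding sum_distrib_left using \<tau>(2) by (intro sum_mono mult_right_mono dens_nonneg) auto
    then show "real \<tau> * (\<Sum>i\<in>I. dens (V i) F x) \<le> (\<Sum>(i, t)\<in>Sigma I T. dens {v \<in> V i. \<phi> t v \<in> UNIV} F x)"
      using fin by (simp add: sum.Sigma[symmetric])
  qed
  also have "\<dots> \<lesssim>\<^sub>N dens (UNIV \<inter> tiles I T V)" by (rule dens_castle_lesim(2)[OF c N])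
  also have "\<dots> \<lesssim>\<^sub>N (\<lambda>_ _. 1)" by (rule lesim_all) (rule dens_le1)
  finally have "(\<lambda>F x. (1 / real \<tau>) * (real \<tau> * (\<Sum>i\<in>I. dens (V i) F x))) \<lesssim>\<^sub>N (\<lambda>_ _. (1 / real \<tau>) * 1)"
    by (rule lesim_cmult) simp
  then have *: "(\<lambda>F x. \<Sum>i\<in>I. dens (V i) F x) \<lesssim>\<^sub>N (\<lambda>_ _. 1 / real \<tau>)" using \<tau>(1) by simp
  show ?thesis unfolding lesim_def
  proof (intro allI impI)
    fix e :: real assume "e > 0"
    then have "ev (\<lambda>F x. (\<Sum>i\<in>I. dens (V i) F x) \<le> 1 / real \<tau> + e)" using * by (simp add: lesim_def)
    from ev_conjugate[OF a this] show "ev (\<lambda>F x. (\<Sum>i\<in>I. dens (tr a (V i)) F x) \<le> 1 / real \<tau> + e)"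
      by (rule ev_mono) (simp add: dens_conjugate[OF a])
  qed
qed

lemma almost_finiteI:
  assumes "\<And>(n::nat) K (\<delta>::real). n \<ge> 1 \<Longrightarrow> finite K \<Longrightarrow> K \<subseteq> carrier G \<Longrightarrow> \<delta> > 0 \<Longrightarrow>
    \<exists>(J::'j set) S U S'. castle G X \<phi> J S U \<and> (\<forall>p\<in>J. openin (top_of_set X) (U p)) \<and>
      (\<forall>p\<in>J. Folner_invariant G K \<delta> (S p)) \<and>
      (\<forall>p\<in>J. \<forall>s\<in>S p. \<forall>v\<in>U p. \<forall>w\<in>U p. dist (\<phi> s v) (\<phi> s w) < \<delta>) \<and>
      (\<forall>p\<in>J. S' p \<subseteq> S p \<and> real (card (S' p)) \<le> real (card (S p)) / real n) \<and>
      subequivalent G X \<phi> (X - tiles J S U) (tiles J S' U)"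
  shows "almost_finite G X \<phi>"
  unfolding almost_finite_def
proof (intro allI impI, elim conjE)
  fix n :: nat and K :: "'g set" and \<delta> :: real assume n: "1 \<le> n" "finite K" "K \<subseteq> carrier G" "0 < \<delta>"
  \<comment> \<open>Distances below \<open>\<delta> / 2\<close> bound the diameter, a supremum, only
    weakly by \<open>\<delta> / 2\<close>; this is still strictly below
    \<open>\<delta>\<close>.\<close>
  then have d2: "\<delta> / 2 > 0" by simp
  obtain J :: "'j set" and S U S' where *: "castle G X \<phi> J S U \<and> (\<forall>p\<in>J. openin (top_of_set X) (U p)) \<and>
      (\<forall>p\<in>J. Folner_invariant G K (\<delta> / 2) (S p)) \<and>
      (\<forall>p\<in>J. \<forall>s\<in>S p. \<forall>v\<in>U p. \<forall>w\<in>U p. dist (\<phi> s v) (\<phi> s w) < \<delta> / 2) \<and>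
      (\<forall>p\<in>J. S' p \<subseteq> S p \<and> real (card (S' p)) \<le> real (card (S p)) / real n) \<and>
      subequivalent G X \<phi> (X - tiles J S U) (tiles J S' U)"
    using assms[OF n(1-3) d2] by (elim exE) (rule that)
  note c = *[THEN conjunct1] and op = *[THEN conjunct2, THEN conjunct1]
    and fol = *[THEN conjunct2, THEN conjunct2, THEN conjunct1]
    and dia = *[THEN conjunct2, THEN conjunct2, THEN conjunct2, THEN conjunct1]
    and S' = *[THEN conjunct2, THEN conjunct2, THEN conjunct2, THEN conjunct2, THEN conjunct1]
    and sub = *[THEN conjunct2, THEN conjunct2, THEN conjunct2, THEN conjunct2, THEN conjunct2]
  define I where "I = {..<card J}"
  obtain f where "bij_betw f {0..<card J} J" using ex_bij_betw_nat_finite castle_fin(1)[OF c] by blast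
  then have f: "f ` I = J" "inj_on f I" by (auto simp: bij_betw_def I_def lessThan_atLeast0)
  have fJ: "f i \<in> J" if "i \<in> I" for i using f that by blast
  have til: "tiles I (\<lambda>i. S (f i)) (\<lambda>i. U (f i)) = tiles J S U" for S U
    unfolding tiles_def f(1)[symmetric] by simp
  have c': "castle G X \<phi> I (\<lambda>i. S (f i)) (\<lambda>i. U (f i))"
  proof (rule castleI)
    fix i j s t v w assume a: "i \<in> I" "j \<in> I" "s \<in> S (f i)" "t \<in> S (f j)" "v \<in> U (f i)" "w \<in> U (f j)" "\<phi> s v = \<phi> t w"
    have "f i = f j \<and> s = t" using castle_unique[OF c fJ[OF a(1)] fJ[OF a(2)] a(3-7)] by blast
    then show "i = j \<and> s = t" using f(2) a(1,2) by (auto dest: inj_onD)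
  qed (use castle_fin[OF c] fJ in \<open>auto simp: I_def\<close>)
  have "Folner_invariant G K \<delta> (S (f i))" if i: "i \<in> I" for i
  proof -
    have "\<delta> / 2 * real (card (S (f i))) \<le> \<delta> * real (card (S (f i)))" using n(4) by (intro mult_right_mono) auto
    then show ?thesis using fol fJ[OF i] unfolding Folner_invariant_def by fastforce
  qed
  moreover have "diameter (\<phi> s ` U (f i)) < \<delta>" if i: "i \<in> I" and s: "s \<in> S (f i)" for i s
  proof -
    have "diameter (\<phi> s ` U (f i)) \<le> \<delta> / 2"
    proof (cases "U (f i) = {}")
      case False
      have "dist (\<phi> s v) (\<phi> s w) \<le> \<delta> / 2" if "v \<in> U (f i)" "w \<in> U (f i)" for v w
        using dia fJ[OF i] s that by (simp add: less_imp_le)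
      then have le: "dist x y \<le> \<delta> / 2" if "x \<in> \<phi> s ` U (f i)" "y \<in> \<phi> s ` U (f i)" for x y using that by blast
      have "(SUP (x, y)\<in>\<phi> s ` U (f i) \<times> \<phi> s ` U (f i). dist x y) \<le> \<delta> / 2"
      proof (rule cSUP_least)
        show "\<phi> s ` U (f i) \<times> \<phi> s ` U (f i) \<noteq> {}" using False by simp
        show "(case z of (x, y) \<Rightarrow> dist x y) \<le> \<delta> / 2" if "z \<in> \<phi> s ` U (f i) \<times> \<phi> s ` U (f i)" for z
        proof -
          obtain x y where z: "z = (x, y)" "x \<in> \<phi> s ` U (f i)" "y \<in> \<phi> s ` U (f i)"
            using \<open>z \<in> _\<close> by (rule SigmaE)
          show ?thesis using le[OF z(2,3)] z(1) by simp
        qed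
      qed
      then show ?thesis using False by (simp add: diameter_def)
    qed (use n in simp)
    then show ?thesis using n(4) by simp
  qed
  ultimately show "\<exists>(I::nat set) S V S'.
        open_castle G X \<phi> I S V \<and>
        (\<forall>i\<in>I. Folner_invariant G K \<delta> (S i)) \<and>
        (\<forall>i\<in>I. \<forall>s\<in>S i. diameter (\<phi> s ` V i) < \<delta>) \<and>
        (\<forall>i\<in>I. S' i \<subseteq> S i \<and> real (card (S' i)) \<le> real (card (S i)) / real n) \<and>
        subequivalent G X \<phi>
          (X - (\<Union>i\<in>I. translates \<phi> (S i) (V i)))
          (\<Union>i\<in>I. translates \<phi> (S' i) (V i))"
    using c' op S' sub fJ
    by (intro exI[of _ I] exI[of _ "\<lambda>i. S (f i)"] exI[of _ "\<lambda>i. U (f i)"] exI[of _ "\<lambda>i. S' (f i)"])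
      (simp add: open_castle_def tiles_def[symmetric] til)
qed

text \<open>About an \<open>n\<close>-th part of the elements at each height is set aside. Up to
  rounding these levels carry an \<open>n\<close>-th of the density of the castle, more than the
  remainder has, so comparison under \<open>N\<close> alone moves the remainder into them.\<close>

lemma almost_finite_extension: "almost_finite G X \<phi>"
proof (rule almost_finiteI)
  fix n :: nat and K and \<delta> :: real
  assume n: "n \<ge> 1" and K: "finite K" "K \<subseteq> carrier G" and d: "\<delta> > 0"
  \<comment> \<open>The first bound leaves room for the density gap; the second pushes the density
    below \<open>1 / card N\<close> when \<open>N\<close> is finite, so that the remainder is
    empty.\<close>
  define \<eta> where "\<eta> = min (1 / (4 * real n)) (if finite N then 1 / (2 * real (card N)) else 1)"
  have cN: "card N > 0" if "finite N" using that N_one by (auto simp: card_gt_0_iff)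
  have hf: "\<eta> > 0" "\<eta> \<le> 1 / (4 * real n)" using n cN by (auto simp: \<eta>_def)
  have hfin: "\<eta> < 1 / card N" if "finite N"
  proof -
    have "\<eta> \<le> 1 / (2 * real (card N))" using that by (simp add: \<eta>_def)
    also have "\<dots> < 1 / card N" using cN[OF that] by (simp add: field_simps)
    finally show ?thesis .
  qed
  show "\<exists>(J::(nat \<times> 'g set \<times> nat) set) S U S'. castle G X \<phi> J S U \<and> (\<forall>p\<in>J. openin (top_of_set X) (U p)) \<and>
      (\<forall>p\<in>J. Folner_invariant G K \<delta> (S p)) \<and>
      (\<forall>p\<in>J. \<forall>s\<in>S p. \<forall>v\<in>U p. \<forall>w\<in>U p. dist (\<phi> s v) (\<phi> s w) < \<delta>) \<and>
      (\<forall>p\<in>J. S' p \<subseteq> S p \<and> real (card (S' p)) \<le> real (card (S p)) / real n) \<and>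
      subequivalent G X \<phi> (X - tiles J S U) (tiles J S' U)"
  proof (rule column_castle_exists[OF n K d hf(1)], goal_cases)
    case (1 h I T V J U)
    let ?S = "\<lambda>p::nat \<times> 'g set \<times> nat. fst (snd p)"
    note c = 1(1) and fol = 1(2) and op = 1(3) and dia = 1(4) and base = 1(5) and dis = 1(6)
      and form = 1(7) and cT = 1(8) and TN = 1(9) and large = 1(10) and R = 1(11)
    note fin = castle_fin[OF c]
    define A where "A = (\<lambda>p j. {t \<in> N. \<gamma> (int j) \<otimes> t \<in> ?S p})"
    have finA: "finite (A p j)" if "p \<in> J" for p j
    proof (rule finite_imageD)
      show "finite ((\<lambda>t. \<gamma> (int j) \<otimes> t) ` A p j)"
        using fin(2)[OF that] by (rule finite_subset[rotated]) (auto simp: A_def)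
      show "inj_on (\<lambda>t. \<gamma> (int j) \<otimes> t) (A p j)"
        using gam_unique by (intro inj_onI) (auto simp: A_def)
    qed
    have AN: "finite (A p j) \<and> A p j \<subseteq> N" if "p \<in> J" for p j using finA[OF that] by (auto simp: A_def)
    have SA: "?S p = (\<Union>j\<in>{..2 * h}. (\<lambda>t. \<gamma> (int j) \<otimes> t) ` A p j)" if p: "p \<in> J" for p
    proof (intro equalityI subsetI)
      fix s assume s: "s \<in> ?S p"
      obtain j t where "j \<le> 2 * h" "t \<in> N" "s = \<gamma> (int j) \<otimes> t" using form[OF p s] by blast
      then show "s \<in> (\<Union>j\<in>{..2 * h}. (\<lambda>t. \<gamma> (int j) \<otimes> t) ` A p j)" using s by (auto simp: A_def)
    qed (auto simp: A_def)
    \<comment> \<open>The share is taken at every height separately, since only levels of equal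
      height over a base are known to have equal density.\<close>
    have "\<exists>A'. A' \<subseteq> A p j \<and> card A' = card (A p j) div n" for p j
    proof -
      obtain A' where "A' \<subseteq> A p j" "card A' = card (A p j) div n"
        by (rule obtain_subset_with_card_n[OF div_le_dividend])
      then show ?thesis by blast
    qed
    then obtain A' where A': "\<And>p j. A' p j \<subseteq> A p j" "\<And>p j. card (A' p j) = card (A p j) div n" by metis
    have A'N: "finite (A' p j) \<and> A' p j \<subseteq> N" if "p \<in> J" for p j
      using AN[OF that, of j] A'(1)[of p j] by (meson finite_subset subset_trans)
    define S' where "S' = (\<lambda>p. \<Union>j\<in>{..2 * h}. (\<lambda>t. \<gamma> (int j) \<otimes> t) ` A' p j)"
    have S'S: "S' p \<subseteq> ?S p" if "p \<in> J" for p unfolding S'_def SA[OF that] using A'(1) by blast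
    have card_S': "real (card (S' p)) \<le> real (card (?S p)) / real n" if p: "p \<in> J" for p
    proof -
      have "card (S' p) = (\<Sum>j\<in>{..2 * h}. card (A' p j))"
        using sum_columns[of "2 * h" "A' p" "\<lambda>_. 1::nat"] A'N[OF p] by (simp add: S'_def)
      moreover have "card (?S p) = (\<Sum>j\<in>{..2 * h}. card (A p j))"
        using sum_columns[of "2 * h" "A p" "\<lambda>_. 1::nat"] AN[OF p] unfolding SA[OF p] by simp
      moreover have "real (card (A' p j)) \<le> real (card (A p j)) / real n" for j
      proof -
        have "real (card (A' p j) * n) \<le> real (card (A p j))"
          unfolding A'(2) of_nat_le_iff by (rule div_times_less_eq_dividend)
        then show ?thesis using n by (simp add: field_simps)
      qed
      ultimately show ?thesis by (simp add: sum_divide_distrib sum_mono)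
    qed
    have cS': "castle G X \<phi> J S' U" using c by (rule castle_sub) (use S'S in auto)
    let ?A = "X - tiles J ?S U" and ?B = "tiles J S' U"
    have cA: "closedin (top_of_set X) ?A" by (rule closedin_remainder[OF c op])
    have oB: "openin (top_of_set X) ?B" by (rule openin_tiles[OF cS' op])
    have sub: "subequivalent (G\<lparr>carrier := N\<rparr>) X \<phi> ?A ?B"
    proof (cases "finite N")
      case True
      have e: "?A = {}" by (rule small_density_empty[OF True _ R hfin[OF True]]) auto
      show ?thesis unfolding e by (rule subequivalent_empty)
    next
      case False
      define \<tau> where "\<tau> = 4 * n * (2 * h + 1)"
      have \<tau>: "\<tau> > 0" "\<And>i. i \<in> I \<Longrightarrow> \<tau> \<le> card (T i)" using n large False by (auto simp: \<tau>_def)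
      let ?D = "\<lambda>j p F x. dens (tr (\<gamma> (int j)) (U p)) F x"
      \<comment> \<open>Pieces cut from the same base are disjoint, so the rounding loss is governed
        by the old bases \<open>V i\<close>, however many pieces there are.\<close>
      have group: "(\<Sum>p\<in>J. ?D j p F x) \<le> (\<Sum>i\<in>I. dens (tr (\<gamma> (int j)) (V i)) F x)"
        if F: "finite F" "F \<subseteq> N" "x \<in> X" for j F x
      proof -
        have "(\<Sum>p\<in>J. ?D j p F x) = (\<Sum>i\<in>I. \<Sum>p\<in>{p \<in> J. fst p = i}. ?D j p F x)"
          using fin(1) castle_fin(1)[OF cT] base by (intro sum.group[symmetric]) auto
        also have "\<dots> \<le> (\<Sum>i\<in>I. dens (tr (\<gamma> (int j)) (V i)) F x)"
        proof (rule sum_mono)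
          fix i assume "i \<in> I"
          have "(\<Sum>p\<in>{p \<in> J. fst p = i}. ?D j p F x) = dens (\<Union>p\<in>{p \<in> J. fst p = i}. tr (\<gamma> (int j)) (U p)) F x"
          proof (rule dens_UN_disjoint[symmetric, OF _ F])
            fix p q y assume "p \<in> {p \<in> J. fst p = i}" "q \<in> {p \<in> J. fst p = i}"
              "y \<in> tr (\<gamma> (int j)) (U p)" "y \<in> tr (\<gamma> (int j)) (U q)"
            then show "p = q" using dis[of p q "\<phi> (inv (\<gamma> (int j))) y"] by (simp add: tr_def)
          qed (use fin(1) in simp)
          also have "\<dots> \<le> dens (tr (\<gamma> (int j)) (V i)) F x"
            using base by (intro dens_mono F) (fastforce simp: tr_def)
          finally show "(\<Sum>p\<in>{p \<in> J. fst p = i}. ?D j p F x) \<le> dens (tr (\<gamma> (int j)) (V i)) F x" .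
        qed
        finally show ?thesis .
      qed
      have bases: "(\<lambda>F x. \<Sum>j\<in>{..2 * h}. \<Sum>p\<in>J. ?D j p F x) \<lesssim>\<^sub>N (\<lambda>_ _. \<Sum>j\<in>{..2 * h}. 1 / real \<tau>)"
      proof (rule lesim_sum)
        fix j
        show "(\<lambda>F x. \<Sum>p\<in>J. ?D j p F x) \<lesssim>\<^sub>N (\<lambda>_ _. 1 / real \<tau>)"
          by (rule le_lesim[OF group dens_bases[OF cT TN \<tau> gam_closed]])
      qed simp
      have dB: "(\<lambda>F x. \<Sum>p\<in>J. \<Sum>j\<in>{..2 * h}. card (A' p j) * ?D j p F x) \<lesssim>\<^sub>N dens ?B"
        by (rule dens_columns(2)[OF cS']) (use A'N in \<open>auto simp: S'_def\<close>)
      have "dens (tiles J ?S U) \<lesssim>\<^sub>N (\<lambda>F x. \<Sum>p\<in>J. \<Sum>j\<in>{..2 * h}. card (A p j) * ?D j p F x)"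
        by (rule dens_columns(1)[OF c SA AN])
      also have "\<dots> \<lesssim>\<^sub>N (\<lambda>F x. real n * (\<Sum>p\<in>J. \<Sum>j\<in>{..2 * h}. card (A' p j) * ?D j p F x)
          + real n * (\<Sum>j\<in>{..2 * h}. \<Sum>p\<in>J. ?D j p F x))"
      proof (rule lesim_all)
        fix F x
        have le: "card (A p j) * ?D j p F x \<le> real n * (card (A' p j) * ?D j p F x) + real n * ?D j p F x" for p j
        proof -
          have "card (A p j) \<le> n * card (A' p j) + n"
            unfolding A'(2) using n mod_less_divisor[of n "card (A p j)"] mult_div_mod_eq[of n "card (A p j)"] by linarith
          then have "real (card (A p j)) \<le> real (n * card (A' p j) + n)" by (simp only: of_nat_le_iff)
          then have "real (card (A p j)) * ?D j p F x \<le> real (n * card (A' p j) + n) * ?D j p F x"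
            by (rule mult_right_mono) (rule dens_nonneg)
          then show ?thesis by (simp add: algebra_simps)
        qed
        have "(\<Sum>p\<in>J. \<Sum>j\<in>{..2 * h}. card (A p j) * ?D j p F x) \<le>
          (\<Sum>p\<in>J. \<Sum>j\<in>{..2 * h}. real n * (card (A' p j) * ?D j p F x) + real n * ?D j p F x)"
          by (intro sum_mono le)
        also have "\<dots> = real n * (\<Sum>p\<in>J. \<Sum>j\<in>{..2 * h}. card (A' p j) * ?D j p F x)
          + real n * (\<Sum>p\<in>J. \<Sum>j\<in>{..2 * h}. ?D j p F x)"
          by (simp add: sum.distrib sum_distrib_left)
        also have "(\<Sum>p\<in>J. \<Sum>j\<in>{..2 * h}. ?D j p F x) = (\<Sum>j\<in>{..2 * h}. \<Sum>p\<in>J. ?D j p F x)"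
          by (rule sum.swap)
        finally show "(\<Sum>p\<in>J. \<Sum>j\<in>{..2 * h}. card (A p j) * ?D j p F x) \<le>
          real n * (\<Sum>p\<in>J. \<Sum>j\<in>{..2 * h}. card (A' p j) * ?D j p F x)
          + real n * (\<Sum>j\<in>{..2 * h}. \<Sum>p\<in>J. ?D j p F x)" .
      qed
      also have "\<dots> \<lesssim>\<^sub>N (\<lambda>F x. real n * dens ?B F x + real n * (\<Sum>j\<in>{..2 * h}. 1 / real \<tau>))"
        by (intro lesim_add lesim_cmult dB bases) simp_all
      finally have dO: "dens (tiles J ?S U) \<lesssim>\<^sub>N (\<lambda>F x. real n * dens ?B F x + real n * (\<Sum>j\<in>{..2 * h}. 1 / real \<tau>))" .
      have "real n * (\<Sum>j\<in>{..2 * h}. 1 / real \<tau>) = real n * (real (2 * h + 1) * (1 / real \<tau>))" by simp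
      also have "\<dots> = 1 / 4"
      proof -
        have gen: "a * (b * (1 / (4 * a * b))) = 1 / 4" if "a \<noteq> 0" "b \<noteq> 0" for a b :: real
          using that by (simp add: field_simps)
        have \<tau>_eq: "real \<tau> = 4 * real n * real (2 * h + 1)"
          unfolding \<tau>_def by (simp only: of_nat_mult of_nat_numeral)
        have nz: "real n \<noteq> 0" "real (2 * h + 1) \<noteq> 0" using n by linarith+
        show ?thesis unfolding \<tau>_eq by (rule gen[OF nz])
      qed
      finally have quarter: "real n * (\<Sum>j\<in>{..2 * h}. 1 / real \<tau>) = 1 / 4" .
      have rn: "real n \<ge> 1" using n by simp
      have e: "1 / (16 * real n) > 0" using n by simp
      have ev1: "ev (\<lambda>F x. dens (tiles J ?S U) F x \<le> real n * dens ?B F x + 1 / 4 + 1 / 16)"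
        using dO unfolding quarter lesim_def by (elim allE[of _ "1/16"]) simp
      have ev2: "ev (\<lambda>F x. dens ?A F x \<le> \<eta> + 1 / (16 * real n))"
        using R e unfolding lesim_def by blast
      have "ev (\<lambda>F x. dens ?A F x + 1 / (16 * real n) \<le> dens ?B F x)"
      proof (rule ev_mono[OF ev_conj[OF ev1 ev2]])
        fix F x assume F: "finite F" "F \<noteq> {}" "F \<subseteq> N" "x \<in> X"
          and b: "dens (tiles J ?S U) F x \<le> real n * dens ?B F x + 1 / 4 + 1 / 16 \<and> dens ?A F x \<le> \<eta> + 1 / (16 * real n)"
        have "1 = dens X F x" using dens_X[OF F] by simp
        also have "\<dots> \<le> dens (?A \<union> tiles J ?S U) F x" using F by (intro dens_mono) auto
        also have "\<dots> \<le> dens ?A F x + dens (tiles J ?S U) F x" using F(1) by (rule dens_Un)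
        finally have 1: "1 \<le> dens ?A F x + dens (tiles J ?S U) F x" .
        \<comment> \<open>The remainder has density at most \<open>5 / (16 * n)\<close>, so the
          castle has at least 11/16. Rounding and error terms take 5/16 of this, leaving at least
          \<open>6 / (16 * n)\<close> for \<open>?B\<close> and a gap of
          \<open>1 / (16 * n)\<close>.\<close>
        have dA: "dens ?A F x \<le> 5 / (16 * real n)"
          using b hf(2) by (simp add: field_simps)
        also have "\<dots> \<le> 5 / 16" using rn by (simp add: field_simps)
        finally have "6 / 16 \<le> real n * dens ?B F x" using 1 b by simp
        then have "6 / (16 * real n) \<le> dens ?B F x" using rn by (simp add: field_simps)
        then show "dens ?A F x + 1 / (16 * real n) \<le> dens ?B F x" using dA rn by (simp add: field_simps)
      qed
      then show ?thesis by (rule comparison[OF cA oB e])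
    qed
    show ?case
    proof (intro exI conjI ballI)
      show "castle G X \<phi> J ?S U" by (rule c)
      show "subequivalent G X \<phi> ?A ?B" using sub by (rule subequivalent_carrier_mono)
    qed (use op fol dia S'S card_S' in auto)
  qed
qed

end

section \<open>Semidirect products by the integers\<close>

text \<open>Carries almost finiteness from \<open>H\<close> to its copy in the semidirect product.
  An isomorphism respects right translates and complements, hence Folner boundaries; all other data
  are translates by group elements.\<close>

lemma almost_finite_iso:
  assumes H: "group H" and K: "group K" and h: "h \<in> iso H K"
    and af: "almost_finite H X (\<lambda>t. \<phi> (h t))"
  shows "almost_finite K X \<phi>"
  unfolding almost_finite_def
proof (intro allI impI, elim conjE)
  fix n :: nat and C and \<delta> :: real
  assume n: "1 \<le> n" and C: "finite C" "C \<subseteq> carrier K" and d: "0 < \<delta>"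
  have hom: "h (a \<otimes>\<^bsub>H\<^esub> b) = h a \<otimes>\<^bsub>K\<^esub> h b" if "a \<in> carrier H" "b \<in> carrier H" for a b
    using h that by (auto simp: iso_def hom_def)
  have inj: "inj_on h (carrier H)" and im: "h ` carrier H = carrier K"
    using h by (auto simp: iso_def bij_betw_def)
  have hc: "h a \<in> carrier K" if "a \<in> carrier H" for a using im that by blast
  obtain C0 where C0: "C0 \<subseteq> carrier H" "finite C0" "C = h ` C0"
    using C im finite_subset_image[of C h "carrier H"] by auto
  obtain I :: "nat set" and S V S' where
    *: "open_castle H X (\<lambda>t. \<phi> (h t)) I S V \<and>
        (\<forall>i\<in>I. Folner_invariant H C0 \<delta> (S i)) \<and>
        (\<forall>i\<in>I. \<forall>s\<in>S i. diameter (\<phi> (h s) ` V i) < \<delta>) \<and>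
        (\<forall>i\<in>I. S' i \<subseteq> S i \<and> real (card (S' i)) \<le> real (card (S i)) / real n) \<and>
        subequivalent H X (\<lambda>t. \<phi> (h t))
          (X - (\<Union>i\<in>I. translates (\<lambda>t. \<phi> (h t)) (S i) (V i)))
          (\<Union>i\<in>I. translates (\<lambda>t. \<phi> (h t)) (S' i) (V i))"
    using af[unfolded almost_finite_def, rule_format, of n C0 \<delta>] n C0 d by blast
  have S: "S i \<subseteq> carrier H" "finite (S i)" if "i \<in> I" for i
    using * that by (auto simp: open_castle_def castle_def tower_def)
  have tr: "translates (\<lambda>t. \<phi> (h t)) T W = translates \<phi> (h ` T) W" for T W
    by (simp add: translates_def)
  have card: "card (h ` T) = card T" if "T \<subseteq> carrier H" for T
    using inj that by (meson card_image inj_on_subset)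
  have bd: "Folner_boundary K C (h ` T) = h ` Folner_boundary H C0 T" if T: "T \<subseteq> carrier H" for T
  proof -
    have eq: "C #>\<^bsub>K\<^esub> h t = h ` (C0 #>\<^bsub>H\<^esub> t)" if "t \<in> carrier H" for t
      using C0(1) that by (simp add: C0(3) r_coset_def image_UN hom subset_iff)
    have sub: "C0 #>\<^bsub>H\<^esub> t \<subseteq> carrier H" if "t \<in> carrier H" for t
      using C0(1) that monoid.m_closed[OF group.is_monoid[OF H]] by (auto simp: r_coset_def subset_iff)
    have 1: "h ` A \<inter> h ` T \<noteq> {} \<longleftrightarrow> A \<inter> T \<noteq> {}" if "A \<subseteq> carrier H" for A
      using inj that T by (auto simp: inj_on_def) blast
    have 2: "h ` A \<inter> (carrier K - h ` T) \<noteq> {} \<longleftrightarrow> A \<inter> (carrier H - T) \<noteq> {}" if "A \<subseteq> carrier H" for A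
    proof -
      have "carrier K - h ` T = h ` (carrier H - T)"
        using inj_on_image_set_diff[OF inj, of "carrier H" T] T im by simp
      moreover have "h ` A \<inter> h ` (carrier H - T) = h ` (A \<inter> (carrier H - T))"
        using inj_on_image_Int[OF inj, of A "carrier H - T"] that by blast
      ultimately show ?thesis by simp
    qed
    show ?thesis
    proof (intro equalityI subsetI)
      fix u assume u: "u \<in> Folner_boundary K C (h ` T)"
      then obtain t where t: "t \<in> carrier H" "u = h t" using im by (auto simp: Folner_boundary_def)
      then have "t \<in> Folner_boundary H C0 T"
        using u eq[OF t(1)] 1[OF sub[OF t(1)]] 2[OF sub[OF t(1)]] by (simp add: Folner_boundary_def)
      then show "u \<in> h ` Folner_boundary H C0 T" using t by blast
    next
      fix u assume "u \<in> h ` Folner_boundary H C0 T"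
      then obtain t where t: "t \<in> Folner_boundary H C0 T" "u = h t" by blast
      then have tH: "t \<in> carrier H" by (simp add: Folner_boundary_def)
      then show "u \<in> Folner_boundary K C (h ` T)"
        using t eq[OF tH] 1[OF sub[OF tH]] 2[OF sub[OF tH]] hc by (simp add: Folner_boundary_def)
    qed
  qed
  have tower: "tower K X \<phi> (h ` S i) (V i)" if i: "i \<in> I" for i
  proof -
    have t: "V i \<subseteq> X" "disjoint_family_on (\<lambda>s. \<phi> (h s) ` V i) (S i)"
      using * i by (auto simp: open_castle_def castle_def tower_def)
    have "disjoint_family_on (\<lambda>s. \<phi> s ` V i) (h ` S i)"
      unfolding disjoint_family_on_def
    proof (intro ballI impI)
      fix u u' assume "u \<in> h ` S i" "u' \<in> h ` S i" "u \<noteq> u'"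
      then obtain s s' where "s \<in> S i" "s' \<in> S i" "s \<noteq> s'" "u = h s" "u' = h s'" by blast
      then show "\<phi> u ` V i \<inter> \<phi> u' ` V i = {}" using t(2) unfolding disjoint_family_on_def by simp
    qed
    then show ?thesis using t(1) S[OF i] hc by (auto simp: tower_def)
  qed
  have "open_castle K X \<phi> I (\<lambda>i. h ` S i) V"
    using * tower unfolding open_castle_def castle_def tr by blast
  moreover have "Folner_invariant K C \<delta> (h ` S i)" if "i \<in> I" for i
  proof -
    have "Folner_boundary H C0 (S i) \<subseteq> carrier H" by (auto simp: Folner_boundary_def)
    then show ?thesis using * that S[OF that] by (simp add: Folner_invariant_def bd card)
  qed
  moreover have "\<forall>s\<in>h ` S i. diameter (\<phi> s ` V i) < \<delta>" if "i \<in> I" for i using * that by simp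
  moreover have "h ` S' i \<subseteq> h ` S i \<and> real (card (h ` S' i)) \<le> real (card (h ` S i)) / real n" if "i \<in> I" for i
  proof -
    have "S' i \<subseteq> S i" "real (card (S' i)) \<le> real (card (S i)) / real n" using * that by auto
    moreover from this have "S' i \<subseteq> carrier H" using S[OF that] by blast
    ultimately show ?thesis using S[OF that] by (auto simp: card)
  qed
  moreover have "subequivalent K X \<phi> A B" if sub: "subequivalent H X (\<lambda>t. \<phi> (h t)) A B" for A B
    unfolding subequivalent_def
  proof (intro allI impI)
    fix D assume "closedin (top_of_set X) D \<and> D \<subseteq> A"
    from sub[unfolded subequivalent_def, THEN spec, THEN mp, OF this]
    obtain m :: nat and U s where
      "\<forall>i<m. openin (top_of_set X) (U i) \<and> s i \<in> carrier H \<and> \<phi> (h (s i)) ` U i \<subseteq> B"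
      "D \<subseteq> (\<Union>i<m. U i)" "disjoint_family_on (\<lambda>i. \<phi> (h (s i)) ` U i) {..<m}"
      by (elim exE conjE) (rule that)
    then show "\<exists>(m::nat) U s.
        (\<forall>i<m. openin (top_of_set X) (U i) \<and> s i \<in> carrier K \<and> \<phi> (s i) ` U i \<subseteq> B) \<and>
        D \<subseteq> (\<Union>i<m. U i) \<and> disjoint_family_on (\<lambda>i. \<phi> (s i) ` U i) {..<m}"
      using hc by (intro exI[of _ m] exI[of _ U] exI[of _ "\<lambda>i. h (s i)"]) simp
  qed
  ultimately show "\<exists>(I::nat set) S V S'.
        open_castle K X \<phi> I S V \<and>
        (\<forall>i\<in>I. Folner_invariant K C \<delta> (S i)) \<and>
        (\<forall>i\<in>I. \<forall>s\<in>S i. diameter (\<phi> s ` V i) < \<delta>) \<and>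
        (\<forall>i\<in>I. S' i \<subseteq> S i \<and> real (card (S' i)) \<le> real (card (S i)) / real n) \<and>
        subequivalent K X \<phi>
          (X - (\<Union>i\<in>I. translates \<phi> (S i) (V i)))
          (\<Union>i\<in>I. translates \<phi> (S' i) (V i))"
    using * unfolding tr
    by (intro exI[of _ I] exI[of _ "\<lambda>i. h ` S i"] exI[of _ V] exI[of _ "\<lambda>i. h ` S' i"]) simp
qed

text \<open>The empty castle works. \<open>cyclic_extension\<close> assumes a nonempty space, so the
  theorem treats this case separately.\<close>

lemma almost_finite_empty: "almost_finite K {} \<phi>"
  unfolding almost_finite_def
  by (intro allI impI exI[of _ "{}::nat set"])
    (auto simp: open_castle_def castle_def disjoint_family_on_def intro: subequivalent_empty)

theorem theorem5p4:
  fixes H :: "('h, 'b) monoid_scheme"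
    and \<alpha> :: "'h \<Rightarrow> 'h"
    and X :: "'x::metric_space set"
    and \<phi> :: "'h \<times> int \<Rightarrow> 'x \<Rightarrow> 'x"
  assumes "group H"
    and "countable (carrier H)"
    and "\<alpha> \<in> auto H"
    and "free_continuous_action (semidirect_int H \<alpha>) X \<phi>"
    and "almost_finite H X (\<lambda>t. \<phi> (t, 0))"
  shows "almost_finite (semidirect_int H \<alpha>) X \<phi>"
proof (cases "X = {}")
  case False
  let ?G = "semidirect_int H \<alpha>" and ?N = "carrier H \<times> {0::int}"
  interpret H: group H by fact
  interpret A: group "AutoGroup H" using group.AutoGroup[OF assms(1)] .
  interpret act: free_continuous_action ?G X \<phi> by fact
  have grp: "group ?G" by (rule group_semidirect_int[OF assms(1,3)])
  have au: "\<alpha> [^]\<^bsub>AutoGroup H\<^esub> m \<in> auto H" for m :: int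
    using A.int_pow_closed[of \<alpha> m] assms(3) by (simp add: AutoGroup_def)
  have one: "(\<alpha> [^]\<^bsub>AutoGroup H\<^esub> m) \<one>\<^bsub>H\<^esub> = \<one>\<^bsub>H\<^esub>" for m :: int
    using au[of m] assms(1) by (auto simp: auto_def intro: hom_one)
  have zero: "\<one>\<^bsub>AutoGroup H\<^esub> t = t" if "t \<in> carrier H" for t
    using that by (simp add: AutoGroup_def BijGroup_def)
  have G: "carrier ?G = carrier H \<times> UNIV" "\<one>\<^bsub>?G\<^esub> = (\<one>\<^bsub>H\<^esub>, 0)"
    "(s, k) \<otimes>\<^bsub>?G\<^esub> (t, l) = (s \<otimes>\<^bsub>H\<^esub> (\<alpha> [^]\<^bsub>AutoGroup H\<^esub> k) t, k + l)" for s t k l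
    by (auto simp: semidirect_int_def semidirect_product_def)
  have "group_hom ?G integer_group snd"
    using grp group_integer_group unfolding group_hom_def group_hom_axioms_def
    by (auto simp: hom_def G)
  then have "kernel ?G integer_group snd \<lhd> ?G" by (rule group_hom.normal_kernel)
  moreover have "kernel ?G integer_group snd = ?N" by (auto simp: kernel_def G)
  ultimately have normal: "?N \<lhd> ?G" by simp
  have grpN: "group (?G\<lparr>carrier := ?N\<rparr>)"
    using subgroup.subgroup_is_group[OF normal_imp_subgroup[OF normal] grp] .
  have "(\<lambda>t. (t, 0)) \<in> iso H (?G\<lparr>carrier := ?N\<rparr>)"
    by (auto simp: iso_def hom_def bij_betw_def inj_on_def G zero)
  then have af: "almost_finite (?G\<lparr>carrier := ?N\<rparr>) X \<phi>"
    by (rule almost_finite_iso[OF assms(1) grpN _ assms(5)])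
  \<comment> \<open>\<open>N\<close> is the kernel of the projection to the integers, and
    \<open>(t, k)\<close> is the product of \<open>(t, 0)\<close> with the pair of the unit and
    \<open>k\<close>, because every power of \<open>\<alpha>\<close> fixes the unit.\<close>
  interpret cyclic_extension ?G ?N "\<lambda>k. (\<one>\<^bsub>H\<^esub>, k)" X \<phi>
  proof (intro cyclic_extension.intro cyclic_extension_axioms.intro grp normal af)
    show "X \<noteq> {}" by fact
    show "compact X" by (rule act.compact_space)
    show "continuous_on X (\<phi> a)" if "a \<in> carrier ?G" for a using act.continuous that by blast
    show "\<phi> a x \<in> X" if "a \<in> carrier ?G" "x \<in> X" for a x using act.element_image that by blast
    show "\<phi> (a \<otimes>\<^bsub>?G\<^esub> b) x = \<phi> a (\<phi> b x)" if "a \<in> carrier ?G" "b \<in> carrier ?G" "x \<in> X" for a b x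
      using act.composition_rule that by blast
    show "\<phi> \<one>\<^bsub>?G\<^esub> x = x" if "x \<in> X" for x using act.id_eq_one that by (metis restrict_apply')
    show "a = \<one>\<^bsub>?G\<^esub>" if "a \<in> carrier ?G" "x \<in> X" "\<phi> a x = x" for a x
      using act.free[OF that(2)] that unfolding stabilizer_def by blast
    show "\<exists>t\<in>?N. \<exists>k. a = t \<otimes>\<^bsub>?G\<^esub> (\<one>\<^bsub>H\<^esub>, k)" if "a \<in> carrier ?G" for a
    proof -
      obtain t k where "a = (t, k)" "t \<in> carrier H" using \<open>a \<in> carrier ?G\<close> by (auto simp: G)
      then have "(t, 0) \<in> ?N" "a = (t, 0) \<otimes>\<^bsub>?G\<^esub> (\<one>\<^bsub>H\<^esub>, k)" by (auto simp: G one zero)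
      then show ?thesis by blast
    qed
  qed (auto simp: G one)
  show ?thesis by (rule almost_finite_extension)
qed (use almost_finite_empty in simp)

end
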